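(* Let $\mathcal{E}$ be an $n$-dimensional complex evolution algebra which is complete and not nilpotent. Then $\mathcal{E}$ is isomorphic to one of the following pairwise non-isomorphic algebras: \[ \{e_1^2=e_1\}\oplus \mathbb{C}^{n-1}\qquad\text{or}\qquad \{e_1^2=e_1\}\oplus \widetilde{\mathcal{E}}\oplus \mathbb{C}^{n-s-1}, \] where $\widetilde{\mathcal{E}}$ is an $s$-dimensional evolution algebra with maximal index of nilpotency.
   Context: An evolution algebra over $\mathbb{C}$ is a $\mathbb{C}$-algebra $\mathcal{E}$ admitting a basis $\{e_1,\dots,e_n\}$ (a natural basis) such that $e_ie_j=0$ for all $i\neq j$. $\mathcal{E}$ is complete if every subalgebra of $\mathcal{E}$ admits a natural basis which can be extended to a natural basis of $\mathcal{E}$. $\{e_1^2=e_1\}$ denotes the one-dimensional evolution algebra spanned by $e_1$ with $e_1^2=e_1$; $\mathbb{C}^k$ denotes the $k$-dimensional zero evolution algebra (all products zero); $\oplus$ is the direct sum of algebras. Powers are defined by $\mathcal{E}^1=\mathcal{E}$ and $\mathcal{E}^k=\sum_{i=1}^{k-1}\mathcal{E}^i\mathcal{E}^{k-i}$; $\mathcal{E}$ is nilpotent if $\mathcal{E}^k=0$ for some $k$, and its index of nilpotency is the least such $k$. An $s$-dimensional evolution algebra has maximal index of nilpotency if it is nilpotent and its index of nilpotency is the largest possible among all $s$-dimensional nilpotent evolution algebras.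
   Formalization: The second family is restricted to 2 ≤ s ≤ n−1, because for s ≤ 1 the algebra Ẽ is zero or ℂ and the second algebra coincides with the first, so the list would not be pairwise non-isomorphic. *)

theory Defs
  imports Complex_Main
begin

text \<open>An n-dimensional complex algebra is modelled by structure constants
  c i j k (for i, j, k < n) acting on coordinate vectors nat => complex
  supported on indices below n.  Every n-dimensional complex algebra is
  isomorphic to one of this form.\<close>

type_synonym vec = "nat \<Rightarrow> complex"
type_synonym sconst = "nat \<Rightarrow> nat \<Rightarrow> nat \<Rightarrow> complex"

definition Vn :: "nat \<Rightarrow> vec set" where
  "Vn n = {v. \<forall>i\<ge>n. v i = 0}"

definition zv :: vec where "zv = (\<lambda>_. 0)"

definition vadd :: "vec \<Rightarrow> vec \<Rightarrow> vec" where
  "vadd x y = (\<lambda>k. x k + y k)"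

definition vscale :: "complex \<Rightarrow> vec \<Rightarrow> vec" where
  "vscale a x = (\<lambda>k. a * x k)"

definition mult :: "nat \<Rightarrow> sconst \<Rightarrow> vec \<Rightarrow> vec \<Rightarrow> vec" where
  "mult n c x y = (\<lambda>k. if k < n then (\<Sum>i<n. \<Sum>j<n. x i * y j * c i j k) else 0)"

definition vspan :: "vec set \<Rightarrow> vec set" where
  "vspan S = {v. \<exists>F a. finite F \<and> F \<subseteq> S \<and> v = (\<lambda>k. \<Sum>x\<in>F. a x * x k)}"

definition is_basis :: "nat \<Rightarrow> (nat \<Rightarrow> vec) \<Rightarrow> bool" where
  "is_basis n b \<longleftrightarrow> (\<forall>i<n. b i \<in> Vn n) \<and>
     (\<forall>v\<in>Vn n. \<exists>!a. (\<forall>i\<ge>n. a i = 0) \<and> v = (\<lambda>k. \<Sum>i<n. a i * b i k))"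

definition natural_basis :: "nat \<Rightarrow> sconst \<Rightarrow> (nat \<Rightarrow> vec) \<Rightarrow> bool" where
  "natural_basis n c b \<longleftrightarrow> is_basis n b \<and>
     (\<forall>i<n. \<forall>j<n. i \<noteq> j \<longrightarrow> mult n c (b i) (b j) = zv)"

definition is_evolution :: "nat \<Rightarrow> sconst \<Rightarrow> bool" where
  "is_evolution n c \<longleftrightarrow> (\<exists>b. natural_basis n c b)"

definition subalg :: "nat \<Rightarrow> sconst \<Rightarrow> vec set \<Rightarrow> bool" where
  "subalg n c S \<longleftrightarrow> S \<subseteq> Vn n \<and> zv \<in> S \<and>
     (\<forall>x\<in>S. \<forall>y\<in>S. vadd x y \<in> S \<and> mult n c x y \<in> S) \<and>
     (\<forall>a. \<forall>x\<in>S. vscale a x \<in> S)"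

text \<open>Complete: every subalgebra has a natural basis extendable to a natural
  basis of the whole algebra, i.e. it is spanned by a subfamily of some
  natural basis of the algebra.\<close>
definition complete_evo :: "nat \<Rightarrow> sconst \<Rightarrow> bool" where
  "complete_evo n c \<longleftrightarrow> (\<forall>S. subalg n c S \<longrightarrow>
     (\<exists>b I. natural_basis n c b \<and> I \<subseteq> {..<n} \<and> S = vspan (b ` I)))"

text \<open>powlist n c k = [E^1, ..., E^k], with E^1 = E and
  E^k = sum_{i=1}^{k-1} E^i E^{k-i}.\<close>
primrec powlist :: "nat \<Rightarrow> sconst \<Rightarrow> nat \<Rightarrow> vec set list" where
  "powlist n c 0 = []"
| "powlist n c (Suc k) = (let L = powlist n c k in
     if k = 0 then [Vn n]
     else L @ [vspan {mult n c x y | x y i. i < k \<and> x \<in> L ! i \<and> y \<in> L ! (k - 1 - i)}])"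

definition apow :: "nat \<Rightarrow> sconst \<Rightarrow> nat \<Rightarrow> vec set" where
  "apow n c k = powlist n c k ! (k - 1)"

definition nilpotent :: "nat \<Rightarrow> sconst \<Rightarrow> bool" where
  "nilpotent n c \<longleftrightarrow> (\<exists>k\<ge>1. apow n c k = {zv})"

definition nil_index :: "nat \<Rightarrow> sconst \<Rightarrow> nat" where
  "nil_index n c = (LEAST k. k \<ge> 1 \<and> apow n c k = {zv})"

definition max_nil_index :: "nat \<Rightarrow> sconst \<Rightarrow> bool" where
  "max_nil_index s d \<longleftrightarrow> is_evolution s d \<and> nilpotent s d \<and>
     (\<forall>d'. is_evolution s d' \<and> nilpotent s d' \<longrightarrow> nil_index s d' \<le> nil_index s d)"

definition alg_iso :: "nat \<Rightarrow> sconst \<Rightarrow> nat \<Rightarrow> sconst \<Rightarrow> bool" where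
  "alg_iso n c m d \<longleftrightarrow> (\<exists>f. bij_betw f (Vn n) (Vn m) \<and>
     (\<forall>x\<in>Vn n. \<forall>y\<in>Vn n. f (vadd x y) = vadd (f x) (f y) \<and>
                         f (mult n c x y) = mult m d (f x) (f y)) \<and>
     (\<forall>a. \<forall>x\<in>Vn n. f (vscale a x) = vscale a (f x)))"

definition dsum :: "nat \<Rightarrow> sconst \<Rightarrow> nat \<Rightarrow> sconst \<Rightarrow> sconst" where
  "dsum n1 c1 n2 c2 = (\<lambda>i j k.
     if i < n1 \<and> j < n1 \<and> k < n1 then c1 i j k
     else if n1 \<le> i \<and> n1 \<le> j \<and> n1 \<le> k then c2 (i - n1) (j - n1) (k - n1)
     else 0)"

definition idem1 :: sconst where "idem1 = (\<lambda>i j k. 1)"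
definition zero_alg :: sconst where "zero_alg = (\<lambda>i j k. 0)"

definition A1 :: "nat \<Rightarrow> sconst" where
  "A1 n = dsum 1 idem1 (n - 1) zero_alg"

definition A2 :: "nat \<Rightarrow> nat \<Rightarrow> sconst \<Rightarrow> sconst" where
  "A2 n s d = dsum 1 idem1 (s + (n - s - 1)) (dsum s d (n - s - 1) zero_alg)"

end

theory Submission
  imports "HOL-Library.Multiset" "HOL-Computational_Algebra.Fundamental_Theorem_Algebra" Defs
begin

text \<open>Let \<open>Z\<close> be the set of the vectors of a natural basis \<open>e\<^sub>i\<close> that square to zero. Completeness gives
  \<open>E = S + Ann S\<close> for every subalgebra \<open>S\<close>. Taking \<open>S\<close> spanned by an element of square zero, and square
  roots of coefficients, one finds that the nonzero \<open>e\<^sub>i\<^sup>2\<close> are linearly independent, and then that every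
  subalgebra containing \<open>Z\<close> is spanned by basis vectors. In particular, if \<open>J \<supseteq> Z\<close> spans an ideal
  and \<open>x\<^sup>2 = \<mu> x\<close> modulo \<open>J\<close>, then \<open>x\<close> is modulo \<open>J\<close> a multiple of one basis vector.

  Any nonzero quotient by such an ideal contains an eigenvector \<open>x \<noteq> 0\<close>, \<open>x\<^sup>2 = \<mu> x\<close>: if the squares of the
  basis vectors of the quotient are dependent one takes square roots again, and otherwise one has to solve a
  system \<open>x\<^sub>i\<^sup>2 = \<Sum>\<^sub>j b\<^sub>i\<^sub>j x\<^sub>j\<close> with invertible \<open>b\<close>. Its coordinate algebra has the square-free monomials as
  a basis, and the ideal generated by the \<open>x\<^sub>i\<close> equals its own square, hence is not nilpotent; so some
  \<open>x\<^sub>i\<close> acts with a nonzero eigenvalue, and a joint eigenvector of the dual action is a nonzero solution.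

  So \<open>Z\<close> extends one basis vector at a time to a chain of ideals. Solving further equations
  \<open>x\<^sup>2 = \<mu> x\<close> with \<open>x\<close> supported on two basis vectors shows that exactly one basis vector \<open>e\<close> has a loop, that
  it splits off as an idempotent, and that in the remaining chain each square has a nonzero coefficient at the
  preceding vector. This property characterises the maximal index of nilpotency \<open>2\<^sup>s\<^sup>-\<^sup>1 + 1\<close>.

  For the uniqueness part, the annihilator of an algebra with maximal index of nilpotency consists of
  squares, so the zero summand can be cancelled.\<close>

section \<open>Linear systems and quadratic eigenvectors\<close>

text \<open>Forward substitution. It serves to choose the annihilator corrections of the chain
  vectors in \<open>iso_A2\<close>.\<close>

lemma triangular_system_solution:
  fixes L :: "nat \<Rightarrow> nat \<Rightarrow> complex"
  assumes "\<And>p. p < m \<Longrightarrow> L p p \<noteq> 0"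
  shows "\<exists>c. \<forall>p<m. (\<Sum>j<Suc p. L p j * c j) = r p"
  using assms
proof (induction m)
  case (Suc m)
  then obtain c where c: "\<forall>p<m. (\<Sum>j<Suc p. L p j * c j) = r p" by auto
  let ?c = "c(m := (r m - (\<Sum>j<m. L m j * c j)) / L m m)"
  have old: "(\<Sum>j<l. L p j * ?c j) = (\<Sum>j<l. L p j * c j)" if "l \<le> m" for p l
    using that by (intro sum.cong) auto
  have "(\<Sum>j<Suc p. L p j * ?c j) = r p" if "p < Suc m" for p
  proof (cases "p = m")
    case True
    then show ?thesis using Suc.prems[of m] old[of m m] by simp
  next
    case False
    then show ?thesis using that c old[of "Suc p" p] by simp
  qed
  then show ?case by blast
qed simp

lemma sum_single:
  fixes h :: "nat \<Rightarrow> complex"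
  assumes "m < n" "\<And>l. l < n \<Longrightarrow> l \<noteq> m \<Longrightarrow> h l = 0"
  shows "(\<Sum>l<n. h l) = h m"
proof -
  have "(\<Sum>l<n. h l) = (\<Sum>l<n. if l = m then h m else 0)"
    using assms(2) by (intro sum.cong) auto
  then show ?thesis using assms(1) by simp
qed

text \<open>Gaussian elimination: a row \<open>v\<close> with a nonzero entry in column
  \<open>k\<close> clears that column from the other rows, which costs one row and one
  equation.\<close>

lemma homogeneous_system_nontrivial_solution:
  fixes a :: "'u \<Rightarrow> 'm \<Rightarrow> complex"
  assumes "finite M" "finite U" "card M < card U"
  shows "\<exists>y. (\<exists>u\<in>U. y u \<noteq> 0) \<and> (\<forall>k\<in>M. (\<Sum>u\<in>U. y u * a u k) = 0)"
  using assms
proof (induction M arbitrary: U a rule: finite_induct)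
  case empty
  then obtain u where "u \<in> U" by fastforce
  then show ?case by (intro exI[of _ "\<lambda>_. 1"]) auto
next
  case (insert k M)
  show ?case
  proof (cases "\<forall>u\<in>U. a u k = 0")
    case True
    obtain y where "\<exists>u\<in>U. y u \<noteq> 0" "\<forall>k\<in>M. (\<Sum>u\<in>U. y u * a u k) = 0"
      using insert.IH[of U a] insert.prems insert.hyps by auto
    with True show ?thesis by (intro exI[of _ y]) auto
  next
    case False
    then obtain v where v: "v \<in> U" "a v k \<noteq> 0" by blast
    define a' where "a' u l = a u l - a u k / a v k * a v l" for u l
    have "card M < card (U - {v})"
      using insert v by (simp add: card_insert_if)
    then obtain y where y: "\<exists>u\<in>U - {v}. y u \<noteq> 0"
        "\<forall>l\<in>M. (\<Sum>u\<in>U - {v}. y u * a' u l) = 0"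
      using insert.IH[of "U - {v}" a'] insert.prems by auto
    define c where "c = - (\<Sum>u\<in>U - {v}. y u * a u k) / a v k"
    define y' where "y' = y(v := c)"
    have split: "(\<Sum>u\<in>U. y' u * a u l) = c * a v l + (\<Sum>u\<in>U - {v}. y u * a u l)" for l
      using v insert.prems by (subst sum.remove[of U v]) (auto simp: y'_def intro!: sum.cong)
    have "(\<Sum>u\<in>U. y' u * a u l) = (\<Sum>u\<in>U - {v}. y u * a' u l)" for l
      unfolding split c_def a'_def
      by (simp add: algebra_simps sum_subtractf sum_distrib_left sum_distrib_right sum_divide_distrib)
    moreover have "(\<Sum>u\<in>U. y' u * a u k) = 0"
      unfolding split c_def using v by simp
    moreover have "\<exists>u\<in>U. y' u \<noteq> 0" using y(1) by (auto simp: y'_def)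
    ultimately show ?thesis using y(2) by (intro exI[of _ y']) auto
  qed
qed

text \<open>The vector \<open>v\<close> joins the rows as an extra row, indexed by
  \<open>None\<close>. There are then more rows than columns, hence a dependence, and independence
  of the old rows makes its coefficient at \<open>None\<close> nonzero.\<close>

lemma solve_of_independent_rows:
  fixes a :: "'m \<Rightarrow> 'm \<Rightarrow> complex"
  assumes "finite M"
    and ind: "\<And>y. (\<forall>k\<in>M. (\<Sum>i\<in>M. y i * a i k) = 0) \<Longrightarrow> \<forall>i\<in>M. y i = 0"
  shows "\<exists>y. \<forall>k\<in>M. (\<Sum>i\<in>M. y i * a i k) = v k"
proof -
  define a' where "a' u k = (case u of None \<Rightarrow> v k | Some i \<Rightarrow> a i k)" for u k
  have "\<exists>y. (\<exists>u\<in>insert None (Some ` M). y u \<noteq> 0) \<and>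
      (\<forall>k\<in>M. (\<Sum>u\<in>insert None (Some ` M). y u * a' u k) = 0)"
    using assms(1)
    by (intro homogeneous_system_nontrivial_solution) (auto simp: card_insert_if card_image)
  then obtain y where y: "\<exists>u\<in>insert None (Some ` M). y u \<noteq> 0"
    and "\<forall>k\<in>M. (\<Sum>u\<in>insert None (Some ` M). y u * a' u k) = 0" by blast
  then have *: "\<forall>k\<in>M. y None * v k + (\<Sum>i\<in>M. y (Some i) * a i k) = 0"
    using assms(1) by (simp add: sum.reindex a'_def)
  have "y None \<noteq> 0"
    using ind[of "\<lambda>i. y (Some i)"] * y by auto
  then have "(\<Sum>i\<in>M. (- y (Some i) / y None) * a i k) = v k" if "k \<in> M" for k
  proof -
    have "(\<Sum>i\<in>M. (- y (Some i) / y None) * a i k) = - (\<Sum>i\<in>M. y (Some i) * a i k) / y None"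
      by (simp add: sum_divide_distrib sum_negf)
    also have "\<dots> = v k"
      using * that \<open>y None \<noteq> 0\<close> by (simp add: field_simps add_eq_0_iff)
    finally show ?thesis .
  qed
  then show ?thesis by (intro exI[of _ "\<lambda>i. - y (Some i) / y None"]) blast
qed

section \<open>Polynomials as functionals on sequences\<close>

text \<open>The linear extension of sending the \<open>k\<close>-th power of the variable to
  \<open>s k\<close>. Below, \<open>s k\<close> is the value of a functional on a monomial
  multiplied by the \<open>k\<close>-th power of one variable.\<close>

definition seq_eval :: "complex poly \<Rightarrow> (nat \<Rightarrow> complex) \<Rightarrow> complex" where
  "seq_eval p s = (\<Sum>k\<le>degree p. coeff p k * s k)"

lemma seq_eval_eq: "degree p \<le> N \<Longrightarrow> seq_eval p s = (\<Sum>k\<le>N. coeff p k * s k)"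
  unfolding seq_eval_def by (rule sum.mono_neutral_left) (auto simp: coeff_eq_0)

text \<open>Multiplication by the variable shifts the sequence by one, so a linear factor acts as
  the shift minus its root.\<close>

lemma seq_eval_linear_factor:
  "seq_eval ([:- \<mu>, 1:] * q) s = seq_eval q (\<lambda>k. s (Suc k)) - \<mu> * seq_eval q s"
proof -
  let ?N = "degree q"
  have "degree ([:- \<mu>, 1:] * q) \<le> Suc ?N"
    by (rule order_trans[OF degree_mult_le]) auto
  then have "seq_eval ([:- \<mu>, 1:] * q) s = (\<Sum>k\<le>Suc ?N. coeff ([:- \<mu>, 1:] * q) k * s k)"
    by (rule seq_eval_eq)
  also have "\<dots> = (\<Sum>k\<le>Suc ?N. coeff (pCons 0 q) k * s k) - \<mu> * (\<Sum>k\<le>Suc ?N. coeff q k * s k)"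
    by (simp add: algebra_simps sum.distrib sum_subtractf sum_distrib_left del: sum.atMost_Suc)
  also have "(\<Sum>k\<le>Suc ?N. coeff (pCons 0 q) k * s k) = seq_eval q (\<lambda>k. s (Suc k))"
    unfolding seq_eval_def by (subst sum.atMost_Suc_shift) simp
  also have "(\<Sum>k\<le>Suc ?N. coeff q k * s k) = seq_eval q s"
    by (rule seq_eval_eq[symmetric]) simp
  finally show ?thesis .
qed

lemma seq_eval_monom: "seq_eval (monom c k) s = c * s k"
proof (cases "c = 0")
  case False
  then have "seq_eval (monom c k) s = (\<Sum>j\<le>k. if j = k then c * s k else 0)"
    unfolding seq_eval_def by (intro sum.cong) (auto simp: degree_monom_eq)
  then show ?thesis by simp
qed (simp add: seq_eval_def)

text \<open>Divide out the highest power of the variable. If the quotient were not constant, it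
  would have a root; that root is also one of \<open>p\<close>, hence 0, against the choice of the
  power.\<close>

lemma poly_only_root_zero_imp_monom:
  fixes p :: "complex poly"
  assumes "p \<noteq> 0" "\<And>\<mu>. poly p \<mu> = 0 \<Longrightarrow> \<mu> = 0"
  shows "\<exists>c k. c \<noteq> 0 \<and> p = monom c k"
proof -
  obtain q where q: "p = [:- 0, 1:] ^ order 0 p * q" "\<not> [:- 0, 1:] dvd q"
    using order_decomp[OF assms(1)] by blast
  have "degree q = 0"
  proof (rule ccontr)
    assume "degree q \<noteq> 0"
    then obtain z where z: "poly q z = 0"
      using fundamental_theorem_of_algebra[of q] constant_degree by metis
    then have "poly p z = 0" by (subst q(1)) simp
    then have "z = 0" by (rule assms(2))
    then show False using z q(2) by (simp add: poly_eq_0_iff_dvd)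
  qed
  then obtain c where c: "q = [:c:]" by (rule degree_eq_zeroE)
  have "p = smult c (monom 1 (order 0 p))"
    using q(1) c by (simp add: monom_altdef)
  then show ?thesis using assms(1)
    by (intro exI[of _ c] exI[of _ "order 0 p"]) (auto simp: smult_monom)
qed

text \<open>Linear functionals on the polynomial ring in the variables \<open>M\<close> that vanish on the ideal generated
  by \<open>x\<^sub>i\<^sup>2 - (\<Sum>j\<in>M. b i j x\<^sub>j)\<close>; a multiset stands for a monomial.\<close>

definition quad_functionals :: "nat set \<Rightarrow> (nat \<Rightarrow> nat \<Rightarrow> complex) \<Rightarrow> (nat multiset \<Rightarrow> complex) set" where
  "quad_functionals M b = {f. (\<forall>\<alpha>. \<not> set_mset \<alpha> \<subseteq> M \<longrightarrow> f \<alpha> = 0) \<and>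
     (\<forall>\<alpha>. \<forall>i\<in>M. f (add_mset i (add_mset i \<alpha>)) = (\<Sum>j\<in>M. b i j * f (add_mset j \<alpha>)))}"

text \<open>The coefficient of the variable \<open>m\<close> in the normal form in which every
  square has been replaced by its linear expression. Each replacement lowers the degree by one. The
  square to replace is an arbitrary choice; \<open>reduce_monomial_square\<close> shows that the
  choice does not matter.\<close>

function reduce_monomial ::
    "nat set \<Rightarrow> (nat \<Rightarrow> nat \<Rightarrow> complex) \<Rightarrow> nat \<Rightarrow> nat multiset \<Rightarrow> complex" where
  "reduce_monomial M b m \<alpha> =
    (if \<not> set_mset \<alpha> \<subseteq> M then 0
     else if \<exists>i. 2 \<le> count \<alpha> i then
       (\<Sum>j\<in>M. b (SOME i. 2 \<le> count \<alpha> i) j *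
          reduce_monomial M b m (add_mset j (\<alpha> - replicate_mset 2 (SOME i. 2 \<le> count \<alpha> i))))
     else if \<alpha> = {#m#} then 1 else 0)"
  by pat_completeness auto
termination
proof (relation "measure (\<lambda>(M, b, m, \<alpha>). size \<alpha>)", goal_cases)
  case (2 M b m \<alpha> j)
  let ?i = "SOME i. 2 \<le> count \<alpha> i"
  have "2 \<le> count \<alpha> ?i" using 2 by (metis someI_ex)
  then have "replicate_mset 2 ?i \<subseteq># \<alpha>" by (simp add: count_le_replicate_mset_subset_eq)
  then have "size (\<alpha> - replicate_mset 2 ?i) + 2 = size \<alpha>"
    by (metis size_Diff_submset size_mset_mono size_replicate_mset le_add_diff_inverse2)
  then show ?case by simp
qed simp

declare reduce_monomial.simps [simp del]

text \<open>Confluence of the rewriting. If the chosen square is that of another variable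
  \<open>k\<close>, both squares are reduced, in either order, by the induction hypothesis for
  monomials of lower degree, and the two double sums agree.\<close>

lemma reduce_monomial_square:
  assumes "finite M" "i \<in> M" "set_mset \<alpha> \<subseteq> M"
  shows "reduce_monomial M b m (add_mset i (add_mset i \<alpha>)) =
    (\<Sum>j\<in>M. b i j * reduce_monomial M b m (add_mset j \<alpha>))"
  using assms(2,3)
proof (induction "size \<alpha>" arbitrary: \<alpha> i rule: less_induct)
  case less
  let ?R = "reduce_monomial M b m" and ?\<alpha> = "add_mset i (add_mset i \<alpha>)"
  define k where "k = (SOME k. 2 \<le> count ?\<alpha> k)"
  have ex: "\<exists>k. 2 \<le> count ?\<alpha> k" by (rule exI[of _ i]) simp
  then have k: "2 \<le> count ?\<alpha> k" unfolding k_def by (rule someI_ex)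
  have eq: "?R ?\<alpha> = (\<Sum>j\<in>M. b k j * ?R (add_mset j (?\<alpha> - replicate_mset 2 k)))"
    using less.prems ex by (subst reduce_monomial.simps) (simp add: k_def)
  show ?case
  proof (cases "k = i")
    case True
    then show ?thesis by (simp add: eq numeral_2_eq_2)
  next
    case False
    then have "2 \<le> count \<alpha> k" using k by simp
    then have "replicate_mset 2 k \<subseteq># \<alpha>" by (simp add: count_le_replicate_mset_subset_eq)
    then obtain \<beta> where \<beta>: "\<alpha> = add_mset k (add_mset k \<beta>)"
      by (metis numeral_2_eq_2 replicate_mset_Suc replicate_mset_0 subset_mset.le_iff_add
          union_mset_add_mset_left add_0)
    have sub: "k \<in> M" "set_mset \<beta> \<subseteq> M" using less.prems \<beta> by auto
    have "?R ?\<alpha> = (\<Sum>j\<in>M. b k j * ?R (add_mset i (add_mset i (add_mset j \<beta>))))"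
      unfolding eq unfolding \<beta> by (intro sum.cong) (auto simp: numeral_2_eq_2 add_mset_commute)
    also have "\<dots> = (\<Sum>j\<in>M. b k j * (\<Sum>l\<in>M. b i l * ?R (add_mset l (add_mset j \<beta>))))"
      using less.prems sub by (intro sum.cong arg_cong2[where f="(*)"] less.hyps refl) (auto simp: \<beta>)
    also have "\<dots> = (\<Sum>l\<in>M. b i l * (\<Sum>j\<in>M. b k j * ?R (add_mset j (add_mset l \<beta>))))"
      unfolding sum_distrib_left
      by (subst sum.swap) (simp add: add_mset_commute mult.left_commute)
    also have "\<dots> = (\<Sum>l\<in>M. b i l * ?R (add_mset k (add_mset k (add_mset l \<beta>))))"
      using less.prems sub
      by (intro sum.cong arg_cong2[where f="(*)"] less.hyps[symmetric] refl) (auto simp: \<beta>)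
    finally show ?thesis by (simp add: \<beta> add_mset_commute)
  qed
qed

lemma reduce_monomial_in_quad_functionals:
  assumes "finite M"
  shows "reduce_monomial M b m \<in> quad_functionals M b"
proof -
  have zero: "reduce_monomial M b m \<alpha> = 0" if "\<not> set_mset \<alpha> \<subseteq> M" for \<alpha>
    using that by (subst reduce_monomial.simps) simp
  moreover have "reduce_monomial M b m (add_mset i (add_mset i \<alpha>)) =
      (\<Sum>j\<in>M. b i j * reduce_monomial M b m (add_mset j \<alpha>))" if "i \<in> M" for i \<alpha>
    using reduce_monomial_square[OF assms that]
    by (cases "set_mset \<alpha> \<subseteq> M") (auto simp: zero)
  ultimately show ?thesis by (auto simp: quad_functionals_def)
qed

text \<open>Square-free monomials span the coordinate algebra, since a repeated variable can be
  traded for lower degree. Hence the functionals form a space of dimension at most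
  \<open>2 ^ card M\<close>.\<close>

lemma quad_functional_vanishing:
  assumes "finite M" and f: "f \<in> quad_functionals M b"
    and z: "\<And>Q. Q \<subseteq> M \<Longrightarrow> f (mset_set Q) = 0"
  shows "f \<alpha> = 0"
proof (induction "size \<alpha>" arbitrary: \<alpha> rule: less_induct)
  case less
  consider "\<not> set_mset \<alpha> \<subseteq> M" | i where "set_mset \<alpha> \<subseteq> M" "2 \<le> count \<alpha> i"
    | "set_mset \<alpha> \<subseteq> M" "\<forall>i. count \<alpha> i < 2"
    by (meson not_le)
  then show ?case
  proof cases
    case 1
    then show ?thesis using f by (simp add: quad_functionals_def)
  next
    case 2
    then have "replicate_mset 2 i \<subseteq># \<alpha>" by (simp add: count_le_replicate_mset_subset_eq)
    then obtain \<beta> where \<beta>: "\<alpha> = add_mset i (add_mset i \<beta>)"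
      by (metis numeral_2_eq_2 replicate_mset_Suc replicate_mset_0 subset_mset.le_iff_add
          union_mset_add_mset_left add_0)
    then have "f \<alpha> = (\<Sum>j\<in>M. b i j * f (add_mset j \<beta>))"
      using f 2 by (auto simp: quad_functionals_def)
    also have "\<dots> = 0" by (intro sum.neutral) (simp add: less.hyps \<beta>)
    finally show ?thesis .
  next
    case 3
    have "\<alpha> = mset_set (set_mset \<alpha>)"
    proof (rule multiset_eqI)
      fix i
      have "count \<alpha> i < 2" using 3 by blast
      then show "count \<alpha> i = count (mset_set (set_mset \<alpha>)) i"
        by (cases "i \<in># \<alpha>") (auto simp: count_mset_set' less_2_cases_iff count_eq_zero_iff)
    qed
    then show ?thesis using z[of "set_mset \<alpha>"] 3 by simp
  qed
qed

section \<open>The dual action of the variables and its eigenvectors\<close>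

text \<open>The transpose of multiplication by the polynomial \<open>p\<close> in the variable
  \<open>i\<close>.\<close>

definition shift_poly :: "nat \<Rightarrow> complex poly \<Rightarrow> (nat multiset \<Rightarrow> complex) \<Rightarrow> nat multiset \<Rightarrow> complex"
  where "shift_poly i p f \<alpha> = seq_eval p (\<lambda>k. f (replicate_mset k i + \<alpha>))"

lemma shift_poly_linear_factor:
  "shift_poly i ([:- \<mu>, 1:] * q) f \<alpha> = shift_poly i q f (add_mset i \<alpha>) - \<mu> * shift_poly i q f \<alpha>"
  unfolding shift_poly_def seq_eval_linear_factor by simp

lemma shift_poly_in_quad_functionals:
  assumes "f \<in> quad_functionals M b" "i \<in> M"
  shows "shift_poly i p f \<in> quad_functionals M b"
proof -
  have "shift_poly i p f (add_mset l (add_mset l \<alpha>)) = (\<Sum>j\<in>M. b l j * shift_poly i p f (add_mset j \<alpha>))"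
    if "l \<in> M" for l \<alpha>
  proof -
    have "f (add_mset l (add_mset l (replicate_mset k i + \<alpha>))) =
        (\<Sum>j\<in>M. b l j * f (add_mset j (replicate_mset k i + \<alpha>)))" for k
      using assms that unfolding quad_functionals_def by blast
    then show ?thesis
      unfolding shift_poly_def seq_eval_def
      by (simp add: sum_distrib_left, subst sum.swap) (simp add: mult.left_commute)
  qed
  moreover have "shift_poly i p f \<alpha> = 0" if "\<not> set_mset \<alpha> \<subseteq> M" for \<alpha>
    using assms that by (auto simp: quad_functionals_def shift_poly_def seq_eval_def)
  ultimately show ?thesis by (auto simp: quad_functionals_def)
qed

text \<open>The shifts of \<open>f\<close> by the powers 0 to \<open>card (Pow M)\<close> of the
  variable are one more than the square-free monomials, which determine a functional, so they are
  linearly dependent.\<close>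

lemma shift_annihilating_poly:
  assumes "finite M" "f \<in> quad_functionals M b" "i \<in> M"
  shows "\<exists>p. p \<noteq> 0 \<and> (\<forall>\<alpha>. shift_poly i p f \<alpha> = 0)"
proof -
  let ?N = "card (Pow M)"
  obtain y where y: "\<exists>k\<in>{..?N}. y k \<noteq> 0"
      "\<forall>Q\<in>Pow M. (\<Sum>k\<in>{..?N}. y k * f (replicate_mset k i + mset_set Q)) = 0"
    using homogeneous_system_nontrivial_solution[of "Pow M" "{..?N}"
        "\<lambda>k Q. f (replicate_mset k i + mset_set Q)"] assms(1) by auto
  define p where "p = (\<Sum>k\<le>?N. monom (y k) k)"
  have co: "coeff p k = (if k \<le> ?N then y k else 0)" for k
    by (simp add: p_def coeff_sum)
  then have "degree p \<le> ?N" by (intro degree_le) auto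
  then have "shift_poly i p f (mset_set Q) = 0" if "Q \<subseteq> M" for Q
    using y(2) that by (simp add: shift_poly_def seq_eval_eq co)
  then have "shift_poly i p f \<alpha> = 0" for \<alpha>
    using quad_functional_vanishing[OF assms(1) shift_poly_in_quad_functionals[OF assms(2,3)]] by blast
  moreover have "p \<noteq> 0" using y(1) co by (metis atMost_iff coeff_0)
  ultimately show ?thesis by blast
qed

text \<open>The minimal polynomial argument: for an annihilating \<open>p\<close> of least degree
  and a root \<open>\<mu>\<close>, the cofactor of the linear factor does not kill \<open>f\<close>,
  and it sends \<open>f\<close> to an eigenvector. The flag \<open>nz\<close> asks for a nonzero
  eigenvalue, which exists if no power of the variable kills \<open>f\<close>.\<close>

lemma shift_eigenfunctional:
  assumes "finite M" "f \<in> quad_functionals M b" "i \<in> M" "f \<beta> \<noteq> 0"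
    and "nz \<longrightarrow> (\<forall>k. \<exists>\<alpha>. f (replicate_mset k i + \<alpha>) \<noteq> 0)"
  shows "\<exists>\<mu> q. (nz \<longrightarrow> \<mu> \<noteq> 0) \<and> (\<exists>\<alpha>. shift_poly i q f \<alpha> \<noteq> 0) \<and>
    (\<forall>\<alpha>. shift_poly i q f (add_mset i \<alpha>) = \<mu> * shift_poly i q f \<alpha>)"
proof -
  let ?P = "\<lambda>p. p \<noteq> 0 \<and> (\<forall>\<alpha>. shift_poly i p f \<alpha> = 0)"
  obtain p where p: "?P p" and min: "\<And>q. ?P q \<Longrightarrow> degree p \<le> degree q"
    using ex_has_least_nat[of ?P _ degree] shift_annihilating_poly[OF assms(1-3)] by metis
  \<comment> \<open>Otherwise 0 is the only possible root and \<open>p\<close> is a monomial, so a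
    power of the variable kills \<open>f\<close>. This excludes \<open>nz\<close>; then
    \<open>p\<close> has no root at all, the power is the zeroth, and \<open>f \<beta>\<close> would
    vanish.\<close>
  have "\<exists>\<mu>. poly p \<mu> = 0 \<and> (nz \<longrightarrow> \<mu> \<noteq> 0)"
  proof (rule ccontr)
    assume no: "\<not> ?thesis"
    then have "\<And>\<mu>. poly p \<mu> = 0 \<Longrightarrow> \<mu> = 0" by blast
    with p obtain c k where ck: "c \<noteq> 0" "p = monom c k"
      using poly_only_root_zero_imp_monom by blast
    then have 0: "f (replicate_mset k i + \<alpha>) = 0" for \<alpha>
      using p by (simp add: shift_poly_def seq_eval_monom)
    then have "\<not> nz" using assms(5) by blast
    with no have "poly p 0 \<noteq> 0" by blast
    then have "k = 0" using ck by (simp add: poly_monom zero_power)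
    then show False using 0[of \<beta>] assms(4) by simp
  qed
  then obtain \<mu> where \<mu>: "poly p \<mu> = 0" "nz \<longrightarrow> \<mu> \<noteq> 0" by blast
  then obtain q where q: "p = [:- \<mu>, 1:] * q" using poly_eq_0_iff_dvd by (metis dvdE)
  then have "q \<noteq> 0" using p by auto
  then have "degree q < degree p" unfolding q by (subst degree_mult_eq) auto
  then have "\<exists>\<alpha>. shift_poly i q f \<alpha> \<noteq> 0" using min[of q] \<open>q \<noteq> 0\<close> by fastforce
  moreover have "shift_poly i q f (add_mset i \<alpha>) = \<mu> * shift_poly i q f \<alpha>" for \<alpha>
    using p shift_poly_linear_factor[of i \<mu> q f \<alpha>] q by simp
  ultimately show ?thesis using \<mu>(2) by blast
qed

text \<open>The variables act by commuting operators on a finite-dimensional space. The variable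
  \<open>i\<close> is treated first, which secures its nonzero eigenvalue; the others follow one at
  a time.\<close>

lemma joint_shift_eigenfunctional:
  assumes "finite M" "f \<in> quad_functionals M b" "i \<in> M"
    and "\<And>k. \<exists>\<alpha>. f (replicate_mset k i + \<alpha>) \<noteq> 0"
  shows "\<exists>g\<in>quad_functionals M b. \<exists>x. x i \<noteq> 0 \<and> (\<exists>\<alpha>. g \<alpha> \<noteq> 0) \<and>
    (\<forall>j\<in>M. \<forall>\<alpha>. g (add_mset j \<alpha>) = x j * g \<alpha>)"
proof -
  have "\<exists>g\<in>quad_functionals M b. \<exists>x. x i \<noteq> 0 \<and> (\<exists>\<alpha>. g \<alpha> \<noteq> 0) \<and>
    (\<forall>j\<in>insert i F. \<forall>\<alpha>. g (add_mset j \<alpha>) = x j * g \<alpha>)" if "finite F" "F \<subseteq> M" for F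
    using that
  proof (induction F rule: finite_induct)
    case empty
    obtain \<beta> where "f \<beta> \<noteq> 0" using assms(4) by blast
    from shift_eigenfunctional[OF assms(1-3) this, of True] assms(4)
    obtain \<mu> q where "\<mu> \<noteq> 0" "\<exists>\<alpha>. shift_poly i q f \<alpha> \<noteq> 0"
      "\<forall>\<alpha>. shift_poly i q f (add_mset i \<alpha>) = \<mu> * shift_poly i q f \<alpha>" by auto
    then show ?case
      using shift_poly_in_quad_functionals[OF assms(2,3), of q]
      by (intro bexI[of _ "shift_poly i q f"] exI[of _ "\<lambda>_. \<mu>"]) auto
  next
    case (insert j F)
    then obtain g x where g: "g \<in> quad_functionals M b" "x i \<noteq> 0" "\<exists>\<alpha>. g \<alpha> \<noteq> 0"
      "\<forall>l\<in>insert i F. \<forall>\<alpha>. g (add_mset l \<alpha>) = x l * g \<alpha>" by blast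
    show ?case
    proof (cases "j = i")
      case True
      then show ?thesis using g by (intro bexI[of _ g] exI[of _ x]) auto
    next
      case False
      have j: "j \<in> M" using insert by blast
      obtain \<beta> where "g \<beta> \<noteq> 0" using g(3) by blast
      from shift_eigenfunctional[OF assms(1) g(1) j this, of False]
      obtain \<mu> q where q: "\<exists>\<alpha>. shift_poly j q g \<alpha> \<noteq> 0"
        "\<forall>\<alpha>. shift_poly j q g (add_mset j \<alpha>) = \<mu> * shift_poly j q g \<alpha>" by auto
      \<comment> \<open>Since the shifts commute, a polynomial in the variable \<open>j\<close>
        preserves the eigenvalues already obtained.\<close>
      have "shift_poly j q g (add_mset l \<alpha>) = x l * shift_poly j q g \<alpha>" if "l \<in> insert i F" for l \<alpha>
      proof -
        have "g (add_mset l \<beta>) = x l * g \<beta>" for \<beta> using g(4) that by blast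
        then show ?thesis
          unfolding shift_poly_def seq_eval_def by (simp add: sum_distrib_left mult.left_commute)
      qed
      then show ?thesis
        using q g(2) shift_poly_in_quad_functionals[OF g(1) j, of q] False insert.hyps
        by (intro bexI[of _ "shift_poly j q g"] exI[of _ "x(j := \<mu>)"]) auto
    qed
  qed
  from this[OF assms(1) order_refl] show ?thesis using assms(3) by (simp add: insert_absorb)
qed

section \<open>Nonzero solutions of quadratic systems\<close>

text \<open>The joint eigenvalues of an eigenfunctional satisfy the defining relations, so they form
  a solution. It is nonzero as soon as some variable does not act nilpotently on the functional
  \<open>f\<close>, and the inverse matrix \<open>a\<close> guarantees such a variable.\<close>

lemma quadratic_system_nonzero_solution:
  fixes a b :: "nat \<Rightarrow> nat \<Rightarrow> complex"
  assumes "finite M" "M \<noteq> {}"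
    and inv: "\<And>j k. j \<in> M \<Longrightarrow> k \<in> M \<Longrightarrow> (\<Sum>i\<in>M. a i k * b i j) = (if j = k then 1 else 0)"
  shows "\<exists>x. (\<exists>i\<in>M. x i \<noteq> 0) \<and> (\<forall>i\<in>M. (x i)\<^sup>2 = (\<Sum>j\<in>M. b i j * x j))"
proof -
  obtain m where m: "m \<in> M" using assms(2) by blast
  define f where "f = reduce_monomial M b m"
  have f: "f \<in> quad_functionals M b"
    unfolding f_def by (rule reduce_monomial_in_quad_functionals[OF assms(1)])
  have f1: "f {#m#} = 1"
    unfolding f_def using m by (subst reduce_monomial.simps) auto
  \<comment> \<open>Inverting the relations writes a variable as a combination of squares, so the
    degree of a nonconstant monomial can be raised.\<close>
  have raise: "f (add_mset k \<alpha>) = (\<Sum>i\<in>M. a i k * f (add_mset i (add_mset i \<alpha>)))" if "k \<in> M" for k \<alpha>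
  proof -
    have "(\<Sum>i\<in>M. a i k * f (add_mset i (add_mset i \<alpha>))) =
        (\<Sum>i\<in>M. \<Sum>j\<in>M. a i k * b i j * f (add_mset j \<alpha>))"
      using f by (intro sum.cong) (auto simp: quad_functionals_def sum_distrib_left mult.assoc)
    also have "\<dots> = (\<Sum>j\<in>M. (\<Sum>i\<in>M. a i k * b i j) * f (add_mset j \<alpha>))"
      by (subst sum.swap) (simp add: sum_distrib_right)
    also have "\<dots> = (\<Sum>j\<in>M. if j = k then f (add_mset j \<alpha>) else 0)"
      using inv that by (intro sum.cong) auto
    finally show ?thesis using that assms(1) by simp
  qed
  have "\<exists>i\<in>M. \<forall>k. \<exists>\<alpha>. f (replicate_mset k i + \<alpha>) \<noteq> 0"
  proof (rule ccontr)
    assume "\<not> ?thesis"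
    then have "\<forall>i\<in>M. \<exists>k. \<forall>\<alpha>. f (replicate_mset k i + \<alpha>) = 0" by blast
    then obtain K where K: "\<And>i \<alpha>. i \<in> M \<Longrightarrow> f (replicate_mset (K i) i + \<alpha>) = 0" by metis
    define N where "N = (\<Sum>i\<in>M. K i)"
    \<comment> \<open>A monomial whose degree exceeds the sum \<open>N\<close> of the exponents
      \<open>K i\<close> contains some variable to the power \<open>K i\<close>.\<close>
    have large: "f \<alpha> = 0" if "size \<alpha> \<ge> Suc N" for \<alpha>
    proof (cases "set_mset \<alpha> \<subseteq> M")
      case False
      then show ?thesis using f by (simp add: quad_functionals_def)
    next
      case True
      have "\<exists>i\<in>M. K i \<le> count \<alpha> i"
      proof (rule ccontr)
        assume "\<not> ?thesis"
        then have "(\<Sum>i\<in>M. count \<alpha> i) \<le> N"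
          unfolding N_def by (intro sum_mono) (auto simp: not_le less_imp_le)
        moreover have "size \<alpha> = (\<Sum>i\<in>M. count \<alpha> i)"
          unfolding size_multiset_overloaded_eq using True assms(1)
          by (intro sum.mono_neutral_left) (auto simp: not_in_iff)
        ultimately show False using that by simp
      qed
      then obtain i where i: "i \<in> M" "replicate_mset (K i) i \<subseteq># \<alpha>"
        by (auto simp: count_le_replicate_mset_subset_eq)
      then obtain \<gamma> where "\<alpha> = replicate_mset (K i) i + \<gamma>" by (metis subset_mset.le_iff_add)
      then show ?thesis using K i by simp
    qed
    \<comment> \<open>Descending induction on the degree, with \<open>d\<close> bounding its
      distance to the range of \<open>large\<close>. It reaches the monomial \<open>m\<close>
      itself, where \<open>f\<close> is 1.\<close>
    have "f \<alpha> = 0" if "\<alpha> \<noteq> {#}" "size \<alpha> + d \<ge> Suc N" for \<alpha> d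
      using that
    proof (induction d arbitrary: \<alpha>)
      case 0
      then show ?case using large by simp
    next
      case (Suc d)
      show ?case
      proof (cases "set_mset \<alpha> \<subseteq> M")
        case False
        then show ?thesis using f by (simp add: quad_functionals_def)
      next
        case True
        obtain k \<beta> where \<beta>: "\<alpha> = add_mset k \<beta>" using Suc.prems(1) by (cases \<alpha>) auto
        have "f (add_mset i (add_mset i \<beta>)) = 0" for i
          using Suc.prems \<beta> by (intro Suc.IH) auto
        then show ?thesis using raise[of k \<beta>] True \<beta> by simp
      qed
    qed
    from this[of "{#m#}" N] f1 show False by simp
  qed
  then obtain i where i: "i \<in> M" "\<And>k. \<exists>\<alpha>. f (replicate_mset k i + \<alpha>) \<noteq> 0" by blast
  from joint_shift_eigenfunctional[OF assms(1) f i]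
  obtain g x where g: "g \<in> quad_functionals M b" "x i \<noteq> 0" "\<exists>\<alpha>. g \<alpha> \<noteq> 0"
    "\<forall>j\<in>M. \<forall>\<alpha>. g (add_mset j \<alpha>) = x j * g \<alpha>" by blast
  obtain \<alpha> where \<alpha>: "g \<alpha> \<noteq> 0" using g(3) by blast
  \<comment> \<open>The relation is evaluated on the eigenfunctional \<open>g\<close> and divided by
    the nonzero value \<open>g \<alpha>\<close>.\<close>
  have "(x l)\<^sup>2 = (\<Sum>j\<in>M. b l j * x j)" if "l \<in> M" for l
  proof -
    have "(x l)\<^sup>2 * g \<alpha> = g (add_mset l (add_mset l \<alpha>))"
      using g(4) that by (simp add: power2_eq_square)
    also have "\<dots> = (\<Sum>j\<in>M. b l j * g (add_mset j \<alpha>))"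
      using g(1) that by (simp add: quad_functionals_def)
    also have "\<dots> = (\<Sum>j\<in>M. b l j * x j) * g \<alpha>"
      using g(4) by (simp add: sum_distrib_right mult.assoc)
    finally show ?thesis using \<alpha> by simp
  qed
  then show ?thesis using i(1) g(2) by blast
qed

text \<open>If the rows of \<open>a\<close> are dependent, square roots of the coefficients give an
  eigenvector with \<open>\<mu> = 0\<close>. Otherwise \<open>a\<close> is invertible, and solving
  the system of its inverse gives one with \<open>\<mu> = 1\<close>.\<close>

lemma quadratic_eigenvector:
  fixes a :: "nat \<Rightarrow> nat \<Rightarrow> complex"
  assumes "finite M" "M \<noteq> {}"
  shows "\<exists>x \<mu>. (\<exists>i\<in>M. x i \<noteq> 0) \<and> (\<forall>k\<in>M. (\<Sum>i\<in>M. (x i)\<^sup>2 * a i k) = \<mu> * x k)"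
proof (cases "\<exists>y. (\<forall>k\<in>M. (\<Sum>i\<in>M. y i * a i k) = 0) \<and> (\<exists>i\<in>M. y i \<noteq> 0)")
  case True
  then obtain y where "\<forall>k\<in>M. (\<Sum>i\<in>M. y i * a i k) = 0" "\<exists>i\<in>M. y i \<noteq> 0" by blast
  then show ?thesis by (intro exI[of _ "\<lambda>i. csqrt (y i)"] exI[of _ 0]) auto
next
  case False
  then have "\<exists>y. \<forall>k\<in>M. (\<Sum>i\<in>M. y i * a i k) = (if j = k then 1 else 0)" for j
    by (intro solve_of_independent_rows[OF assms(1)]) blast
  then obtain y where y: "\<And>j k. k \<in> M \<Longrightarrow> (\<Sum>i\<in>M. y j i * a i k) = (if j = k then 1 else 0)"
    by metis
  then have inv: "(\<Sum>i\<in>M. a i k * y j i) = (if j = k then 1 else 0)" if "k \<in> M" for j k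
    using that by (simp add: mult.commute)
  obtain x where x: "\<exists>i\<in>M. x i \<noteq> 0" "\<forall>i\<in>M. (x i)\<^sup>2 = (\<Sum>j\<in>M. y j i * x j)"
    using quadratic_system_nonzero_solution[OF assms, of a "\<lambda>i j. y j i"] inv by blast
  have "(\<Sum>i\<in>M. (x i)\<^sup>2 * a i k) = 1 * x k" if "k \<in> M" for k
  proof -
    have "(\<Sum>i\<in>M. (x i)\<^sup>2 * a i k) = (\<Sum>i\<in>M. \<Sum>j\<in>M. x j * (a i k * y j i))"
      using x(2) by (intro sum.cong) (auto simp: sum_distrib_left mult_ac)
    also have "\<dots> = (\<Sum>j\<in>M. x j * (\<Sum>i\<in>M. a i k * y j i))"
      by (subst sum.swap) (simp add: sum_distrib_left)
    also have "\<dots> = (\<Sum>j\<in>M. if j = k then x j else 0)"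
      using inv[OF that] by (intro sum.cong) auto
    finally show ?thesis using that assms(1) by simp
  qed
  then show ?thesis using x(1) by blast
qed

section \<open>Powers and homomorphisms\<close>

lemma zv_in_Vn [simp]: "zv \<in> Vn n"
  and vadd_in_Vn [simp]: "x \<in> Vn n \<Longrightarrow> y \<in> Vn n \<Longrightarrow> vadd x y \<in> Vn n"
  and vscale_in_Vn [simp]: "x \<in> Vn n \<Longrightarrow> vscale a x \<in> Vn n"
  and mult_in_Vn [simp]: "mult n c x y \<in> Vn n"
  by (auto simp: Vn_def zv_def vadd_def vscale_def mult_def)

lemma mult_vadd_right: "mult n c z (vadd x y) = vadd (mult n c z x) (mult n c z y)"
  by (auto simp: fun_eq_iff vadd_def mult_def algebra_simps sum.distrib)

lemma mult_vscale_left: "mult n c (vscale a x) z = vscale a (mult n c x z)"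
  and mult_vscale_right: "mult n c z (vscale a x) = vscale a (mult n c z x)"
  by (auto simp: fun_eq_iff vscale_def mult_def sum_distrib_left mult_ac)

lemma mult_zv [simp]: "mult n c zv x = zv" "mult n c x zv = zv"
  by (auto simp: mult_def zv_def)

lemma vadd_zv [simp]: "vadd x zv = x" "vadd zv x = x"
  and vscale_zv [simp]: "vscale a zv = zv"
  and vscale_0 [simp]: "vscale 0 x = zv"
  and vscale_1 [simp]: "vscale 1 x = x"
  by (auto simp: vadd_def zv_def vscale_def)

definition vsubspace :: "vec set \<Rightarrow> bool" where
  "vsubspace T \<longleftrightarrow> zv \<in> T \<and> (\<forall>x\<in>T. \<forall>y\<in>T. vadd x y \<in> T) \<and> (\<forall>a. \<forall>x\<in>T. vscale a x \<in> T)"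

lemma vsubspace_Vn: "vsubspace (Vn n)"
  by (simp add: vsubspace_def)

lemma vsubspace_sum:
  assumes "vsubspace T" "finite F" "\<And>i. i \<in> F \<Longrightarrow> g i \<in> T"
  shows "(\<lambda>k. \<Sum>i\<in>F. a i * g i k) \<in> T"
  using assms(2,3)
proof (induction F rule: finite_induct)
  case empty
  then show ?case using assms(1) by (simp add: vsubspace_def zv_def)
next
  case (insert i F)
  then have "vadd (vscale (a i) (g i)) (\<lambda>k. \<Sum>i\<in>F. a i * g i k) \<in> T"
    using assms(1) by (simp add: vsubspace_def)
  then show ?case using insert.hyps by (simp add: vadd_def vscale_def)
qed

lemma vspan_superset: "x \<in> S \<Longrightarrow> x \<in> vspan S"
  unfolding vspan_def by (intro CollectI exI[of _ "{x}"] exI[of _ "\<lambda>_. 1"]) auto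

lemma vspan_minimal: "vsubspace T \<Longrightarrow> S \<subseteq> T \<Longrightarrow> vspan S \<subseteq> T"
  unfolding vspan_def by (auto intro!: vsubspace_sum)

lemma vsubspace_vspan: "vsubspace (vspan S)"
  unfolding vsubspace_def
proof (intro conjI ballI allI)
  show "zv \<in> vspan S" unfolding vspan_def zv_def by (intro CollectI exI[of _ "{}"]) auto
next
  fix x y assume "x \<in> vspan S" "y \<in> vspan S"
  then obtain F a G b where F: "finite F" "F \<subseteq> S" "x = (\<lambda>k. \<Sum>x\<in>F. a x * x k)"
    and G: "finite G" "G \<subseteq> S" "y = (\<lambda>k. \<Sum>x\<in>G. b x * x k)"
    unfolding vspan_def by blast
  let ?a = "\<lambda>x. (if x \<in> F then a x else 0) + (if x \<in> G then b x else 0)"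
  have "x k = (\<Sum>x\<in>F \<union> G. (if x \<in> F then a x else 0) * x k)" for k
    unfolding F(3) using F(1) G(1) by (intro sum.mono_neutral_cong_left) auto
  moreover have "y k = (\<Sum>x\<in>F \<union> G. (if x \<in> G then b x else 0) * x k)" for k
    unfolding G(3) using F(1) G(1) by (intro sum.mono_neutral_cong_left) auto
  ultimately have "vadd x y = (\<lambda>k. \<Sum>x\<in>F \<union> G. ?a x * x k)"
    by (simp add: vadd_def distrib_right sum.distrib)
  then show "vadd x y \<in> vspan S"
    unfolding vspan_def using F G by (intro CollectI exI[of _ "F \<union> G"] exI[of _ ?a]) auto
next
  fix c x assume "x \<in> vspan S"
  then obtain F a where F: "finite F" "F \<subseteq> S" "x = (\<lambda>k. \<Sum>x\<in>F. a x * x k)"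
    unfolding vspan_def by blast
  then have "vscale c x = (\<lambda>k. \<Sum>x\<in>F. (c * a x) * x k)"
    by (simp add: vscale_def sum_distrib_left mult.assoc)
  then show "vscale c x \<in> vspan S"
    unfolding vspan_def using F by (intro CollectI exI[of _ F] exI[of _ "\<lambda>x. c * a x"]) auto
qed

section \<open>Powers of an algebra\<close>

lemma length_powlist [simp]: "length (powlist n c k) = k"
  by (induction k) (auto simp: Let_def)

lemma powlist_nth: "i < k \<Longrightarrow> powlist n c k ! i = apow n c (Suc i)"
proof (induction k)
  case (Suc k)
  show ?case
  proof (cases "i < k")
    case True
    then show ?thesis using Suc.IH by (auto simp: Let_def nth_append)
  next
    case False
    then have "i = k" using Suc.prems by simp
    then show ?thesis by (simp add: apow_def)
  qed
qed simp

lemma apow_1: "apow n c (Suc 0) = Vn n"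
  by (simp add: apow_def)

text \<open>Frees the powers from their encoding as a list; the later facts about powers rest on
  this form.\<close>

lemma apow_Suc:
  assumes "0 < k"
  shows "apow n c (Suc k) =
    vspan {mult n c x y | x y i. i < k \<and> x \<in> apow n c (Suc i) \<and> y \<in> apow n c (k - i)}"
proof -
  have "powlist n c k ! i = apow n c (Suc i)" "powlist n c k ! (k - 1 - i) = apow n c (k - i)"
    if "i < k" for i
    using that powlist_nth[of "k - 1 - i" k n c] by (simp_all add: powlist_nth Suc_diff_Suc)
  then have "i < k \<and> x \<in> powlist n c k ! i \<and> y \<in> powlist n c k ! (k - 1 - i) \<longleftrightarrow>
      i < k \<and> x \<in> apow n c (Suc i) \<and> y \<in> apow n c (k - i)" for x y i
    by auto
  then show ?thesis using assms by (simp add: apow_def[of n c "Suc k"] Let_def nth_append)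
qed

lemma apow_mult:
  assumes "x \<in> apow n c i" "y \<in> apow n c j" "0 < i" "0 < j"
  shows "mult n c x y \<in> apow n c (i + j)"
proof -
  let ?k = "i + j - 1"
  have "i - 1 < ?k" "x \<in> apow n c (Suc (i - 1))" "y \<in> apow n c (?k - (i - 1))"
    using assms by simp_all
  then have "mult n c x y \<in> apow n c (Suc ?k)"
    using assms(3,4) by (subst apow_Suc) (simp, blast intro: vspan_superset)
  then show ?thesis using assms by simp
qed

lemma vsubspace_apow: "0 < k \<Longrightarrow> vsubspace (apow n c k)"
  by (cases k; cases "k = 1") (simp_all add: apow_1 vsubspace_Vn apow_Suc vsubspace_vspan)

lemma zv_in_apow: "0 < k \<Longrightarrow> zv \<in> apow n c k"
  using vsubspace_apow by (simp add: vsubspace_def)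

lemma apow_subset:
  assumes "vsubspace T" "2 \<le> k"
    and "\<And>i j x y. 0 < i \<Longrightarrow> 0 < j \<Longrightarrow> i + j = k \<Longrightarrow> x \<in> apow n c i \<Longrightarrow> y \<in> apow n c j \<Longrightarrow> mult n c x y \<in> T"
  shows "apow n c k \<subseteq> T"
proof -
  obtain k' where k: "k = Suc k'" "0 < k'" using assms(2) by (cases k) auto
  have "mult n c x y \<in> T" if "i < k'" "x \<in> apow n c (Suc i)" "y \<in> apow n c (k' - i)" for x y i
    using that k by (intro assms(3)[of "Suc i" "k' - i"]) auto
  then show ?thesis
    unfolding k apow_Suc[OF k(2)] by (intro vspan_minimal[OF assms(1)]) blast
qed

lemma apow_subset_Vn: "0 < k \<Longrightarrow> apow n c k \<subseteq> Vn n"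
  by (cases "k = 1") (simp add: apow_1, rule apow_subset, auto simp: vsubspace_Vn)

text \<open>In a product of factors of degrees \<open>i\<close> and \<open>j\<close> with
  \<open>i + j = Suc k\<close>, the degree of one factor may be lowered by induction. A factor of
  degree 1 cannot be lowered, and then the other one is.\<close>

lemma apow_Suc_subset: "0 < k \<Longrightarrow> apow n c (Suc k) \<subseteq> apow n c k"
proof (induction k rule: less_induct)
  case (less k)
  show ?case
  proof (cases "k = 1")
    case True
    then show ?thesis using apow_subset_Vn[of "Suc k"] by (simp add: apow_1)
  next
    case False
    show ?thesis
    proof (rule apow_subset)
      fix i j x y
      assume ij: "0 < i" "0 < j" "i + j = Suc k" and xy: "x \<in> apow n c i" "y \<in> apow n c j"
      show "mult n c x y \<in> apow n c k"
      proof (cases "i = 1")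
        case True
        then have "y \<in> apow n c (k - 1)" using less.IH[of "k - 1"] less.prems False ij xy(2) by auto
        then show ?thesis
          using apow_mult[OF xy(1), of y "k - 1"] True False less.prems by simp
      next
        case i: False
        then obtain l where l: "i = Suc l" "0 < l" using ij(1) by (cases i) auto
        then have "x \<in> apow n c l" using less.IH[of l] ij xy(1) by auto
        then show ?thesis
          using apow_mult[of x n c l y j] l ij xy by simp
      qed
    qed (use less.prems in \<open>auto simp: vsubspace_apow\<close>)
  qed
qed

lemma apow_antimono:
  assumes "0 < i" "i \<le> j"
  shows "apow n c j \<subseteq> apow n c i"
  using assms(2)
proof (induction j rule: dec_induct)
  case (step j)
  then show ?case using apow_Suc_subset[of j n c] assms(1) by simp
qed simp

lemma apow_iterated_square:
  assumes "x \<in> Vn n"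
  shows "((\<lambda>y. mult n c y y) ^^ k) x \<in> apow n c (2 ^ k)"
proof (induction k)
  case 0
  then show ?case using assms by (simp add: apow_1)
next
  case (Suc k)
  then show ?case using apow_mult[OF Suc Suc] by (simp add: mult_2)
qed

lemma nilpotent_iterated_square:
  assumes "nilpotent n c" "x \<in> Vn n"
  shows "\<exists>k. ((\<lambda>y. mult n c y y) ^^ k) x = zv"
proof -
  obtain k where k: "1 \<le> k" "apow n c k = {zv}" using assms(1) by (auto simp: nilpotent_def)
  have "k \<le> 2 ^ k" by (simp add: less_imp_le)
  then have "apow n c (2 ^ k) \<subseteq> {zv}" using apow_antimono[of k "2 ^ k"] k by auto
  then show ?thesis using apow_iterated_square[OF assms(2)] by blast
qed

section \<open>Homomorphisms and invariance under isomorphism\<close>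

definition alg_hom :: "nat \<Rightarrow> sconst \<Rightarrow> nat \<Rightarrow> sconst \<Rightarrow> (vec \<Rightarrow> vec) \<Rightarrow> bool" where
  "alg_hom n c m d f \<longleftrightarrow> f ` Vn n \<subseteq> Vn m \<and>
     (\<forall>x\<in>Vn n. \<forall>y\<in>Vn n. f (vadd x y) = vadd (f x) (f y) \<and> f (mult n c x y) = mult m d (f x) (f y)) \<and>
     (\<forall>a. \<forall>x\<in>Vn n. f (vscale a x) = vscale a (f x))"

lemma alg_iso_alt: "alg_iso n c m d \<longleftrightarrow> (\<exists>f. bij_betw f (Vn n) (Vn m) \<and> alg_hom n c m d f)"
  unfolding alg_iso_def alg_hom_def by (auto simp: bij_betw_def)

lemma alg_hom_simps:
  assumes "alg_hom n c m d f" "x \<in> Vn n" "y \<in> Vn n"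
  shows "f x \<in> Vn m" "f (vadd x y) = vadd (f x) (f y)"
    "f (mult n c x y) = mult m d (f x) (f y)" "f (vscale a x) = vscale a (f x)" "f zv = zv"
proof -
  have "f (vscale 0 x) = vscale 0 (f x)" using assms unfolding alg_hom_def by blast
  then show "f zv = zv" by simp
qed (use assms in \<open>auto simp: alg_hom_def\<close>)

lemma alg_hom_zv: "alg_hom n c m d f \<Longrightarrow> f zv = zv"
  using alg_hom_simps(5) zv_in_Vn by blast

lemma alg_hom_sum:
  assumes "alg_hom n c m d f" "finite F" "\<And>i. i \<in> F \<Longrightarrow> g i \<in> Vn n"
  shows "f (\<lambda>k. \<Sum>i\<in>F. a i * g i k) = (\<lambda>k. \<Sum>i\<in>F. a i * f (g i) k)"
  using assms(2,3)
proof (induction F rule: finite_induct)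
  case empty
  then show ?case using alg_hom_zv[OF assms(1)] by (simp add: zv_def)
next
  case (insert i F)
  let ?s = "\<lambda>k. \<Sum>i\<in>F. a i * g i k"
  have s: "?s \<in> Vn n" using insert by (intro vsubspace_sum vsubspace_Vn) auto
  have "f (vadd (vscale (a i) (g i)) ?s) = vadd (vscale (a i) (f (g i))) (f ?s)"
    using alg_hom_simps(2)[OF assms(1) _ s] alg_hom_simps(4)[OF assms(1) _ s] insert.prems by simp
  then show ?case using insert by (simp add: vadd_def vscale_def)
qed

lemma alg_hom_inv:
  assumes "alg_hom n c m d f" "bij_betw f (Vn n) (Vn m)"
  shows "alg_hom m d n c (inv_into (Vn n) f)"
proof -
  let ?g = "inv_into (Vn n) f"
  have g: "?g y \<in> Vn n" "f (?g y) = y" if "y \<in> Vn m" for y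
    using assms(2) that inv_into_into[of y f "Vn n"] f_inv_into_f[of y f "Vn n"]
    by (simp_all add: bij_betw_def)
  have gf: "?g (f x) = x" if "x \<in> Vn n" for x
    using assms(2) that by (auto simp: bij_betw_def)
  note h = alg_hom_simps[OF assms(1)]
  have "?g (vadd x y) = vadd (?g x) (?g y)" "?g (mult m d x y) = mult n c (?g x) (?g y)"
    "?g (vscale a x) = vscale a (?g x)" if "x \<in> Vn m" "y \<in> Vn m" for x y a
  proof -
    have "f (vadd (?g x) (?g y)) = vadd x y" "f (mult n c (?g x) (?g y)) = mult m d x y"
      "f (vscale a (?g x)) = vscale a x"
      using g that h(2-4)[of "?g x" "?g y"] by simp_all
    then show "?g (vadd x y) = vadd (?g x) (?g y)" "?g (mult m d x y) = mult n c (?g x) (?g y)"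
      "?g (vscale a x) = vscale a (?g x)"
      using g that gf[of "vadd (?g x) (?g y)"] gf[of "mult n c (?g x) (?g y)"] gf[of "vscale a (?g x)"]
      by simp_all
  qed
  then show ?thesis using g unfolding alg_hom_def by blast
qed

lemma alg_iso_sym:
  assumes "alg_iso n c m d"
  shows "alg_iso m d n c"
proof -
  obtain f where "bij_betw f (Vn n) (Vn m)" "alg_hom n c m d f"
    using assms unfolding alg_iso_alt by blast
  then have "bij_betw (inv_into (Vn n) f) (Vn m) (Vn n)" "alg_hom m d n c (inv_into (Vn n) f)"
    by (simp_all add: bij_betw_inv_into alg_hom_inv)
  then show ?thesis unfolding alg_iso_alt by blast
qed

lemma alg_hom_comp:
  assumes "alg_hom n c m d f" "alg_hom m d l e g"
  shows "alg_hom n c l e (g \<circ> f)"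
proof -
  have "f x \<in> Vn m" if "x \<in> Vn n" for x using assms(1) that by (auto simp: alg_hom_def)
  with assms show ?thesis by (simp add: alg_hom_def image_subset_iff)
qed

lemma alg_iso_trans:
  assumes "alg_iso n c m d" "alg_iso m d l e"
  shows "alg_iso n c l e"
proof -
  obtain f g where "bij_betw f (Vn n) (Vn m)" "alg_hom n c m d f"
    "bij_betw g (Vn m) (Vn l)" "alg_hom m d l e g"
    using assms unfolding alg_iso_alt by blast
  then have "bij_betw (g \<circ> f) (Vn n) (Vn l)" "alg_hom n c l e (g \<circ> f)"
    by (simp_all add: bij_betw_trans alg_hom_comp)
  then show ?thesis unfolding alg_iso_alt by blast
qed

lemma alg_hom_apow:
  assumes "alg_hom n c m d f" "0 < k" "x \<in> apow n c k"
  shows "f x \<in> apow m d k"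
  using assms(2,3)
proof (induction k arbitrary: x rule: less_induct)
  case (less k)
  note h = alg_hom_simps[OF assms(1)]
  show ?case
  proof (cases "k = 1")
    case True
    then show ?thesis using less.prems h(1)[of x x] by (simp add: apow_1)
  next
    case False
    let ?T = "{x \<in> Vn n. f x \<in> apow m d k}"
    have "apow n c k \<subseteq> ?T"
    proof (rule apow_subset)
      show "vsubspace ?T"
        using vsubspace_apow[of k m d] less.prems(1) alg_hom_zv[OF assms(1)] assms(1)
        unfolding vsubspace_def alg_hom_def by simp
      fix i j x y
      assume ij: "0 < i" "0 < j" "i + j = k" and xy: "x \<in> apow n c i" "y \<in> apow n c j"
      then have "f x \<in> apow m d i" "f y \<in> apow m d j" using less.IH[of i x] less.IH[of j y] by simp_all
      moreover have "x \<in> Vn n" "y \<in> Vn n" using xy apow_subset_Vn[of i n c] apow_subset_Vn[of j n c] ij by blast+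
      ultimately show "mult n c x y \<in> ?T" using apow_mult[of "f x" m d i "f y" j] ij h(3)[of x y] by simp
    qed (use False less.prems in auto)
    then show ?thesis using less.prems by blast
  qed
qed

lemma alg_hom_apow_trivial:
  assumes "alg_hom n c m d f" "inj_on f (Vn n)" "0 < k" "apow m d k = {zv}"
  shows "apow n c k = {zv}"
proof -
  have "x = zv" if "x \<in> apow n c k" for x
  proof -
    have "f x = f zv" using alg_hom_apow[OF assms(1,3) that] assms(4) alg_hom_zv[OF assms(1)] by simp
    moreover have "x \<in> Vn n" using apow_subset_Vn[OF assms(3)] that by blast
    ultimately show ?thesis using inj_onD[OF assms(2)] zv_in_Vn by blast
  qed
  then show ?thesis using zv_in_apow[OF assms(3)] by blast
qed

lemma alg_iso_apow_trivial:
  assumes "alg_iso n c m d" "1 \<le> k"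
  shows "apow n c k = {zv} \<longleftrightarrow> apow m d k = {zv}"
proof -
  have "apow n c k = {zv}" if iso: "alg_iso n c m d" and 0: "apow m d k = {zv}" for n c m d
  proof -
    obtain f where "alg_hom n c m d f" "inj_on f (Vn n)"
      using iso unfolding alg_iso_alt bij_betw_def by blast
    then show ?thesis using assms(2) 0 alg_hom_apow_trivial[of n c m d f k] by simp
  qed
  then show ?thesis using assms(1) alg_iso_sym by blast
qed

lemma alg_iso_nilpotent: "alg_iso n c m d \<Longrightarrow> nilpotent n c \<longleftrightarrow> nilpotent m d"
  using alg_iso_apow_trivial[of n c m d] by (auto simp: nilpotent_def)

lemma alg_iso_nil_index:
  assumes "alg_iso n c m d"
  shows "nil_index n c = nil_index m d"
proof -
  have "(1 \<le> k \<and> apow n c k = {zv}) = (1 \<le> k \<and> apow m d k = {zv})" for k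
    using alg_iso_apow_trivial[OF assms, of k] by auto
  then show ?thesis by (simp add: nil_index_def)
qed

section \<open>Evolution algebras given by a matrix\<close>

lemma mult_sum_left:
  "mult n c (\<lambda>k. \<Sum>i\<in>F. a i * b i k) y = (\<lambda>k. \<Sum>i\<in>F. a i * mult n c (b i) y k)"
proof
  fix k
  have "(\<Sum>p<n. \<Sum>q<n. (\<Sum>i\<in>F. a i * b i p) * y q * c p q k) =
      (\<Sum>p<n. \<Sum>i\<in>F. a i * (\<Sum>q<n. b i p * y q * c p q k))"
  proof (rule sum.cong[OF refl])
    fix p
    have "(\<Sum>q<n. (\<Sum>i\<in>F. a i * b i p) * y q * c p q k) =
        (\<Sum>q<n. \<Sum>i\<in>F. a i * (b i p * y q * c p q k))"
      by (simp add: sum_distrib_left sum_distrib_right mult_ac)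
    also have "\<dots> = (\<Sum>i\<in>F. \<Sum>q<n. a i * (b i p * y q * c p q k))" by (rule sum.swap)
    finally show "(\<Sum>q<n. (\<Sum>i\<in>F. a i * b i p) * y q * c p q k) =
        (\<Sum>i\<in>F. a i * (\<Sum>q<n. b i p * y q * c p q k))"
      by (simp add: sum_distrib_left)
  qed
  also have "\<dots> = (\<Sum>i\<in>F. a i * (\<Sum>p<n. \<Sum>q<n. b i p * y q * c p q k))"
    by (subst sum.swap) (simp add: sum_distrib_left)
  finally show "mult n c (\<lambda>k. \<Sum>i\<in>F. a i * b i k) y k = (\<Sum>i\<in>F. a i * mult n c (b i) y k)"
    by (simp add: mult_def)
qed

lemma mult_swap: "mult n c x y = mult n (\<lambda>i j. c j i) y x"
proof -
  have "(\<Sum>i<n. \<Sum>j<n. x i * y j * c i j k) = (\<Sum>i<n. \<Sum>j<n. y i * x j * c j i k)" for k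
    by (subst sum.swap) (simp add: mult_ac)
  then show ?thesis by (simp add: mult_def fun_eq_iff)
qed

lemma mult_sum_right:
  "mult n c y (\<lambda>k. \<Sum>i\<in>F. a i * b i k) = (\<lambda>k. \<Sum>i\<in>F. a i * mult n c y (b i) k)"
  unfolding mult_swap[of n c y] by (rule mult_sum_left)

definition uv :: "nat \<Rightarrow> vec" where "uv i = (\<lambda>k. if k = i then 1 else 0)"

lemma uv_in_Vn [simp]: "i < n \<Longrightarrow> uv i \<in> Vn n"
  by (auto simp: uv_def Vn_def)

lemma Vn_sum_uv:
  assumes "x \<in> Vn n"
  shows "(\<lambda>k. \<Sum>i<n. x i * uv i k) = x"
proof
  fix k
  have "(\<Sum>i<n. x i * uv i k) = (\<Sum>i<n. if i = k then x k else 0)"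
    by (intro sum.cong) (auto simp: uv_def)
  then show "(\<Sum>i<n. x i * uv i k) = x k" using assms by (auto simp: Vn_def)
qed

lemma sum_in_Vn: "(\<And>i. i \<in> F \<Longrightarrow> g i \<in> Vn n) \<Longrightarrow> (\<lambda>k. \<Sum>i\<in>F. a i * g i k) \<in> Vn n"
  by (auto simp: Vn_def)

text \<open>Change of basis: \<open>d\<close> holds the structure constants with respect to
  \<open>b\<close>, and the isomorphism sends coordinates to the vector that they describe.
  Independence of the \<open>n\<close> vectors yields surjectivity as well.\<close>

lemma alg_iso_of_basis:
  assumes b: "\<And>i. i < n \<Longrightarrow> b i \<in> Vn n"
    and ind: "\<And>a. (\<And>k. k < n \<Longrightarrow> (\<Sum>i<n. a i * b i k) = 0) \<Longrightarrow> \<forall>i<n. a i = 0"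
    and table: "\<And>i j. i < n \<Longrightarrow> j < n \<Longrightarrow> mult n c (b i) (b j) = (\<lambda>k. \<Sum>l<n. d i j l * b l k)"
  shows "alg_iso n d n c"
proof -
  define \<phi> where "\<phi> a = (\<lambda>k. \<Sum>i<n. a i * b i k)" for a :: vec
  have \<phi>: "\<phi> a \<in> Vn n" for a unfolding \<phi>_def using b by (intro sum_in_Vn) auto
  have add: "\<phi> (vadd x y) = vadd (\<phi> x) (\<phi> y)" for x y
    by (simp add: \<phi>_def vadd_def distrib_right sum.distrib)
  have scale: "\<phi> (vscale a x) = vscale a (\<phi> x)" for a x
    by (simp add: \<phi>_def vscale_def sum_distrib_left mult.assoc)
  have "\<phi> (mult n d x y) = mult n c (\<phi> x) (\<phi> y)" for x y
  proof
    fix k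
    have "mult n c (\<phi> x) (\<phi> y) k = (\<Sum>i<n. x i * (\<Sum>j<n. y j * mult n c (b i) (b j) k))"
      unfolding \<phi>_def mult_sum_left mult_sum_right ..
    also have "\<dots> = (\<Sum>i<n. \<Sum>j<n. \<Sum>l<n. x i * y j * d i j l * b l k)"
      by (simp add: table sum_distrib_left mult.assoc)
    also have "\<dots> = (\<Sum>i<n. \<Sum>l<n. \<Sum>j<n. x i * y j * d i j l * b l k)"
      by (rule sum.cong[OF refl sum.swap])
    also have "\<dots> = (\<Sum>l<n. \<Sum>i<n. \<Sum>j<n. x i * y j * d i j l * b l k)"
      by (rule sum.swap)
    also have "\<dots> = \<phi> (mult n d x y) k"
      by (simp add: \<phi>_def mult_def sum_distrib_right)
    finally show "\<phi> (mult n d x y) k = mult n c (\<phi> x) (\<phi> y) k" ..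
  qed
  then have hom: "alg_hom n d n c \<phi>"
    using \<phi> add scale by (auto simp: alg_hom_def)
  have "inj_on \<phi> (Vn n)"
  proof (rule inj_onI)
    fix x y assume xy: "x \<in> Vn n" "y \<in> Vn n" "\<phi> x = \<phi> y"
    have "(\<Sum>i<n. (x i - y i) * b i k) = 0" for k
      using fun_cong[OF xy(3), of k] by (simp add: \<phi>_def left_diff_distrib sum_subtractf)
    then have "\<forall>i<n. x i - y i = 0" by (intro ind)
    then have "x k = y k" for k using xy(1,2) by (cases "k < n") (auto simp: Vn_def)
    then show "x = y" by blast
  qed
  moreover have "y \<in> \<phi> ` Vn n" if "y \<in> Vn n" for y
  proof -
    obtain a where a: "\<forall>k\<in>{..<n}. (\<Sum>i<n. a i * b i k) = y k"
      using solve_of_independent_rows[of "{..<n}" b y] ind by auto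
    let ?a = "\<lambda>i. if i < n then a i else 0"
    have "\<phi> ?a k = y k" for k
    proof (cases "k < n")
      case True
      then show ?thesis using a by (simp add: \<phi>_def)
    next
      case False
      then show ?thesis using \<phi>[of ?a] that by (simp add: Vn_def)
    qed
    moreover have "?a \<in> Vn n" by (simp add: Vn_def)
    ultimately show ?thesis by (intro image_eqI[of y \<phi> ?a]) (auto simp: fun_eq_iff)
  qed
  ultimately have "bij_betw \<phi> (Vn n) (Vn n)" using \<phi> by (auto simp: bij_betw_def)
  then show ?thesis using hom unfolding alg_iso_alt by blast
qed

text \<open>Injectivity makes the images of the unit vectors independent, so there are at most
  \<open>m\<close> of them; if \<open>n = m\<close>, independent rows make every right-hand side
  solvable.\<close>

lemma alg_hom_inj_bij:
  assumes hom: "alg_hom n c m d f" and inj: "inj_on f (Vn n)"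
  shows "n \<le> m" "n = m \<Longrightarrow> bij_betw f (Vn n) (Vn m)"
proof -
  have f: "f x = (\<lambda>k. \<Sum>i<n. x i * f (uv i) k)" if "x \<in> Vn n" for x
    using alg_hom_sum[OF hom, of "{..<n}" uv x] Vn_sum_uv[OF that] by simp
  have Vm: "f x \<in> Vn m" if "x \<in> Vn n" for x using alg_hom_simps(1)[OF hom that that] .
  have ind: "\<forall>i<n. y i = 0" if "\<forall>k<m. (\<Sum>i<n. y i * f (uv i) k) = 0" for y
  proof -
    let ?y = "\<lambda>i. if i < n then y i else 0"
    have y: "?y \<in> Vn n" by (simp add: Vn_def)
    have "f ?y k = 0" for k
      using that Vm[OF y] f[OF y] by (cases "k < m") (auto simp: Vn_def)
    then have "f ?y = f zv" using alg_hom_zv[OF hom] by (simp add: zv_def fun_eq_iff)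
    then have "?y = zv" using inj_onD[OF inj] y zv_in_Vn by blast
    then have "?y i = 0" for i unfolding zv_def by (rule fun_cong)
    then show ?thesis by presburger
  qed
  show "n \<le> m"
  proof (rule ccontr)
    assume "\<not> n \<le> m"
    then obtain y where "\<exists>i\<in>{..<n}. y i \<noteq> 0" "\<forall>k\<in>{..<m}. (\<Sum>i\<in>{..<n}. y i * f (uv i) k) = 0"
      using homogeneous_system_nontrivial_solution[of "{..<m}" "{..<n}" "\<lambda>i. f (uv i)"] by auto
    then show False using ind by auto
  qed
  assume nm: "n = m"
  have "v \<in> f ` Vn n" if "v \<in> Vn m" for v
  proof -
    obtain y where y: "\<forall>k\<in>{..<n}. (\<Sum>i<n. y i * f (uv i) k) = v k"
      using solve_of_independent_rows[of "{..<n}" "\<lambda>i. f (uv i)" v] ind nm by auto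
    let ?y = "\<lambda>i. if i < n then y i else 0"
    have y': "?y \<in> Vn n" by (simp add: Vn_def)
    have "f ?y k = v k" for k
      using y Vm[OF y'] f[OF y'] nm that by (cases "k < n") (auto simp: Vn_def)
    then show ?thesis using y' by (intro image_eqI[of v f ?y]) (auto simp: fun_eq_iff)
  qed
  then show "bij_betw f (Vn n) (Vn m)" using inj Vm by (auto simp: bij_betw_def)
qed

section \<open>Evolution algebras in matrix form\<close>

text \<open>The unit vectors form a natural basis, and row \<open>i\<close> of \<open>A\<close> is
  the square of the \<open>i\<close>-th one. A nonzero entry \<open>A i k\<close> is an edge from
  \<open>i\<close> to \<open>k\<close> in the graph of the algebra.\<close>

definition evo :: "(nat \<Rightarrow> nat \<Rightarrow> complex) \<Rightarrow> sconst" where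
  "evo A = (\<lambda>i j k. if i = j then A i k else 0)"

lemma mult_evo: "mult n (evo A) x y = (\<lambda>k. if k < n then \<Sum>i<n. x i * y i * A i k else 0)"
proof -
  have "(\<Sum>j<n. x i * y j * evo A i j k) = x i * y i * A i k" if "i < n" for i k
  proof -
    have "(\<Sum>j<n. x i * y j * evo A i j k) = (\<Sum>j<n. if j = i then x i * y i * A i k else 0)"
      by (intro sum.cong) (auto simp: evo_def)
    then show ?thesis using that by simp
  qed
  then show ?thesis by (simp add: mult_def fun_eq_iff)
qed

lemma mult_evo_commute: "mult n (evo A) x y = mult n (evo A) y x"
  by (simp add: mult_evo fun_eq_iff mult_ac)

lemma mult_evo_uv: "i < n \<Longrightarrow> mult n (evo A) x (uv i) = (\<lambda>k. if k < n then x i * A i k else 0)"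
proof -
  assume i: "i < n"
  have "(\<Sum>j<n. x j * uv i j * A j k) = (\<Sum>j<n. if j = i then x i * A i k else 0)" for k
    by (intro sum.cong) (auto simp: uv_def)
  then show ?thesis using i by (simp add: mult_evo fun_eq_iff)
qed

lemma mult_evo_uv_same:
  assumes "i < n"
  shows "mult n (evo A) (uv i) (uv i) = (\<lambda>k. if k < n then A i k else 0)"
proof -
  have "uv i i = 1" by (simp add: uv_def)
  then show ?thesis by (simp add: mult_evo_uv[OF assms] fun_eq_iff)
qed

lemma mult_evo_uv_distinct:
  assumes "j < n" "i \<noteq> j"
  shows "mult n (evo A) (uv i) (uv j) = zv"
proof -
  have "uv i j = 0" using assms(2) by (simp add: uv_def)
  then show ?thesis by (simp add: mult_evo_uv[OF assms(1)] zv_def fun_eq_iff)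
qed

lemma is_basis_independent:
  assumes "is_basis n b" "\<And>k. k < n \<Longrightarrow> (\<Sum>i<n. a i * b i k) = 0"
  shows "\<forall>i<n. a i = 0"
proof -
  define a' where "a' = (\<lambda>i. if i < n then a i else 0)"
  define P where "P a \<longleftrightarrow> (\<forall>i\<ge>n. a i = 0) \<and> zv = (\<lambda>k. \<Sum>i<n. a i * b i k)" for a
  have b: "\<forall>i<n. b i \<in> Vn n" and ex1: "\<exists>!a. P a"
    using assms(1) by (auto simp: is_basis_def P_def)
  have "(\<Sum>i<n. a' i * b i k) = 0" for k
    using assms(2) b by (cases "k < n") (auto simp: Vn_def a'_def)
  then have "P a'" by (simp add: P_def zv_def a'_def)
  moreover have "P (\<lambda>_. 0)" by (simp add: P_def zv_def)
  ultimately have "a' = (\<lambda>_. 0)" using ex1 by blast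
  then have "a' i = 0" for i by (rule fun_cong)
  then show ?thesis unfolding a'_def by presburger
qed

lemma evolution_iso_evo:
  assumes "is_evolution n c"
  shows "\<exists>A. alg_iso n c n (evo A)"
proof -
  obtain b where b: "is_basis n b" "\<forall>i<n. \<forall>j<n. i \<noteq> j \<longrightarrow> mult n c (b i) (b j) = zv"
    using assms by (auto simp: is_evolution_def natural_basis_def)
  have "\<exists>a. mult n c (b i) (b i) = (\<lambda>k. \<Sum>l<n. a l * b l k)" for i
    using b(1) mult_in_Vn[of n c "b i" "b i"] unfolding is_basis_def by blast
  then obtain A where A: "\<And>i. mult n c (b i) (b i) = (\<lambda>k. \<Sum>l<n. A i l * b l k)" by metis
  have "alg_iso n (evo A) n c"
  proof (rule alg_iso_of_basis)
    show "b i \<in> Vn n" if "i < n" for i using b(1) that by (simp add: is_basis_def)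
    show "\<forall>i<n. a i = 0" if "\<And>k. k < n \<Longrightarrow> (\<Sum>i<n. a i * b i k) = 0" for a
      using is_basis_independent[OF b(1) that] .
    show "mult n c (b i) (b j) = (\<lambda>k. \<Sum>l<n. evo A i j l * b l k)" if "i < n" "j < n" for i j
      using that b(2) A by (cases "i = j") (auto simp: evo_def zv_def)
  qed
  then show ?thesis using alg_iso_sym by blast
qed

lemma is_evolution_evo: "is_evolution n (evo A)"
proof -
  have "is_basis n uv"
    unfolding is_basis_def
  proof (intro conjI ballI)
    fix v assume v: "v \<in> Vn n"
    show "\<exists>!a. (\<forall>i\<ge>n. a i = 0) \<and> v = (\<lambda>k. \<Sum>i<n. a i * uv i k)"
    proof (rule ex1I[of _ v])
      show "(\<forall>i\<ge>n. v i = 0) \<and> v = (\<lambda>k. \<Sum>i<n. v i * uv i k)"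
        using v by (simp add: Vn_sum_uv) (simp add: Vn_def)
      fix a assume "(\<forall>i\<ge>n. a i = 0) \<and> v = (\<lambda>k. \<Sum>i<n. a i * uv i k)"
      then show "a = v" using Vn_sum_uv[of a n] by (simp add: Vn_def)
    qed
  qed simp
  then show ?thesis
    unfolding is_evolution_def natural_basis_def using mult_evo_uv_distinct by blast
qed

text \<open>Weights that at least double along every edge bound the powers: the vectors in the
  \<open>k\<close>-th power are supported on indices of weight at least \<open>k\<close>. All upper
  bounds for the index of nilpotency come from a choice of \<open>W\<close>.\<close>

lemma apow_evo_weight:
  fixes W :: "nat \<Rightarrow> nat"
  assumes W: "\<And>i. i < n \<Longrightarrow> 1 \<le> W i"
    and A: "\<And>i k. i < n \<Longrightarrow> k < n \<Longrightarrow> A i k \<noteq> 0 \<Longrightarrow> 2 * W i \<le> W k"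
    and "0 < k" "x \<in> apow n (evo A) k" "l < n" "x l \<noteq> 0"
  shows "k \<le> W l"
  using assms(3-)
proof (induction k arbitrary: x l rule: less_induct)
  case (less k)
  show ?case
  proof (cases "k = 1")
    case True
    then show ?thesis using W less.prems by simp
  next
    case False
    let ?T = "{x. \<forall>l<n. x l \<noteq> 0 \<longrightarrow> k \<le> W l}"
    have "apow n (evo A) k \<subseteq> ?T"
    proof (rule apow_subset)
      show "vsubspace ?T"
        by (auto simp: vsubspace_def zv_def vadd_def vscale_def)
      show "2 \<le> k" using False less.prems by simp
      fix i j x y
      assume ij: "0 < i" "0 < j" "i + j = k"
        and xy: "x \<in> apow n (evo A) i" "y \<in> apow n (evo A) j"
      have "k \<le> W l" if l: "l < n" "mult n (evo A) x y l \<noteq> 0" for l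
      proof -
        have "(\<Sum>p<n. x p * y p * A p l) \<noteq> 0" using l by (simp add: mult_evo)
        then obtain p where p: "p < n" "x p \<noteq> 0" "y p \<noteq> 0" "A p l \<noteq> 0"
          by (metis (no_types, lifting) lessThan_iff mult_zero_left mult_zero_right sum.neutral)
        \<comment> \<open>Hence \<open>k = i + j\<close> is at most \<open>2 * W p\<close>, which
          the edge from \<open>p\<close> to \<open>l\<close> bounds by \<open>W l\<close>.\<close>
        have "i \<le> W p" "j \<le> W p" using less.IH ij xy p by auto
        then show ?thesis using A[OF p(1) l(1) p(4)] ij(3) by simp
      qed
      then show "mult n (evo A) x y \<in> ?T" by blast
    qed
    then show ?thesis using less.prems by blast
  qed
qed

lemma apow_evo_weight_trivial:
  fixes W :: "nat \<Rightarrow> nat"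
  assumes "\<And>i. i < n \<Longrightarrow> 1 \<le> W i"
    and "\<And>i k. i < n \<Longrightarrow> k < n \<Longrightarrow> A i k \<noteq> 0 \<Longrightarrow> 2 * W i \<le> W k"
    and "\<And>i. i < n \<Longrightarrow> W i < k" "0 < k"
  shows "apow n (evo A) k = {zv}"
proof -
  have "x = zv" if x: "x \<in> apow n (evo A) k" for x
  proof -
    have "x l = 0" for l
    proof (cases "l < n")
      case True
      then show ?thesis
        using apow_evo_weight[OF assms(1,2,4) x True] assms(3)[OF True] by fastforce
    next
      case False
      then show ?thesis using apow_subset_Vn[OF assms(4), of n "evo A"] x by (auto simp: Vn_def)
    qed
    then show ?thesis by (simp add: zv_def fun_eq_iff)
  qed
  then show ?thesis using zv_in_apow[OF assms(4)] by blast
qed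

text \<open>A topological order of the graph, built greedily: nilpotency always leaves an index
  whose edges all end among those already listed.\<close>

lemma nilpotent_evo_order:
  assumes nil: "nilpotent n (evo A)"
  shows "\<exists>fs. distinct fs \<and> set fs = {..<n} \<and>
    (\<forall>p<n. \<forall>k<n. A (fs ! p) k \<noteq> 0 \<longrightarrow> k \<in> set (take p fs))"
proof -
  \<comment> \<open>If every index outside \<open>J\<close> had an edge to another index outside
    \<open>J\<close> or to itself, multiplying repeatedly by suitable unit vectors would produce
    elements of all powers that do not vanish outside \<open>J\<close>.\<close>
  have step: "\<exists>i<n. i \<notin> J \<and> (\<forall>k<n. A i k \<noteq> 0 \<longrightarrow> k \<in> J)" if J: "\<not> {..<n} \<subseteq> J" for J
  proof (rule ccontr)
    assume "\<not> ?thesis"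
    then have out: "\<exists>k<n. k \<notin> J \<and> A i k \<noteq> 0" if "i < n" "i \<notin> J" for i using that by blast
    have "\<exists>x\<in>apow n (evo A) (Suc m). \<exists>i<n. i \<notin> J \<and> x i \<noteq> 0" for m
    proof (induction m)
      case 0
      obtain i where "i < n" "i \<notin> J" using J by blast
      then show ?case by (intro bexI[of _ "uv i"] exI[of _ i]) (auto simp: apow_1, simp add: uv_def)
    next
      case (Suc m)
      then obtain x i where x: "x \<in> apow n (evo A) (Suc m)" "i < n" "i \<notin> J" "x i \<noteq> 0" by blast
      obtain k where k: "k < n" "k \<notin> J" "A i k \<noteq> 0" using out x by blast
      have "mult n (evo A) x (uv i) \<in> apow n (evo A) (Suc m + 1)"
        using x by (intro apow_mult) (auto simp: apow_1)
      moreover have "mult n (evo A) x (uv i) k \<noteq> 0" using x k by (simp add: mult_evo_uv)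
      ultimately show ?case using k by auto
    qed
    moreover obtain m where "apow n (evo A) (Suc m) = {zv}"
      using nil by (auto simp: nilpotent_def dest!: Suc_le_D)
    ultimately have "\<exists>x\<in>{zv}. \<exists>i<n. i \<notin> J \<and> x i \<noteq> 0" by metis
    then show False by (simp add: zv_def)
  qed
  have "\<exists>fs. length fs = m \<and> distinct fs \<and> set fs \<subseteq> {..<n} \<and>
    (\<forall>p<m. \<forall>k<n. A (fs ! p) k \<noteq> 0 \<longrightarrow> k \<in> set (take p fs))" if "m \<le> n" for m
    using that
  proof (induction m)
    case 0
    then show ?case by simp
  next
    case (Suc m)
    then obtain fs where fs: "length fs = m" "distinct fs" "set fs \<subseteq> {..<n}"
      "\<forall>p<m. \<forall>k<n. A (fs ! p) k \<noteq> 0 \<longrightarrow> k \<in> set (take p fs)" by auto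
    have "\<not> {..<n} \<subseteq> set fs"
    proof
      assume "{..<n} \<subseteq> set fs"
      then have "n \<le> card (set fs)" using card_mono[of "set fs" "{..<n}"] by simp
      also have "\<dots> \<le> m" using card_length[of fs] fs(1) by simp
      finally show False using Suc.prems by simp
    qed
    from step[OF this] obtain i where i: "i < n" "i \<notin> set fs" "\<forall>k<n. A i k \<noteq> 0 \<longrightarrow> k \<in> set fs"
      by blast
    show ?case
      using fs i by (intro exI[of _ "fs @ [i]"]) (auto simp: nth_append less_Suc_eq)
  qed
  from this[of n] obtain fs where fs: "length fs = n" "distinct fs" "set fs \<subseteq> {..<n}"
    "\<forall>p<n. \<forall>k<n. A (fs ! p) k \<noteq> 0 \<longrightarrow> k \<in> set (take p fs)" by auto
  have "set fs = {..<n}"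
    using fs(1-3) by (intro card_subset_eq) (auto simp: distinct_card)
  then show ?thesis using fs by blast
qed

section \<open>Maximal index of nilpotency\<close>

lemma alg_iso_evo_relabel:
  assumes \<sigma>: "bij_betw \<sigma> {..<n} {..<n}"
  shows "alg_iso n (evo (\<lambda>i k. A (\<sigma> i) (\<sigma> k))) n (evo A)"
proof (rule alg_iso_of_basis)
  have inj: "\<sigma> i = \<sigma> j \<longleftrightarrow> i = j" if "i < n" "j < n" for i j
    using \<sigma> that by (auto simp: bij_betw_def inj_on_def)
  have lt: "\<sigma> i < n" if "i < n" for i using \<sigma> that by (auto simp: bij_betw_def)
  show "uv (\<sigma> i) \<in> Vn n" if "i < n" for i using lt[OF that] by simp
  show "\<forall>i<n. a i = 0" if a: "\<And>k. k < n \<Longrightarrow> (\<Sum>i<n. a i * uv (\<sigma> i) k) = 0" for a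
  proof (intro allI impI)
    fix j assume j: "j < n"
    have "(\<Sum>i<n. a i * uv (\<sigma> i) (\<sigma> j)) = (\<Sum>i<n. if i = j then a j else 0)"
      using j inj by (intro sum.cong) (auto simp: uv_def)
    then show "a j = 0" using a[OF lt[OF j]] j by simp
  qed
  show "mult n (evo A) (uv (\<sigma> i)) (uv (\<sigma> j)) =
      (\<lambda>k. \<Sum>l<n. evo (\<lambda>i k. A (\<sigma> i) (\<sigma> k)) i j l * uv (\<sigma> l) k)" if ij: "i < n" "j < n" for i j
  proof (cases "i = j")
    case False
    then show ?thesis
      using mult_evo_uv_distinct[of "\<sigma> j" n "\<sigma> i" A] ij lt inj by (simp add: zv_def) (simp add: evo_def)
  next
    case True
    have "(\<Sum>l<n. A (\<sigma> i) (\<sigma> l) * uv (\<sigma> l) k) = (if k < n then A (\<sigma> i) k else 0)" for k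
    proof -
      have "(\<Sum>l<n. A (\<sigma> i) (\<sigma> l) * uv (\<sigma> l) k) = (\<Sum>l<n. A (\<sigma> i) l * uv l k)"
        using sum.reindex_bij_betw[OF \<sigma>, of "\<lambda>l. A (\<sigma> i) l * uv l k"] .
      also have "\<dots> = (\<Sum>l<n. if l = k then A (\<sigma> i) k else 0)"
        by (intro sum.cong) (auto simp: uv_def)
      finally show ?thesis by simp
    qed
    then show ?thesis using True mult_evo_uv_same[OF lt[OF ij(1)]] by (simp add: evo_def[of "\<lambda>i k. A (\<sigma> i) (\<sigma> k)"])
  qed
qed

section \<open>Triangular matrices and the index of nilpotency\<close>

definition strict_lower :: "nat \<Rightarrow> (nat \<Rightarrow> nat \<Rightarrow> complex) \<Rightarrow> bool" where
  "strict_lower n D \<longleftrightarrow> (\<forall>i<n. \<forall>k<n. D i k \<noteq> 0 \<longrightarrow> k < i)"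

lemma strict_lowerD: "strict_lower n D \<Longrightarrow> i < n \<Longrightarrow> k < n \<Longrightarrow> i \<le> k \<Longrightarrow> D i k = 0"
  unfolding strict_lower_def by (meson not_le)

text \<open>Together with \<open>strict_lower\<close> and for positive dimension, this is the normal
  form of the algebras of maximal index of nilpotency; see \<open>max_nil_index_evo\<close> and
  \<open>max_nil_index_iso\<close>.\<close>

definition subdiag_nonzero :: "nat \<Rightarrow> (nat \<Rightarrow> nat \<Rightarrow> complex) \<Rightarrow> bool" where
  "subdiag_nonzero n D \<longleftrightarrow> (\<forall>i. Suc i < n \<longrightarrow> D (Suc i) i \<noteq> 0)"

lemma nilpotent_evolution_iso_strict_lower:
  assumes "is_evolution n c" "nilpotent n c"
  shows "\<exists>D. alg_iso n c n (evo D) \<and> strict_lower n D"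
proof -
  obtain A where A: "alg_iso n c n (evo A)" using evolution_iso_evo[OF assms(1)] by blast
  then have "nilpotent n (evo A)" using alg_iso_nilpotent assms(2) by blast
  then obtain fs where fs: "distinct fs" "set fs = {..<n}"
    "\<forall>p<n. \<forall>k<n. A (fs ! p) k \<noteq> 0 \<longrightarrow> k \<in> set (take p fs)"
    using nilpotent_evo_order by blast
  have len: "length fs = n" using distinct_card[OF fs(1)] fs(2) by simp
  have bij: "bij_betw (\<lambda>i. fs ! i) {..<n} {..<n}"
    using bij_betw_nth[OF fs(1)] fs(2) len by blast
  let ?D = "\<lambda>i k. A (fs ! i) (fs ! k)"
  have "strict_lower n ?D"
    unfolding strict_lower_def
  proof (intro allI impI)
    fix i k assume ik: "i < n" "k < n" "?D i k \<noteq> 0"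
    then have "fs ! k \<in> set (take i fs)" using fs len nth_mem by blast
    then obtain l where "l < i" "fs ! l = fs ! k" by (auto simp: in_set_conv_nth)
    then show "k < i" using fs(1) ik len by (auto simp: nth_eq_iff_index_eq)
  qed
  then show ?thesis
    using alg_iso_trans[OF A alg_iso_sym[OF alg_iso_evo_relabel[OF bij]]] by blast
qed

text \<open>Edges lower the index, so weights that halve from each index to the next are admissible;
  the largest is \<open>2 ^ (s - 1)\<close>, at index 0.\<close>

lemma strict_lower_apow_trivial:
  assumes "strict_lower s D"
  shows "apow s (evo D) (2 ^ (s - 1) + 1) = {zv}"
proof (rule apow_evo_weight_trivial[where W = "\<lambda>i. 2 ^ (s - 1 - i)"])
  fix i k assume "i < s" "k < s" "D i k \<noteq> 0"
  then have "k < i" using assms by (simp add: strict_lower_def)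
  then have "Suc (s - 1 - i) \<le> s - 1 - k" using \<open>i < s\<close> by simp
  then have "(2::nat) ^ Suc (s - 1 - i) \<le> 2 ^ (s - 1 - k)" by (intro power_increasing) auto
  then show "2 * 2 ^ (s - 1 - i) \<le> (2::nat) ^ (s - 1 - k)" by simp
next
  fix i
  have "(2::nat) ^ (s - 1 - i) \<le> 2 ^ (s - 1)" by (intro power_increasing) auto
  then show "(2::nat) ^ (s - 1 - i) < 2 ^ (s - 1) + 1" by linarith
qed simp_all

text \<open>The missing edge from \<open>Suc p\<close> to \<open>p\<close> allows the exponents of
  all indices up to \<open>p\<close> to drop by one: that edge was the only one along which doubling
  would fail. The largest weight is then at most \<open>2 ^ (s - 2)\<close>.\<close>

lemma strict_lower_subdiag_zero_apow_trivial:
  assumes D: "strict_lower s D" and p: "Suc p < s" "D (Suc p) p = 0"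
  shows "apow s (evo D) (2 ^ (s - 1)) = {zv}"
proof (rule apow_evo_weight_trivial[where W = "\<lambda>i. if i \<le> p then 2 ^ (s - 2 - i) else 2 ^ (s - 1 - i)"])
  fix i k assume ik: "i < s" "k < s" "D i k \<noteq> 0"
  then have "k < i" using D by (simp add: strict_lower_def)
  moreover have "\<not> (i = Suc p \<and> k = p)" using ik p by auto
  ultimately have
    "Suc (if i \<le> p then s - 2 - i else s - 1 - i) \<le> (if k \<le> p then s - 2 - k else s - 1 - k)"
    using ik p by auto
  then have "(2::nat) ^ Suc (if i \<le> p then s - 2 - i else s - 1 - i) \<le>
      2 ^ (if k \<le> p then s - 2 - k else s - 1 - k)"
    by (intro power_increasing) auto
  then show "2 * (if i \<le> p then 2 ^ (s - 2 - i) else 2 ^ (s - 1 - i)) \<le>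
      (if k \<le> p then 2 ^ (s - 2 - k) else (2::nat) ^ (s - 1 - k))"
    by (auto split: if_splits)
next
  fix i
  have "(2::nat) ^ (if i \<le> p then s - 2 - i else s - 1 - i) < 2 ^ (s - 1)"
    using p by (intro power_strict_increasing) auto
  then show "(if i \<le> p then 2 ^ (s - 2 - i) else 2 ^ (s - 1 - i)) < (2::nat) ^ (s - 1)"
    by (auto split: if_splits)
qed simp_all

lemma subdiag_nonzero_apow_nontrivial:
  assumes D: "strict_lower s D" "subdiag_nonzero s D" and "0 < s"
  shows "apow s (evo D) (2 ^ (s - 1)) \<noteq> {zv}"
proof -
  let ?x = "\<lambda>j. ((\<lambda>y. mult s (evo D) y y) ^^ j) (uv (s - 1))"
  \<comment> \<open>Each squaring moves the highest nonzero coordinate down by exactly one: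
    triangularity clears what lies above, and the subdiagonal entry keeps the new top coordinate
    nonzero.\<close>
  have "?x j (s - 1 - j) \<noteq> 0 \<and> (\<forall>l<s. s - 1 - j < l \<longrightarrow> ?x j l = 0)" if "j < s" for j
    using that
  proof (induction j)
    case 0
    then show ?case by (auto simp: uv_def)
  next
    case (Suc j)
    define x where "x = ?x j"
    define m where "m = s - 1 - Suc j"
    have m: "s - 1 - j = Suc m" "Suc m < s" using Suc.prems by (auto simp: m_def)
    have x: "x (Suc m) \<noteq> 0" "\<And>l. l < s \<Longrightarrow> Suc m < l \<Longrightarrow> x l = 0"
      using Suc unfolding x_def m(1)[symmetric] by auto
    have sq: "?x (Suc j) k = (if k < s then \<Sum>i<s. x i * x i * D i k else 0)" for k
      by (simp add: x_def mult_evo)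
    have "(\<Sum>i<s. x i * x i * D i m) = (\<Sum>i<s. if i = Suc m then x i * x i * D i m else 0)"
    proof (intro sum.cong refl)
      fix i assume i: "i \<in> {..<s}"
      consider "i = Suc m" | "Suc m < i" | "i \<le> m" by linarith
      then show "x i * x i * D i m = (if i = Suc m then x i * x i * D i m else 0)"
        using i x(2) strict_lowerD[OF D(1), of i m] m(2) by cases auto
    qed
    then have "?x (Suc j) m \<noteq> 0"
      unfolding sq using x(1) m(2) D(2) by (simp add: subdiag_nonzero_def)
    moreover have "?x (Suc j) l = 0" if l: "l < s" "m < l" for l
    proof -
      have "x i * x i * D i l = 0" if "i < s" for i
        using x(2)[OF that] strict_lowerD[OF D(1) that l(1)] l(2) by (cases "l < i") auto
      then show ?thesis unfolding sq by (auto intro: sum.neutral)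
    qed
    ultimately show ?case unfolding m_def by blast
  qed
  from this[of "s - 1"] have "?x (s - 1) \<noteq> zv" using assms(3) by (auto simp: zv_def)
  moreover have "?x (s - 1) \<in> apow s (evo D) (2 ^ (s - 1))"
    using assms(3) by (intro apow_iterated_square) simp
  ultimately show ?thesis by blast
qed

lemma strict_lower_nilpotent: "strict_lower s D \<Longrightarrow> nilpotent s (evo D)"
  using strict_lower_apow_trivial[of s D] unfolding nilpotent_def by (metis le_add2)

lemma nil_index_le: "1 \<le> k \<Longrightarrow> apow n c k = {zv} \<Longrightarrow> nil_index n c \<le> k"
  unfolding nil_index_def by (rule Least_le) simp

lemma subdiag_nonzero_nil_index:
  assumes D: "strict_lower s D" "subdiag_nonzero s D" and "0 < s"
  shows "2 ^ (s - 1) < nil_index s (evo D)"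
proof (rule ccontr)
  assume le: "\<not> ?thesis"
  have "1 \<le> nil_index s (evo D) \<and> apow s (evo D) (nil_index s (evo D)) = {zv}"
    unfolding nil_index_def
    by (rule LeastI[of _ "2 ^ (s - 1) + 1"]) (use strict_lower_apow_trivial[OF D(1)] in simp)
  then have "apow s (evo D) (2 ^ (s - 1)) \<subseteq> {zv}"
    using apow_antimono[of "nil_index s (evo D)" "2 ^ (s - 1)" s "evo D"] le by auto
  then show False
    using subdiag_nonzero_apow_nontrivial[OF assms] zv_in_apow[of "2 ^ (s - 1)" s "evo D"] by auto
qed

lemma max_nil_index_evo:
  assumes "strict_lower s D" "subdiag_nonzero s D" "0 < s"
  shows "max_nil_index s (evo D)"
  unfolding max_nil_index_def
proof (intro conjI allI impI)
  fix d' assume d': "is_evolution s d' \<and> nilpotent s d'"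
  then obtain D' where D': "alg_iso s d' s (evo D')" "strict_lower s D'"
    using nilpotent_evolution_iso_strict_lower by blast
  have "nil_index s d' \<le> 2 ^ (s - 1) + 1"
    using nil_index_le[OF _ strict_lower_apow_trivial[OF D'(2)]] alg_iso_nil_index[OF D'(1)] by simp
  then show "nil_index s d' \<le> nil_index s (evo D)"
    using subdiag_nonzero_nil_index[OF assms] by simp
qed (use assms in \<open>auto simp: is_evolution_evo strict_lower_nilpotent\<close>)

text \<open>The comparison algebra \<open>?N\<close>, with ones exactly below the diagonal, forces
  an index above \<open>2 ^ (s - 1)\<close>, while a vanishing subdiagonal entry would bound the
  index by \<open>2 ^ (s - 1)\<close>.\<close>

lemma max_nil_index_iso:
  assumes "max_nil_index s d" "0 < s"
  shows "\<exists>D. alg_iso s d s (evo D) \<and> strict_lower s D \<and> subdiag_nonzero s D"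
proof -
  obtain D where D: "alg_iso s d s (evo D)" "strict_lower s D"
    using assms(1) nilpotent_evolution_iso_strict_lower unfolding max_nil_index_def by blast
  let ?N = "\<lambda>i k. if i = Suc k then 1 else 0"
  have N: "strict_lower s ?N" "subdiag_nonzero s ?N"
    by (auto simp: strict_lower_def subdiag_nonzero_def split: if_splits)
  have "2 ^ (s - 1) < nil_index s (evo ?N)" by (rule subdiag_nonzero_nil_index[OF N assms(2)])
  also have "\<dots> \<le> nil_index s d"
    using assms(1) is_evolution_evo strict_lower_nilpotent[OF N(1)] unfolding max_nil_index_def by blast
  finally have gt: "2 ^ (s - 1) < nil_index s (evo D)" using alg_iso_nil_index[OF D(1)] by simp
  have "D (Suc p) p \<noteq> 0" if "Suc p < s" for p
    using nil_index_le[OF _ strict_lower_subdiag_zero_apow_trivial[OF D(2) that]] gt by force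
  then show ?thesis using D by (auto simp: subdiag_nonzero_def)
qed

text \<open>In triangular form the annihilator lies in the line of the vector with index 0, and each
  vector of that line is a square of a multiple of the vector with index 1. This is what later
  cancels the zero summand.\<close>

lemma max_nil_index_annihilator:
  assumes "max_nil_index s d" "2 \<le> s" "x \<in> Vn s" "\<And>y. y \<in> Vn s \<Longrightarrow> mult s d x y = zv"
  shows "\<exists>w\<in>Vn s. x = mult s d w w"
proof -
  obtain D f where D: "strict_lower s D" "subdiag_nonzero s D"
    and f: "bij_betw f (Vn s) (Vn s)" "alg_hom s d s (evo D) f"
    using max_nil_index_iso[OF assms(1)] assms(2) unfolding alg_iso_alt by auto
  note h = alg_hom_simps[OF f(2)]
  \<comment> \<open>Multiplication by the unit vector \<open>Suc p\<close> exposes this coordinate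
    through the nonzero subdiagonal entry.\<close>
  have 0: "f x (Suc p) = 0" if p: "Suc p < s" for p
  proof -
    have "uv (Suc p) \<in> f ` Vn s" using f(1) p by (simp add: bij_betw_def)
    then obtain y where y: "y \<in> Vn s" "uv (Suc p) = f y" by blast
    then have "mult s (evo D) (f x) (uv (Suc p)) = zv"
      using assms(4)[OF y(1)] h(3)[OF assms(3) y(1)] alg_hom_zv[OF f(2)] by simp
    from fun_cong[OF this, of p] show ?thesis
      using p D(2) by (simp add: mult_evo_uv zv_def subdiag_nonzero_def)
  qed
  have D10: "D (Suc 0) 0 \<noteq> 0" using D(2) assms(2) by (simp add: subdiag_nonzero_def)
  let ?t = "csqrt (f x 0 / D (Suc 0) 0)"
  have "mult s (evo D) (vscale ?t (uv (Suc 0))) (vscale ?t (uv (Suc 0))) = f x"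
  proof
    fix k
    consider "k = 0" | "0 < k" "k < s" | "s \<le> k" by linarith
    then show "mult s (evo D) (vscale ?t (uv (Suc 0))) (vscale ?t (uv (Suc 0))) k = f x k"
    proof cases
      case 1
      have "?t * ?t * D (Suc 0) 0 = f x 0"
        using D10 by (simp flip: power2_eq_square)
      then show ?thesis using 1 assms(2)
        by (simp add: mult_vscale_left mult_vscale_right mult_evo_uv) (simp add: vscale_def uv_def mult_ac)
    next
      case 2
      then have "f x k = 0" using 0[of "k - 1"] by simp
      moreover have "D (Suc 0) k = 0" using 2 assms(2) by (intro strict_lowerD[OF D(1)]) auto
      ultimately show ?thesis using 2 assms(2)
        by (simp add: mult_vscale_left mult_vscale_right mult_evo_uv) (simp add: vscale_def)
    next
      case 3
      then show ?thesis using h(1)[OF assms(3,3)] mult_in_Vn by (simp add: Vn_def)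
    qed
  qed
  moreover have "vscale ?t (uv (Suc 0)) \<in> f ` Vn s"
    using f(1) assms(2) by (simp add: bij_betw_def)
  then obtain w where w: "w \<in> Vn s" "vscale ?t (uv (Suc 0)) = f w" by blast
  ultimately have "f (mult s d w w) = f x" using h(3)[OF w(1,1)] by simp
  then have "mult s d w w = x"
    using f(1) assms(3) mult_in_Vn unfolding bij_betw_def by (metis inj_onD)
  then show ?thesis using w(1) by blast
qed

lemma max_nil_index_nonzero_square:
  assumes "max_nil_index s d" "2 \<le> s"
  shows "\<exists>x\<in>Vn s. mult s d x x \<noteq> zv"
proof -
  obtain D f where D: "subdiag_nonzero s D"
    and f: "bij_betw f (Vn s) (Vn s)" "alg_hom s d s (evo D) f"
    using max_nil_index_iso[OF assms(1)] assms(2) unfolding alg_iso_alt by auto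
  have "uv (Suc 0) \<in> f ` Vn s" using f(1) assms(2) by (simp add: bij_betw_def)
  then obtain x where x: "x \<in> Vn s" "f x = uv (Suc 0)" by (metis imageE)
  have "mult s (evo D) (uv (Suc 0)) (uv (Suc 0)) 0 \<noteq> 0"
    using assms(2) D by (simp add: mult_evo_uv subdiag_nonzero_def) (simp add: uv_def)
  then have "f (mult s d x x) \<noteq> zv"
    using alg_hom_simps(3)[OF f(2) x(1,1)] x(2) by (auto simp: zv_def)
  then show ?thesis using x(1) alg_hom_zv[OF f(2)] by metis
qed

section \<open>Non-isomorphism\<close>

lemma alg_hom_inj:
  assumes "alg_hom n c m d f" "\<And>x. x \<in> Vn n \<Longrightarrow> f x = zv \<Longrightarrow> x = zv"
  shows "inj_on f (Vn n)"
proof (rule inj_onI)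
  fix x y assume xy: "x \<in> Vn n" "y \<in> Vn n" "f x = f y"
  let ?z = "vadd x (vscale (- 1) y)"
  have "f ?z = vadd (f x) (vscale (- 1) (f y))"
    using alg_hom_simps(2)[OF assms(1), of x "vscale (- 1) y"] alg_hom_simps(4)[OF assms(1) xy(2,2)] xy
    by simp
  also have "\<dots> = zv" using xy(3) by (simp add: vadd_def vscale_def zv_def)
  finally have "?z = zv" using assms(2)[of ?z] xy by simp
  then have "?z k = zv k" for k by simp
  then show "x = y" by (simp add: vadd_def vscale_def zv_def fun_eq_iff)
qed

lemma alg_hom_iterated_square:
  assumes "alg_hom n c m d f" "x \<in> Vn n"
  shows "((\<lambda>y. mult n c y y) ^^ k) x \<in> Vn n \<and>
    f (((\<lambda>y. mult n c y y) ^^ k) x) = ((\<lambda>y. mult m d y y) ^^ k) (f x)"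
  by (induction k) (use assms alg_hom_simps(3)[OF assms(1)] in auto)

section \<open>The two families and their nilpotent summand\<close>

lemma A1_eq_evo: "0 < n \<Longrightarrow> A1 n = evo (\<lambda>i k. if i = 0 \<and> k = 0 then 1 else 0)"
  by (auto simp: A1_def dsum_def idem1_def zero_alg_def evo_def fun_eq_iff)

lemma mult_A1:
  assumes "0 < n"
  shows "mult n (A1 n) x y = (\<lambda>k. if k = 0 then x 0 * y 0 else 0)"
proof -
  have eq: "(\<Sum>i<n. x i * y i * (if i = 0 \<and> k = 0 then 1 else 0)) = (if k = 0 then x 0 * y 0 else 0)" for k
  proof -
    have "(\<Sum>i<n. x i * y i * (if i = 0 \<and> k = 0 then 1 else 0)) =
        (\<Sum>i<n. if i = 0 then (if k = 0 then x 0 * y 0 else 0) else 0)"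
      by (intro sum.cong) auto
    then show ?thesis using assms by simp
  qed
  show ?thesis unfolding A1_eq_evo[OF assms] mult_evo eq using assms by (simp add: fun_eq_iff)
qed

lemma A2_eq:
  "A2 n s d i j k = (if i = 0 \<and> j = 0 \<and> k = 0 then 1
     else if 0 < i \<and> 0 < j \<and> 0 < k \<and> i \<le> s \<and> j \<le> s \<and> k \<le> s then d (i - 1) (j - 1) (k - 1) else 0)"
  by (auto simp: A2_def dsum_def idem1_def zero_alg_def)

text \<open>Projection of \<open>A2\<close> onto its nilpotent summand, which occupies the
  coordinates 1 to \<open>s\<close>; coordinate 0 is the idempotent and the rest is the zero
  summand. \<open>nil_incl\<close> is the corresponding inclusion.\<close>

definition nil_part :: "nat \<Rightarrow> vec \<Rightarrow> vec" where
  "nil_part s x = (\<lambda>k. if k < s then x (Suc k) else 0)"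

definition nil_incl :: "vec \<Rightarrow> vec" where
  "nil_incl v = (\<lambda>k. if k = 0 then 0 else v (k - 1))"

lemma sum_shift_support:
  fixes g :: "nat \<Rightarrow> complex"
  assumes "s < n" "g 0 = 0" "\<And>j. s < j \<Longrightarrow> g j = 0"
  shows "(\<Sum>j<n. g j) = (\<Sum>j<s. g (Suc j))"
proof -
  have "(\<Sum>j<n. g j) = (\<Sum>j\<in>Suc ` {..<s}. g j)"
  proof (rule sum.mono_neutral_right)
    show "\<forall>i\<in>{..<n} - Suc ` {..<s}. g i = 0"
    proof
      fix i assume i: "i \<in> {..<n} - Suc ` {..<s}"
      show "g i = 0"
      proof (cases i)
        case (Suc j)
        then show ?thesis using i assms(3)[of i] by (cases "j < s") auto
      qed (simp add: assms(2))
    qed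
  qed (use assms(1) in auto)
  then show ?thesis by (simp add: sum.reindex)
qed

lemma mult_A2:
  assumes "s < n"
  shows "mult n (A2 n s d) x y =
    (\<lambda>k. if k = 0 then x 0 * y 0 else mult s d (nil_part s x) (nil_part s y) (k - 1))"
proof
  fix k
  show "mult n (A2 n s d) x y k =
    (if k = 0 then x 0 * y 0 else mult s d (nil_part s x) (nil_part s y) (k - 1))"
  proof (cases "k = 0")
    case True
    have "(\<Sum>j<n. x i * y j * A2 n s d i j 0) = (if i = 0 then x 0 * y 0 else 0)" for i
    proof -
      have "(\<Sum>j<n. x i * y j * A2 n s d i j 0) =
          (\<Sum>j<n. if j = 0 then (if i = 0 then x 0 * y 0 else 0) else 0)"
        by (intro sum.cong) (auto simp: A2_eq)
      then show ?thesis using assms by simp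
    qed
    then show ?thesis using True assms by (simp add: mult_def)
  next
    case False
    then obtain l where l: "k = Suc l" by (cases k) auto
    show ?thesis
    proof (cases "l < s")
      case True
      have "(\<Sum>i<n. \<Sum>j<n. x i * y j * A2 n s d i j k) =
          (\<Sum>i<s. \<Sum>j<n. x (Suc i) * y j * A2 n s d (Suc i) j k)"
        using assms by (intro sum_shift_support) (auto simp: A2_eq l intro!: sum.neutral)
      also have "\<dots> = (\<Sum>i<s. \<Sum>j<s. x (Suc i) * y (Suc j) * A2 n s d (Suc i) (Suc j) k)"
        using assms by (intro sum.cong refl sum_shift_support) (auto simp: A2_eq l)
      also have "\<dots> = (\<Sum>i<s. \<Sum>j<s. nil_part s x i * nil_part s y j * d i j l)"
        using True by (intro sum.cong) (auto simp: A2_eq l nil_part_def)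
      finally show ?thesis using True assms by (simp add: mult_def l)
    next
      case False
      then show ?thesis by (auto simp: mult_def A2_eq l intro!: sum.neutral)
    qed
  qed
qed

lemma nil_part_hom:
  assumes "s < n"
  shows "alg_hom n (A2 n s d) s d (nil_part s)"
proof -
  have "nil_part s (mult n (A2 n s d) x y) = mult s d (nil_part s x) (nil_part s y)" for x y
    unfolding mult_A2[OF assms] using mult_in_Vn[of s d "nil_part s x" "nil_part s y"]
    by (auto simp: nil_part_def[of s "\<lambda>k. _ k"] Vn_def fun_eq_iff)
  then show ?thesis
    by (auto simp: alg_hom_def) (auto simp: nil_part_def Vn_def vadd_def vscale_def)
qed

lemma nil_part_incl: "x \<in> Vn s \<Longrightarrow> nil_part s (nil_incl x) = x"
  by (auto simp: nil_part_def nil_incl_def Vn_def fun_eq_iff)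

lemma nil_incl_hom:
  assumes "s < n"
  shows "alg_hom s d n (A2 n s d) nil_incl"
proof -
  have "nil_incl (mult s d x y) = mult n (A2 n s d) (nil_incl x) (nil_incl y)"
    if "x \<in> Vn s" "y \<in> Vn s" for x y
    unfolding mult_A2[OF assms] nil_part_incl[OF that(1)] nil_part_incl[OF that(2)]
    by (auto simp: nil_incl_def fun_eq_iff)
  moreover have "nil_incl x \<in> Vn n" if "x \<in> Vn s" for x
    using that assms by (auto simp: nil_incl_def Vn_def)
  ultimately show ?thesis
    by (auto simp: alg_hom_def) (auto simp: nil_incl_def vadd_def vscale_def fun_eq_iff)
qed

lemma nil_incl_eq_zv: "nil_incl x = zv \<Longrightarrow> x = zv"
proof
  fix k assume "nil_incl x = zv"
  then have "nil_incl x (Suc k) = zv (Suc k)" by simp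
  then show "x k = zv k" by (simp add: nil_incl_def zv_def)
qed

text \<open>Squares in \<open>A1\<close> are multiples of the idempotent, so a nonzero square never
  squares to zero. In \<open>A2\<close> there is such an element.\<close>

lemma A1_not_iso_A2:
  assumes "s < n" "2 \<le> s" "max_nil_index s d"
  shows "\<not> alg_iso n (A1 n) n (A2 n s d)"
proof
  assume "alg_iso n (A1 n) n (A2 n s d)"
  then obtain f where f: "bij_betw f (Vn n) (Vn n)" "alg_hom n (A1 n) n (A2 n s d) f"
    unfolding alg_iso_alt by blast
  let ?sq = "\<lambda>y. mult s d y y"
  obtain x where x: "x \<in> Vn s" "?sq x \<noteq> zv" using max_nil_index_nonzero_square[OF assms(3,2)] by blast
  have "\<exists>k. (?sq ^^ k) x = zv"
    using assms(3) x(1) nilpotent_iterated_square unfolding max_nil_index_def by blast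
  then obtain k where k: "(?sq ^^ k) x = zv" "\<And>j. j < k \<Longrightarrow> (?sq ^^ j) x \<noteq> zv"
    using exists_least_iff[of "\<lambda>k. (?sq ^^ k) x = zv"] by blast
  have "k \<noteq> 0" "k \<noteq> 1" using k(1) x(2) by (auto intro: Suc_inject)
  then obtain j where j: "k = Suc (Suc j)" by (metis One_nat_def not0_implies_Suc)
  \<comment> \<open>The iterated square two steps before the first vanishing one.\<close>
  define y where "y = (?sq ^^ j) x"
  have y: "y \<in> Vn s" "?sq y \<noteq> zv" "?sq (?sq y) = zv"
    using k(1) k(2)[of "Suc j"] x(1) j by (auto simp: y_def) (cases j; simp)
  have "nil_incl y \<in> f ` Vn n"
    using f(1) y(1) alg_hom_simps(1)[OF nil_incl_hom[OF assms(1)]] by (auto simp: bij_betw_def)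
  then obtain u where u: "u \<in> Vn n" "f u = nil_incl y" by (metis imageE)
  let ?sq1 = "\<lambda>y. mult n (A1 n) y y"
  have "f (?sq1 u) = nil_incl (?sq y)"
    using alg_hom_simps(3)[OF f(2) u(1,1)] alg_hom_simps(3)[OF nil_incl_hom[OF assms(1)] y(1,1)] u(2)
    by simp
  moreover from this have "f (?sq1 (?sq1 u)) = nil_incl (?sq (?sq y))"
    using alg_hom_simps(3)[OF f(2), of "?sq1 u" "?sq1 u"]
      alg_hom_simps(3)[OF nil_incl_hom[OF assms(1)], of "?sq y" "?sq y"] by simp
  ultimately have "?sq1 u \<noteq> zv" "f (?sq1 (?sq1 u)) = f zv"
    using nil_incl_eq_zv[of "?sq y"] y(2,3) alg_hom_zv[OF f(2)] alg_hom_zv[OF nil_incl_hom[OF assms(1)]]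
    by auto
  moreover from this have "?sq1 (?sq1 u) = zv"
    using f(1) unfolding bij_betw_def by (meson inj_onD mult_in_Vn zv_in_Vn)
  ultimately show False using assms(1,2) by (auto simp: mult_A1 zv_def fun_eq_iff split: if_splits)
qed

text \<open>The map includes the nilpotent summand, applies \<open>f\<close>, and projects to the
  other nilpotent summand. An element \<open>x\<close> of its kernel is sent by \<open>h\<close>
  into the zero summand, so \<open>x\<close> annihilates its own algebra and is therefore a square;
  but squares have no component in the zero summand, so \<open>h x\<close> is zero.\<close>

lemma A2_hom_inj_nil:
  assumes s: "s < n" "2 \<le> s" and s': "s' < n" and d: "max_nil_index s d"
    and f: "alg_hom n (A2 n s d) n (A2 n s' d') f" "inj_on f (Vn n)"
  shows "\<exists>g. alg_hom s d s' d' g \<and> inj_on g (Vn s)"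
proof -
  define h where "h = f \<circ> nil_incl"
  have h: "alg_hom s d n (A2 n s' d') h"
    unfolding h_def by (rule alg_hom_comp[OF nil_incl_hom[OF s(1)] f(1)])
  have h0: "x = zv" if "x \<in> Vn s" "h x = zv" for x
  proof (rule nil_incl_eq_zv)
    show "nil_incl x = zv"
      using that f alg_hom_zv[OF f(1)] alg_hom_simps(1)[OF nil_incl_hom[OF s(1)] that(1,1)]
        zv_in_Vn inj_onD[OF f(2), of "nil_incl x" zv] by (simp add: h_def)
  qed
  have "inj_on (nil_part s' \<circ> h) (Vn s)"
  proof (rule alg_hom_inj[OF alg_hom_comp[OF h nil_part_hom[OF s']]])
    fix x assume x: "x \<in> Vn s" "(nil_part s' \<circ> h) x = zv"
    let ?sq = "\<lambda>y. mult s d y y" and ?sq' = "\<lambda>y. mult n (A2 n s' d') y y"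
    obtain k where "(?sq ^^ k) x = zv"
      using d x(1) nilpotent_iterated_square unfolding max_nil_index_def by blast
    then have "(?sq' ^^ k) (h x) = zv"
      using alg_hom_iterated_square[OF h x(1), of k] alg_hom_zv[OF h] by simp
    \<comment> \<open>Coordinate 0 is multiplicative, so it must vanish on an element whose iterated
      squares reach zero.\<close>
    moreover have "(?sq' ^^ k) v 0 = v 0 ^ (2 ^ k)" for v
      by (induction k) (auto simp: mult_A2[OF s'] mult_2 power_add)
    ultimately have hx0: "h x 0 = 0" by (metis power_eq_0_iff zv_def)
    have "mult n (A2 n s' d') (h x) v = zv" for v
    proof -
      have "nil_part s' (h x) = zv" using x(2) by simp
      then have "mult s' d' (nil_part s' (h x)) (nil_part s' v) = zv" by simp
      then show ?thesis
        unfolding mult_A2[OF s'] hx0 by (simp add: zv_def fun_eq_iff)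
    qed
    then have "h (mult s d x y) = zv" if "y \<in> Vn s" for y
      using alg_hom_simps(3)[OF h x(1) that] by simp
    then have "mult s d x y = zv" if "y \<in> Vn s" for y using h0[of "mult s d x y"] that by simp
    then obtain w where w: "w \<in> Vn s" "x = mult s d w w"
      using max_nil_index_annihilator[OF d s(2) x(1)] by blast
    have "h x k = 0" for k
    proof (cases "0 < k \<and> k \<le> s'")
      case True
      then have "nil_part s' (h x) (k - 1) = h x k" by (cases k) (auto simp: nil_part_def)
      then show ?thesis using x(2) by (simp add: zv_def)
    next
      case False
      have "h x = mult n (A2 n s' d') (h w) (h w)" using alg_hom_simps(3)[OF h w(1,1)] w(2) by simp
      moreover have "k \<noteq> 0 \<Longrightarrow> mult s' d' (nil_part s' (h w)) (nil_part s' (h w)) (k - 1) = 0"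
        using False by (simp add: mult_def)
      ultimately show ?thesis using hx0 by (cases "k = 0") (simp_all add: mult_A2[OF s'])
    qed
    then show "x = zv" using h0[OF x(1)] by (simp add: zv_def fun_eq_iff)
  qed
  then show ?thesis using alg_hom_comp[OF h nil_part_hom[OF s']] by blast
qed

text \<open>Injections between the nilpotent summands exist in both directions, so the dimensions
  agree and an injection is bijective.\<close>

lemma A2_iso_imp_nil_iso:
  assumes s: "s < n" "2 \<le> s" "max_nil_index s d" and s': "s' < n" "2 \<le> s'" "max_nil_index s' d'"
    and iso: "alg_iso n (A2 n s d) n (A2 n s' d')"
  shows "s = s' \<and> alg_iso s d s' d'"
proof -
  have ex: "\<exists>g. alg_hom s d s' d' g \<and> inj_on g (Vn s)"
    if iso: "alg_iso n (A2 n s d) n (A2 n s' d')" and "s < n" "2 \<le> s" "max_nil_index s d" "s' < n" for s d s' d'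
  proof -
    obtain f where f: "bij_betw f (Vn n) (Vn n)" "alg_hom n (A2 n s d) n (A2 n s' d') f"
      using iso unfolding alg_iso_alt by blast
    show ?thesis
      by (rule A2_hom_inj_nil[OF that(2,3,5,4) f(2) bij_betw_imp_inj_on[OF f(1)]])
  qed
  obtain g where g: "alg_hom s d s' d' g" "inj_on g (Vn s)" using ex[OF iso s s'(1)] by blast
  obtain g' where g': "alg_hom s' d' s d g'" "inj_on g' (Vn s')"
    using ex[OF alg_iso_sym[OF iso] s' s(1)] by blast
  have "s = s'" using alg_hom_inj_bij(1)[OF g] alg_hom_inj_bij(1)[OF g'] by simp
  then show ?thesis using alg_hom_inj_bij(2)[OF g] g(1) unfolding alg_iso_alt by blast
qed

section \<open>Complete algebras\<close>

text \<open>Every subalgebra and its annihilator together span the algebra. This consequence of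
  completeness mentions no basis, so it passes along isomorphisms.\<close>

definition ann_complemented :: "nat \<Rightarrow> sconst \<Rightarrow> bool" where
  "ann_complemented n c \<longleftrightarrow> (\<forall>S. subalg n c S \<longrightarrow>
     (\<forall>v\<in>Vn n. \<exists>s\<in>S. \<exists>t\<in>Vn n. v = vadd s t \<and> (\<forall>u\<in>S. mult n c t u = zv)))"

text \<open>Expand \<open>v\<close> in a natural basis that extends one of \<open>S\<close>: the
  terms in \<open>I\<close> lie in \<open>S\<close>, and the other basis vectors annihilate those in
  \<open>I\<close>.\<close>

lemma complete_evo_ann_complemented:
  assumes "complete_evo n c"
  shows "ann_complemented n c"
  unfolding ann_complemented_def
proof (intro allI impI ballI)
  fix S v assume S: "subalg n c S" and v: "v \<in> Vn n"
  obtain b I where b: "natural_basis n c b" and I: "I \<subseteq> {..<n}" and SI: "S = vspan (b ` I)"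
    using assms S unfolding complete_evo_def by blast
  have bV: "b i \<in> Vn n" if "i < n" for i
    using b that by (simp add: natural_basis_def is_basis_def)
  obtain a where a: "v = (\<lambda>k. \<Sum>i<n. a i * b i k)"
    using b v unfolding natural_basis_def is_basis_def by blast
  let ?s = "\<lambda>k. \<Sum>i\<in>I. a i * b i k" and ?t = "\<lambda>k. \<Sum>i\<in>{..<n} - I. a i * b i k"
  have "v k = vadd ?s ?t k" for k
    unfolding a vadd_def using sum.subset_diff[OF I, of "\<lambda>i. a i * b i k"] by (simp add: add.commute)
  then have "v = vadd ?s ?t" by (simp add: fun_eq_iff)
  moreover have "?s \<in> S"
    unfolding SI using finite_subset[OF I]
    by (intro vsubspace_sum vsubspace_vspan) (auto intro: vspan_superset)
  moreover have "?t \<in> Vn n" using bV by (intro sum_in_Vn) auto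
  moreover have "mult n c ?t u = zv" if "u \<in> S" for u
  proof -
    let ?T = "{u. mult n c ?t u = zv}"
    have "mult n c ?t (b j) = zv" if j: "j \<in> I" for j
    proof -
      have "mult n c (b i) (b j) = zv" if "i \<in> {..<n} - I" for i
        using b that j I unfolding natural_basis_def by blast
      then have "a i * mult n c (b i) (b j) k = 0" if "i \<in> {..<n} - I" for i k
        using that by (simp add: zv_def)
      then show ?thesis unfolding mult_sum_left zv_def fun_eq_iff by (intro allI sum.neutral) blast
    qed
    moreover have "vsubspace ?T"
      by (simp add: vsubspace_def mult_vadd_right mult_vscale_right)
    ultimately have "vspan (b ` I) \<subseteq> ?T" by (intro vspan_minimal) auto
    then show ?thesis using that SI by blast
  qed
  ultimately show "\<exists>s\<in>S. \<exists>t\<in>Vn n. v = vadd s t \<and> (\<forall>u\<in>S. mult n c t u = zv)" by blast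
qed

lemma ann_complemented_iso:
  assumes "alg_iso n d m c" "ann_complemented m c"
  shows "ann_complemented n d"
  unfolding ann_complemented_def
proof (intro allI impI ballI)
  fix S v assume S: "subalg n d S" and v: "v \<in> Vn n"
  obtain f where f: "bij_betw f (Vn n) (Vn m)" "alg_hom n d m c f"
    using assms(1) unfolding alg_iso_alt by blast
  note h = alg_hom_simps[OF f(2)]
  have SV: "x \<in> Vn n" if "x \<in> S" for x using S that by (auto simp: subalg_def)
  have "subalg m c (f ` S)"
    unfolding subalg_def
  proof (intro conjI ballI allI)
    show "f ` S \<subseteq> Vn m" using h(1) SV by blast
    show "zv \<in> f ` S" using S alg_hom_zv[OF f(2)] by (force simp: subalg_def)
  next
    fix x y assume "x \<in> f ` S" "y \<in> f ` S"
    then obtain x' y' where x': "x' \<in> S" "x = f x'" "y' \<in> S" "y = f y'" by blast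
    then have "vadd x y = f (vadd x' y')" "mult m c x y = f (mult n d x' y')"
      "vadd x' y' \<in> S" "mult n d x' y' \<in> S"
      using h(2,3)[of x' y'] SV S by (auto simp: subalg_def)
    then show "vadd x y \<in> f ` S" "mult m c x y \<in> f ` S" by auto
  next
    fix a x assume "x \<in> f ` S"
    then obtain x' where x': "x' \<in> S" "x = f x'" by blast
    then have "vscale a x = f (vscale a x')" "vscale a x' \<in> S"
      using h(4)[of x' x'] SV S by (auto simp: subalg_def)
    then show "vscale a x \<in> f ` S" by auto
  qed
  then obtain s t where st: "s \<in> S" "t \<in> Vn m" "f v = vadd (f s) t" "\<forall>u\<in>S. mult m c t (f u) = zv"
    using assms(2) h(1)[OF v v] unfolding ann_complemented_def by blast
  have inj: "x = y" if "x \<in> Vn n" "y \<in> Vn n" "f x = f y" for x y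
    using f(1) that unfolding bij_betw_def by (meson inj_onD)
  obtain t' where t': "t' \<in> Vn n" "t = f t'" using st(2) f(1) unfolding bij_betw_def by blast
  have "f v = f (vadd s t')" using st(3) t' h(2)[of s t'] SV[OF st(1)] by simp
  then have "v = vadd s t'" using inj[OF v] SV[OF st(1)] t'(1) vadd_in_Vn by blast
  moreover have "mult n d t' u = zv" if "u \<in> S" for u
  proof -
    have "f (mult n d t' u) = f zv"
      using st(4) that t' h(3)[of t' u] SV[OF that] alg_hom_zv[OF f(2)] by simp
    then show ?thesis using inj mult_in_Vn zv_in_Vn by blast
  qed
  ultimately show "\<exists>s\<in>S. \<exists>t\<in>Vn n. v = vadd s t \<and> (\<forall>u\<in>S. mult n d t u = zv)"
    using st(1) t'(1) by blast
qed

section \<open>Square-zero elements, subalgebras and ideals\<close>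

locale split_evo =
  fixes n :: nat and A :: "nat \<Rightarrow> nat \<Rightarrow> complex"
  assumes split: "ann_complemented n (evo A)"
begin

definition Z :: "nat set" where "Z = {i. i < n \<and> (\<forall>k<n. A i k = 0)}"

text \<open>The sets of basis vectors that contain the square-zero ones and span an ideal: in graph
  terms, no edge leaves \<open>J\<close>.\<close>

definition closed_idx :: "nat set \<Rightarrow> bool" where
  "closed_idx J \<longleftrightarrow> Z \<subseteq> J \<and> J \<subseteq> {..<n} \<and> (\<forall>i\<in>J. \<forall>k<n. A i k \<noteq> 0 \<longrightarrow> k \<in> J)"

text \<open>The line of \<open>x\<close> is a subalgebra. Writing the \<open>i\<close>-th unit
  vector as a multiple of \<open>x\<close> plus an annihilator \<open>t\<close> of \<open>x\<close>
  shows that its product with \<open>x\<close> is zero; that product is \<open>x i\<close> times row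
  \<open>i\<close>, which is not zero.\<close>

lemma square_zero_imp_annihilator:
  assumes x: "x \<in> Vn n" and sq: "mult n (evo A) x x = zv" and i: "i < n" "i \<notin> Z"
  shows "x i = 0"
proof -
  have "subalg n (evo A) (range (\<lambda>a. vscale a x))"
  proof -
    have "vadd (vscale a x) (vscale b x) = vscale (a + b) x" "vscale a (vscale b x) = vscale (a * b) x" for a b
      by (simp_all add: vadd_def vscale_def algebra_simps)
    moreover have "zv \<in> range (\<lambda>a. vscale a x)" by (rule range_eqI[of _ _ 0]) simp
    ultimately show ?thesis
      using x sq by (auto simp: subalg_def mult_vscale_left mult_vscale_right)
  qed
  then have "\<exists>s\<in>range (\<lambda>a. vscale a x). \<exists>t\<in>Vn n. uv i = vadd s t \<and>
      (\<forall>u\<in>range (\<lambda>a. vscale a x). mult n (evo A) t u = zv)"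
    using split uv_in_Vn[OF i(1)] unfolding ann_complemented_def by blast
  then obtain a t where t: "uv i = vadd (vscale a x) t" "mult n (evo A) t (vscale 1 x) = zv"
    by blast
  have "mult n (evo A) x (uv i) = zv"
    unfolding t(1) mult_vadd_right mult_vscale_right using sq t(2) mult_evo_commute[of n A x t] by simp
  moreover obtain k where k: "k < n" "A i k \<noteq> 0" using i by (auto simp: Z_def)
  ultimately have "(if k < n then x i * A i k else 0) = zv k"
    using mult_evo_uv[OF i(1), of A x] by (metis (no_types, lifting))
  then show ?thesis using k by (simp add: zv_def)
qed

text \<open>Square roots of the coefficients of a dependence are the coordinates of an element of
  square zero.\<close>

lemma rows_independent:
  assumes y: "\<And>k. k < n \<Longrightarrow> (\<Sum>i<n. y i * A i k) = 0" and i: "i < n" "i \<notin> Z"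
  shows "y i = 0"
proof -
  let ?x = "\<lambda>i. if i < n then csqrt (y i) else 0"
  have "(\<Sum>i<n. ?x i * ?x i * A i k) = (\<Sum>i<n. y i * A i k)" for k
    by (intro sum.cong) (auto simp flip: power2_eq_square)
  then have "mult n (evo A) ?x ?x = zv" using y by (simp add: mult_evo zv_def fun_eq_iff)
  then have "?x i = 0" using i by (intro square_zero_imp_annihilator) (auto simp: Vn_def)
  then show ?thesis using i by simp
qed

text \<open>Write the unit vector as \<open>s + t\<close> with \<open>t\<close> annihilating
  \<open>S\<close>. By independence of the rows, \<open>t j * u j = 0\<close> for \<open>u\<close>
  in \<open>S\<close> and \<open>j\<close> outside \<open>Z\<close>. Taking \<open>u = x\<close>
  gives \<open>t i = 0\<close>; for \<open>j\<close> different from \<open>i\<close> the choice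
  \<open>u = s\<close>, where \<open>s j = - t j\<close>, gives \<open>t j = 0\<close>. So
  \<open>t\<close> is supported on \<open>Z\<close> and lies in \<open>S\<close>.\<close>

lemma subalg_coordinate:
  assumes S: "subalg n (evo A) S" and ZS: "\<And>v. (\<And>i. i \<notin> Z \<Longrightarrow> v i = 0) \<Longrightarrow> v \<in> S"
    and x: "x \<in> S" "i < n" "x i \<noteq> 0"
  shows "uv i \<in> S"
proof (cases "i \<in> Z")
  case True
  then show ?thesis by (intro ZS) (auto simp: uv_def)
next
  case False
  obtain s t where st: "s \<in> S" "t \<in> Vn n" "uv i = vadd s t" "\<forall>u\<in>S. mult n (evo A) t u = zv"
    using split S x(2) unfolding ann_complemented_def by (meson uv_in_Vn)
  have 0: "t j * u j = 0" if "u \<in> S" "j < n" "j \<notin> Z" for u j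
  proof (rule rows_independent[OF _ that(2,3)])
    fix k assume k: "k < n"
    have "mult n (evo A) t u k = zv k" using st(4) that(1) by simp
    then show "(\<Sum>i<n. t i * u i * A i k) = 0" using k by (simp add: mult_evo zv_def)
  qed
  have ti: "t i = 0" using 0[OF x(1,2) False] x(3) by simp
  have "t j = 0" if "j \<notin> Z" for j
  proof (cases "j < n \<and> j \<noteq> i")
    case True
    have "uv i j = s j + t j" unfolding st(3) by (simp add: vadd_def)
    then have "s j = - t j" using True by (simp add: uv_def add_eq_0_iff)
    then show ?thesis using 0[OF st(1) _ that] True by simp
  next
    case False
    then show ?thesis using ti st(2) by (auto simp: Vn_def)
  qed
  then have "t \<in> S" by (rule ZS)
  then show ?thesis using st S by (simp add: subalg_def)
qed

text \<open>Since \<open>x\<close> is an eigenvector modulo \<open>J\<close>, its multiples plus the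
  vectors supported on \<open>J\<close> form a subalgebra. By \<open>subalg_coordinate\<close> it
  contains the unit vector \<open>i\<close>, which modulo \<open>J\<close> is then a nonzero
  multiple of \<open>x\<close>.\<close>

lemma unique_support:
  assumes J: "closed_idx J" and x: "x \<in> Vn n"
    and sq: "\<And>k. k < n \<Longrightarrow> k \<notin> J \<Longrightarrow> (\<Sum>i<n. (x i)\<^sup>2 * A i k) = \<mu> * x k"
    and i: "i < n" "i \<notin> J" "x i \<noteq> 0" and j: "j < n" "j \<notin> J" "x j \<noteq> 0"
  shows "i = j"
proof -
  let ?S = "{v \<in> Vn n. \<exists>a. \<forall>k. k \<notin> J \<longrightarrow> v k = a * x k}"
  have AJ: "A i k = 0" if "i \<in> J" "k < n" "k \<notin> J" for i k
    using J that by (auto simp: closed_idx_def)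
  have "subalg n (evo A) ?S"
    unfolding subalg_def
  proof (intro conjI ballI allI)
    show "zv \<in> ?S" by (simp add: zv_def Vn_def exI[of _ 0])
  next
    fix v w assume "v \<in> ?S" "w \<in> ?S"
    then obtain a b where v: "v \<in> Vn n" "\<And>k. k \<notin> J \<Longrightarrow> v k = a * x k"
      and w: "w \<in> Vn n" "\<And>k. k \<notin> J \<Longrightarrow> w k = b * x k" by auto
    have "\<forall>k. k \<notin> J \<longrightarrow> vadd v w k = (a + b) * x k"
      using v(2) w(2) by (simp add: vadd_def distrib_right)
    then show "vadd v w \<in> ?S" using v(1) w(1) by (intro CollectI conjI exI[of _ "a + b"]) auto
    have "mult n (evo A) v w k = (a * b * \<mu>) * x k" if k: "k \<notin> J" for k
    proof (cases "k < n")
      case True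
      have "(\<Sum>i<n. v i * w i * A i k) = (\<Sum>i<n. a * b * ((x i)\<^sup>2 * A i k))"
      proof (intro sum.cong refl)
        fix i
        show "v i * w i * A i k = a * b * ((x i)\<^sup>2 * A i k)"
          using v(2)[of i] w(2)[of i] AJ[OF _ True k]
          by (cases "i \<in> J") (auto simp: power2_eq_square mult_ac)
      qed
      also have "\<dots> = a * b * (\<mu> * x k)" using sq[OF True k] by (simp flip: sum_distrib_left)
      finally show ?thesis using True by (simp add: mult_evo mult.assoc)
    next
      case False
      then show ?thesis using x by (simp add: mult_evo Vn_def)
    qed
    then show "mult n (evo A) v w \<in> ?S"
      by (intro CollectI conjI exI[of _ "a * b * \<mu>"]) auto
  next
    fix a v assume "v \<in> ?S"
    then obtain b where v: "v \<in> Vn n" "\<And>k. k \<notin> J \<Longrightarrow> v k = b * x k" by auto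
    then have "\<forall>k. k \<notin> J \<longrightarrow> vscale a v k = (a * b) * x k" by (simp add: vscale_def)
    then show "vscale a v \<in> ?S" using v(1) by (intro CollectI conjI exI[of _ "a * b"]) auto
  qed auto
  moreover have "v \<in> ?S" if v: "\<And>i. i \<notin> Z \<Longrightarrow> v i = 0" for v
  proof -
    have "Z \<subseteq> J" "Z \<subseteq> {..<n}" using J by (auto simp: closed_idx_def)
    then have "v k = 0" if "k \<notin> J \<or> n \<le> k" for k
      using v[of k] that by (cases "k \<in> Z") auto
    then show ?thesis by (auto simp: Vn_def intro!: exI[of _ 0])
  qed
  moreover have "x \<in> ?S" using x by (auto intro!: exI[of _ 1])
  ultimately have "uv i \<in> ?S" using i by (intro subalg_coordinate[of ?S x]) auto
  then obtain a where a: "\<And>k. k \<notin> J \<Longrightarrow> uv i k = a * x k" by blast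
  have "a \<noteq> 0" using a[OF i(2)] by (auto simp: uv_def)
  then have "uv i j \<noteq> 0" using a[OF j(2)] j(3) by simp
  then show ?thesis by (auto simp: uv_def split: if_splits)
qed

text \<open>An eigenvector of the quotient by \<open>J\<close> is supported on a single index
  \<open>i\<close>, and the eigenvector equation says that edges from \<open>i\<close> lead only to
  \<open>i\<close> or into \<open>J\<close>.\<close>

lemma closed_idx_extend:
  assumes J: "closed_idx J" "J \<noteq> {..<n}"
  shows "\<exists>i<n. i \<notin> J \<and> closed_idx (insert i J)"
proof -
  let ?M = "{..<n} - J"
  have JM: "J \<subseteq> {..<n}" "?M \<noteq> {}" using J by (auto simp: closed_idx_def)
  obtain x0 \<mu> where x0: "\<exists>i\<in>?M. x0 i \<noteq> 0" "\<forall>k\<in>?M. (\<Sum>i\<in>?M. (x0 i)\<^sup>2 * A i k) = \<mu> * x0 k"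
    using quadratic_eigenvector[of ?M A] JM(2) by auto
  define x where "x i = (if i \<in> ?M then x0 i else 0)" for i
  have sq: "(\<Sum>i<n. (x i)\<^sup>2 * A i k) = \<mu> * x k" if "k < n" "k \<notin> J" for k
  proof -
    have "(\<Sum>i<n. (x i)\<^sup>2 * A i k) = (\<Sum>i\<in>?M. (x0 i)\<^sup>2 * A i k)"
      by (intro sum.mono_neutral_cong_right) (auto simp: x_def)
    then show ?thesis using x0(2) that by (simp add: x_def)
  qed
  obtain i where i: "i < n" "i \<notin> J" "x i \<noteq> 0" using x0(1) by (auto simp: x_def)
  have xV: "x \<in> Vn n" by (auto simp: Vn_def x_def)
  have uniq: "x j = 0" if "j \<noteq> i" for j
    using unique_support[OF J(1) xV sq i, of j] that by (auto simp: x_def)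
  have "k = i \<or> k \<in> J" if "k < n" "A i k \<noteq> 0" for k
  proof (rule ccontr)
    assume k: "\<not> ?thesis"
    have "(\<Sum>j<n. (x j)\<^sup>2 * A j k) = (\<Sum>j<n. if j = i then (x i)\<^sup>2 * A i k else 0)"
      using uniq by (intro sum.cong) auto
    then have "(x i)\<^sup>2 * A i k = \<mu> * x k" using sq[of k] that k i(1) by simp
    then show False using k uniq that i(3) by simp
  qed
  then show ?thesis using J(1) i by (intro exI[of _ i]) (auto simp: closed_idx_def)
qed

section \<open>Chains of ideals and the loop\<close>

text \<open>A loop-free flag of ideals above the span of \<open>Z\<close>: each listed vector
  squares to zero modulo the ideal of its predecessors.\<close>

definition chain :: "nat list \<Rightarrow> bool" where
  "chain fs \<longleftrightarrow> distinct fs \<and> set fs \<subseteq> {..<n} - Z \<and>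
     (\<forall>p<length fs. \<forall>k<n. A (fs ! p) k \<noteq> 0 \<longrightarrow> k \<in> Z \<union> set (take p fs))"

lemma chain_nth:
  assumes "chain fs" "p < length fs"
  shows "fs ! p < n" "fs ! p \<notin> Z" "l \<le> p \<Longrightarrow> fs ! p \<notin> set (take l fs)"
proof -
  have "fs ! p \<in> set fs" using assms(2) by simp
  then have "fs ! p \<in> {..<n} - Z" using assms(1) unfolding chain_def by blast
  then show "fs ! p < n" "fs ! p \<notin> Z" by auto
  show "fs ! p \<notin> set (take l fs)" if "l \<le> p"
    using assms that by (auto simp: chain_def in_set_conv_nth nth_eq_iff_index_eq)
qed

lemma chain_closed:
  assumes "chain fs"
  shows "closed_idx (Z \<union> set (take p fs))"
  unfolding closed_idx_def
proof (intro conjI ballI allI impI)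
  show "Z \<union> set (take p fs) \<subseteq> {..<n}"
    using assms set_take_subset[of p fs] by (auto simp: chain_def Z_def)
  fix i k assume i: "i \<in> Z \<union> set (take p fs)" and k: "k < n" "A i k \<noteq> 0"
  then have "i \<in> set (take p fs)" by (auto simp: Z_def)
  then obtain j where j: "j < p" "j < length fs" "i = fs ! j" by (auto simp: in_set_conv_nth)
  then have "k \<in> Z \<union> set (take j fs)" using assms k by (auto simp: chain_def)
  then show "k \<in> Z \<union> set (take p fs)" using set_take_subset_set_take[of j p fs] j(1) by auto
qed auto

lemma chain_append:
  assumes "chain fs" "i < n" "i \<notin> Z \<union> set fs" "\<And>k. k < n \<Longrightarrow> A i k \<noteq> 0 \<Longrightarrow> k \<in> Z \<union> set fs"
  shows "chain (fs @ [i])"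
  using assms by (auto simp: chain_def nth_append less_Suc_eq)

lemma maximal_chain: "\<exists>fs. chain fs \<and> (\<forall>i. \<not> chain (fs @ [i]))"
proof -
  have "length fs < Suc n" if "chain fs" for fs
  proof -
    have "length fs = card (set fs)" using that by (simp add: chain_def distinct_card)
    also have "\<dots> \<le> card {..<n}" using that by (intro card_mono) (auto simp: chain_def)
    finally show ?thesis by simp
  qed
  moreover have "chain []" by (simp add: chain_def)
  ultimately obtain fs where fs: "chain fs" "\<And>gs. chain gs \<Longrightarrow> length gs \<le> length fs"
    using ex_has_greatest_nat[of chain "[]" length "Suc n"] by blast
  then have "\<not> chain (fs @ [i])" for i using fs(2)[of "fs @ [i]"] by auto
  then show ?thesis using fs(1) by blast
qed

lemma full_chain_nilpotent:
  assumes fs: "chain fs" "Z \<union> set fs = {..<n}"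
  shows "nilpotent n (evo A)"
proof -
  let ?q = "length fs"
  \<comment> \<open>Position 0 is kept for all of \<open>Z\<close>; the weights halve with each
    further position along the chain.\<close>
  define pos where "pos i = (if i \<in> Z then 0 else Suc (THE p. p < ?q \<and> fs ! p = i))" for i
  have d: "distinct fs" and dZ: "set fs \<inter> Z = {}" using fs(1) by (auto simp: chain_def)
  have pos: "pos (fs ! p) = Suc p" if "p < ?q" for p
  proof -
    have "(THE p'. p' < ?q \<and> fs ! p' = fs ! p) = p"
      using d that by (intro the_equality) (auto simp: nth_eq_iff_index_eq)
    moreover have "fs ! p \<notin> Z" using dZ that nth_mem by blast
    ultimately show ?thesis by (simp add: pos_def)
  qed
  have posle: "pos i \<le> ?q" if "i < n" for i
  proof (cases "i \<in> Z")
    case False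
    then have "i \<in> set fs" using fs(2) that by blast
    then obtain p where "p < ?q" "i = fs ! p" by (auto simp: in_set_conv_nth)
    then show ?thesis using pos by simp
  qed (simp add: pos_def)
  let ?W = "\<lambda>i. 2 ^ (?q - pos i) :: nat"
  have "apow n (evo A) (2 ^ ?q + 1) = {zv}"
  proof (rule apow_evo_weight_trivial[where W = ?W])
    fix i k assume ik: "i < n" "k < n" "A i k \<noteq> 0"
    then have "i \<notin> Z" by (auto simp: Z_def)
    then have "i \<in> set fs" using fs(2) ik by blast
    then obtain p where p: "p < ?q" "i = fs ! p" by (auto simp: in_set_conv_nth)
    then have "k \<in> Z \<union> set (take p fs)" using fs(1) ik by (auto simp: chain_def)
    then have "pos k < pos i"
    proof
      assume "k \<in> set (take p fs)"
      then obtain l where "l < p" "l < ?q" "k = fs ! l" by (auto simp: in_set_conv_nth)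
      then show ?thesis using pos p by simp
    qed (use pos p in \<open>simp add: pos_def\<close>)
    then have "Suc (?q - pos i) \<le> ?q - pos k" using posle[OF ik(1)] by linarith
    then have "(2::nat) ^ Suc (?q - pos i) \<le> ?W k" by (intro power_increasing) auto
    then show "2 * ?W i \<le> ?W k" by simp
  next
    fix i
    have "?W i \<le> 2 ^ ?q" by (intro power_increasing) auto
    then show "?W i < 2 ^ ?q + 1" by linarith
  qed simp_all
  then show ?thesis unfolding nilpotent_def by (intro exI[of _ "2 ^ ?q + 1"]) simp
qed

lemma two_point_square:
  assumes "i < n" "j < n" "i \<noteq> j"
  shows "(\<Sum>l<n. ((\<lambda>l. if l = i then a else if l = j then b else 0) l)\<^sup>2 * A l k) =
    a\<^sup>2 * A i k + b\<^sup>2 * A j k"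
proof -
  have "(\<Sum>l<n. ((\<lambda>l. if l = i then a else if l = j then b else 0) l)\<^sup>2 * A l k) =
      (\<Sum>l<n. (if l = i then a\<^sup>2 * A i k else 0) + (if l = j then b\<^sup>2 * A j k else 0))"
    using assms(3) by (intro sum.cong) auto
  then show ?thesis using assms by (simp add: sum.distrib)
qed

lemma no_two_point:
  assumes J: "closed_idx J" and ij: "i < n" "j < n" "i \<noteq> j" "i \<notin> J" "j \<notin> J" "a \<noteq> 0" "b \<noteq> 0"
    and eq: "\<And>k. k < n \<Longrightarrow> k \<notin> J \<Longrightarrow>
      a\<^sup>2 * A i k + b\<^sup>2 * A j k = \<mu> * (if k = i then a else if k = j then b else 0)"
  shows False
proof -
  let ?x = "\<lambda>l. if l = i then a else if l = j then b else 0"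
  have "i = j"
  proof (rule unique_support[OF J, of ?x \<mu>])
    show "?x \<in> Vn n" using ij by (auto simp: Vn_def)
    show "(\<Sum>l<n. (?x l)\<^sup>2 * A l k) = \<mu> * ?x k" if "k < n" "k \<notin> J" for k
      using two_point_square[OF ij(1-3), of a b k] eq[OF that] by simp
  qed (use ij in auto)
  then show False using ij(3) by simp
qed

text \<open>If the entry vanished, both vectors would square to zero modulo the ideal of the vectors
  before them, and their sum would be an eigenvector for 0 with two support points.\<close>

lemma chain_subdiag:
  assumes fs: "chain fs" and p: "Suc p < length fs"
  shows "A (fs ! Suc p) (fs ! p) \<noteq> 0"
proof
  assume 0: "A (fs ! Suc p) (fs ! p) = 0"
  have d: "distinct fs" using fs by (simp add: chain_def)
  have r: "k \<in> Z \<union> set (take l fs)" if "l < length fs" "k < n" "A (fs ! l) k \<noteq> 0" for l k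
    using fs that by (auto simp: chain_def)
  show False
  proof (rule no_two_point[OF chain_closed[OF fs, of p], of "fs ! Suc p" "fs ! p" 1 1 0])
    show "fs ! Suc p \<noteq> fs ! p" using d p by (simp add: nth_eq_iff_index_eq)
    fix k assume k: "k < n" "k \<notin> Z \<union> set (take p fs)"
    have "A (fs ! p) k = 0" using r[of p k] p k by auto
    moreover have "A (fs ! Suc p) k = 0"
      using r[of "Suc p" k] p k 0 by (auto simp: take_Suc_conv_app_nth)
    ultimately show "1\<^sup>2 * A (fs ! Suc p) k + 1\<^sup>2 * A (fs ! p) k =
      0 * (if k = fs ! Suc p then 1 else if k = fs ! p then 1 else 0)" by simp
  qed (use chain_nth(1,2)[OF fs Suc_lessD[OF p]] chain_nth(3)[OF fs Suc_lessD[OF p], of p]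
      chain_nth(1,2)[OF fs p] chain_nth(3)[OF fs p, of p] in auto)
qed

text \<open>A maximal chain leaves an index over, since a full one would make the algebra nilpotent.
  The next index \<open>i\<close> has a loop by maximality. A further index \<open>k\<close> would
  either give an eigenvector supported on both \<open>k\<close> and \<open>i\<close>, or extend the
  chain while bypassing \<open>i\<close>.\<close>

lemma chain_and_loop:
  assumes "\<not> nilpotent n (evo A)"
  shows "\<exists>fs i. chain fs \<and> i < n \<and> i \<notin> Z \<union> set fs \<and> insert i (Z \<union> set fs) = {..<n} \<and> A i i \<noteq> 0"
proof -
  obtain fs where fs: "chain fs" "\<And>i. \<not> chain (fs @ [i])" using maximal_chain by blast
  let ?J = "Z \<union> set fs"
  have J: "closed_idx ?J" using chain_closed[OF fs(1), of "length fs"] by simp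
  have "?J \<noteq> {..<n}" using full_chain_nilpotent[OF fs(1)] assms by blast
  then obtain i where i: "i < n" "i \<notin> ?J" "closed_idx (insert i ?J)"
    using closed_idx_extend[OF J] by blast
  have loop: "A i i \<noteq> 0"
  proof
    assume "A i i = 0"
    then have "k \<in> ?J" if "k < n" "A i k \<noteq> 0" for k
      using i(3) that by (auto simp: closed_idx_def)
    then show False using chain_append[OF fs(1) i(1,2)] fs(2) by blast
  qed
  have "insert i ?J = {..<n}"
  proof (rule ccontr)
    assume "insert i ?J \<noteq> {..<n}"
    then obtain k where k: "k < n" "k \<notin> insert i ?J" "closed_idx (insert k (insert i ?J))"
      using closed_idx_extend[OF i(3)] by blast
    have Ai: "A i l = 0" if "l < n" "l \<notin> ?J" "l \<noteq> i" for l
      using i(3) that by (auto simp: closed_idx_def)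
    have Ak: "A k l = 0" if "l < n" "l \<notin> ?J" "l \<noteq> i" "l \<noteq> k" for l
      using k(3) that by (auto simp: closed_idx_def)
    \<comment> \<open>The equation for \<open>t\<close> makes the unit vector \<open>k\<close> plus
      \<open>t\<close> times the unit vector \<open>i\<close> an eigenvector modulo
      \<open>?J\<close> with eigenvalue \<open>A k k\<close>.\<close>
    have False if t: "t \<noteq> 0" "A k i + t\<^sup>2 * A i i = A k k * t" for t
    proof (rule no_two_point[OF J, of k i 1 t "A k k"])
      fix l assume l: "l < n" "l \<notin> ?J"
      show "1\<^sup>2 * A k l + t\<^sup>2 * A i l = A k k * (if l = k then 1 else if l = i then t else 0)"
        using Ai[OF l] Ak[OF l] t(2) k(2) by auto
    qed (use k i t in auto)
    \<comment> \<open>If \<open>A k i\<close> is zero, the quadratic has the nonzero root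
      \<open>A k k / A i i\<close>; otherwise its constant term excludes the root 0.\<close>
    moreover have "\<exists>t. t \<noteq> 0 \<and> A k i + t\<^sup>2 * A i i = A k k * t" if "A k k \<noteq> 0 \<or> A k i \<noteq> 0"
    proof (cases "A k i = 0")
      case True
      then show ?thesis using that loop
        by (intro exI[of _ "A k k / A i i"]) (simp add: power2_eq_square field_simps)
    next
      case False
      let ?p = "[:A k i, - A k k, A i i:]"
      have "\<not> constant (poly ?p)" using loop by (simp add: constant_degree)
      then obtain t where "poly ?p t = 0" using fundamental_theorem_of_algebra by blast
      then have "A k i + t * (t * A i i - A k k) = 0" by simp
      moreover from this have "t \<noteq> 0" using False by auto
      ultimately show ?thesis by (intro exI[of _ t]) (simp add: power2_eq_square algebra_simps)
    qed
    ultimately have "A k k = 0" "A k i = 0" by blast+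
    then have "l \<in> ?J" if "l < n" "A k l \<noteq> 0" for l using Ak that by blast
    then show False using chain_append[OF fs(1) k(1)] k(2) fs(2) by blast
  qed
  then show ?thesis using fs(1) i loop by blast
qed

section \<open>Splitting off an idempotent\<close>

text \<open>Solves \<open>w = y + w * w\<close> from the top of the chain downwards. No square of a
  vector supported on the prefix reaches the last index of that prefix, so \<open>w\<close> agrees
  with \<open>y\<close> there; the square of this coordinate is moved into the given part
  \<open>y'\<close> and the shorter chain is solved.\<close>

lemma chain_solve:
  assumes fs: "chain fs" and y: "\<And>k. k \<notin> Z \<union> set (take p fs) \<Longrightarrow> y k = 0" and p: "p \<le> length fs"
  shows "\<exists>w. (\<forall>k. k \<notin> Z \<union> set (take p fs) \<longrightarrow> w k = 0) \<and> (\<forall>k<n. w k = y k + (\<Sum>i<n. (w i)\<^sup>2 * A i k))"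
  using y p
proof (induction p arbitrary: y)
  case 0
  have "(y i)\<^sup>2 * A i k = 0" if "i < n" "k < n" for i k
    using 0(1)[of i] that by (cases "i \<in> Z") (auto simp: Z_def)
  then have "(\<Sum>i<n. (y i)\<^sup>2 * A i k) = 0" if "k < n" for k
    using that by (intro sum.neutral) auto
  then show ?case using 0(1) by (intro exI[of _ y]) auto
next
  case (Suc p)
  let ?f = "fs ! p" and ?J = "Z \<union> set (take p fs)"
  have p: "p < length fs" using Suc.prems by simp
  have tk: "set (take (Suc p) fs) = insert ?f (set (take p fs))" using p by (simp add: take_Suc_conv_app_nth)
  have fJ: "?f \<notin> ?J" "?f < n"
    using chain_nth(1,2)[OF fs p] chain_nth(3)[OF fs p, of p] by auto
  have Af: "A ?f k = 0" if "k < n" "k \<notin> ?J" for k using fs p that by (auto simp: chain_def)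
  define y' where "y' k = (if k \<in> ?J then y k + (y ?f)\<^sup>2 * A ?f k else 0)" for k
  obtain w where w: "\<And>k. k \<notin> ?J \<Longrightarrow> w k = 0"
    "\<And>k. k < n \<Longrightarrow> w k = y' k + (\<Sum>i<n. (w i)\<^sup>2 * A i k)"
    using Suc.IH[of y'] p by (auto simp: y'_def)
  define w' where "w' = w(?f := y ?f)"
  have sq: "(\<Sum>i<n. (w' i)\<^sup>2 * A i k) = (y ?f)\<^sup>2 * A ?f k + (\<Sum>i<n. (w i)\<^sup>2 * A i k)" for k
  proof -
    have "(\<Sum>i<n. (w' i)\<^sup>2 * A i k) =
        (\<Sum>i<n. (if i = ?f then (y ?f)\<^sup>2 * A ?f k else 0) + (w i)\<^sup>2 * A i k)"
      using w(1)[OF fJ(1)] by (intro sum.cong) (auto simp: w'_def)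
    then show ?thesis using fJ(2) by (simp add: sum.distrib)
  qed
  have "w' k = y k + (\<Sum>i<n. (w' i)\<^sup>2 * A i k)" if k: "k < n" for k
  proof -
    have s: "(\<Sum>i<n. (w i)\<^sup>2 * A i k) = w k - y' k" using w(2)[OF k] by simp
    show ?thesis
    proof (cases "k \<in> ?J")
      case True
      then have "k \<noteq> ?f" using fJ(1) by blast
      then show ?thesis unfolding sq s using True by (simp add: w'_def y'_def)
    next
      case False
      then show ?thesis unfolding sq s using Af[OF k False] w(1)[OF False] Suc.prems(1)[of k]
        by (auto simp: w'_def y'_def tk)
    qed
  qed
  moreover have "w' k = 0" if "k \<notin> Z \<union> set (take (Suc p) fs)" for k
    using that w(1)[of k] by (auto simp: w'_def tk)
  ultimately show ?case by blast
qed

text \<open>The coordinate \<open>c = 1 / A i i\<close> solves the equation at the loop, since no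
  other square reaches \<open>i\<close>; the remaining coordinates are found by
  \<open>chain_solve\<close>.\<close>

lemma idempotent_exists:
  assumes fs: "chain fs" and i: "i < n" "i \<notin> Z \<union> set fs" "insert i (Z \<union> set fs) = {..<n}" "A i i \<noteq> 0"
  shows "\<exists>u. u \<in> Vn n \<and> mult n (evo A) u u = u \<and> u i \<noteq> 0 \<and> (\<forall>k. k \<noteq> i \<longrightarrow> k \<notin> Z \<longrightarrow> u k = 0)"
proof -
  let ?J = "Z \<union> set fs"
  have Jn: "?J \<subseteq> {..<n}" using i(3) by blast
  define c where "c = 1 / A i i"
  obtain w where w: "\<And>k. k \<notin> ?J \<Longrightarrow> w k = 0"
    "\<And>k. k < n \<Longrightarrow> w k = (if k \<in> ?J then c\<^sup>2 * A i k else 0) + (\<Sum>j<n. (w j)\<^sup>2 * A j k)"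
    using chain_solve[OF fs, of "length fs" "\<lambda>k. if k \<in> ?J then c\<^sup>2 * A i k else 0"] by auto
  define u where "u = w(i := c)"
  have sq: "(\<Sum>j<n. (u j)\<^sup>2 * A j k) = u k" if k: "k < n" for k
  proof -
    have "(\<Sum>j<n. (u j)\<^sup>2 * A j k) = (\<Sum>j<n. (if j = i then c\<^sup>2 * A i k else 0) + (w j)\<^sup>2 * A j k)"
      using w(1)[OF i(2)] by (intro sum.cong) (auto simp: u_def)
    then have *: "(\<Sum>j<n. (u j)\<^sup>2 * A j k) = c\<^sup>2 * A i k + (\<Sum>j<n. (w j)\<^sup>2 * A j k)"
      using i(1) by (simp add: sum.distrib)
    show ?thesis
    proof (cases "k = i")
      case True
      then have "(\<Sum>j<n. (w j)\<^sup>2 * A j k) = 0" using w(2)[OF k] w(1)[OF i(2)] i(2) by auto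
      then show ?thesis unfolding * using True i(4) by (simp add: u_def c_def power2_eq_square)
    next
      case False
      then have "k \<in> ?J" using i(3) k by auto
      then show ?thesis unfolding * using False w(2)[OF k] by (simp add: u_def)
    qed
  qed
  have "u k = 0" if "n \<le> k" for k
  proof -
    have "k \<notin> ?J" "k \<noteq> i" using Jn i(1) that by auto
    then show ?thesis using w(1) by (simp add: u_def)
  qed
  then have uV: "u \<in> Vn n" by (simp add: Vn_def)
  have ui: "u i \<noteq> 0" using i(4) by (simp add: u_def c_def)
  \<comment> \<open>An idempotent is an eigenvector for 1 modulo the span of \<open>Z\<close>, so
    \<open>unique_support\<close> removes all its chain coordinates.\<close>
  have Zc: "closed_idx Z" using chain_closed[OF fs, of 0] by simp
  have "u k = 0" if k: "k \<noteq> i" "k \<notin> Z" for k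
  proof (rule ccontr)
    assume "u k \<noteq> 0"
    moreover from this have "k < n" using uV by (auto simp: Vn_def not_less[symmetric])
    ultimately have "i = k"
      using unique_support[OF Zc uV, of 1 i k] sq i ui k by auto
    then show False using k by simp
  qed
  moreover have "mult n (evo A) u u = u"
    using sq uV by (auto simp: mult_evo Vn_def fun_eq_iff power2_eq_square)
  ultimately show ?thesis using uV ui by blast
qed

end

section \<open>Bases adapted to the normal forms\<close>

lemma alg_iso_evo_of_basis:
  assumes "\<And>i. i < n \<Longrightarrow> b i \<in> Vn n"
    and "\<And>a. (\<And>k. k < n \<Longrightarrow> (\<Sum>i<n. a i * b i k) = 0) \<Longrightarrow> \<forall>i<n. a i = 0"
    and "\<And>i j. i < n \<Longrightarrow> j < n \<Longrightarrow> i \<noteq> j \<Longrightarrow> mult n c (b i) (b j) = zv"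
    and "\<And>i. i < n \<Longrightarrow> mult n c (b i) (b i) = (\<lambda>k. \<Sum>l<n. D i l * b l k)"
  shows "alg_iso n (evo D) n c"
proof (rule alg_iso_of_basis[OF assms(1,2)])
  show "mult n c (b i) (b j) = (\<lambda>k. \<Sum>l<n. evo D i j l * b l k)" if "i < n" "j < n" for i j
    using assms(3)[OF that] assms(4)[OF that(1)] by (cases "i = j") (auto simp: evo_def zv_def)
qed

lemma A2_evo:
  "A2 n s (evo D) = evo (\<lambda>i k. if i = 0 then (if k = 0 then 1 else 0)
     else if 0 < k \<and> i \<le> s \<and> k \<le> s then D (i - 1) (k - 1) else 0)"
  by (intro ext) (auto simp: A2_eq evo_def)

context split_evo
begin

lemma mult_disjoint:
  assumes "\<And>l. l < n \<Longrightarrow> l \<notin> Z \<Longrightarrow> x l = 0 \<or> y l = 0"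
  shows "mult n (evo A) x y = zv"
proof -
  have "x l * y l * A l k = 0" if "l < n" "k < n" for l k
    using assms[OF that(1)] that by (cases "l \<in> Z") (auto simp: Z_def)
  then show ?thesis unfolding mult_evo zv_def fun_eq_iff by (auto intro: sum.neutral)
qed

lemma mult_single:
  assumes "j < n" "\<And>l. l < n \<Longrightarrow> l \<noteq> j \<Longrightarrow> l \<notin> Z \<Longrightarrow> x l = 0"
  shows "mult n (evo A) x x = (\<lambda>k. if k < n then (x j)\<^sup>2 * A j k else 0)"
proof -
  have "(\<Sum>l<n. x l * x l * A l k) = x j * x j * A j k" if "k < n" for k
  proof (rule sum_single[OF assms(1)])
    show "x l * x l * A l k = 0" if "l < n" "l \<noteq> j" for l
      using assms(2)[OF that] \<open>l < n\<close> \<open>k < n\<close> by (cases "l \<in> Z") (auto simp: Z_def)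
  qed
  then show ?thesis by (auto simp: mult_evo power2_eq_square)
qed

text \<open>The idempotent together with the unit vectors of \<open>Z\<close> is the adapted
  basis.\<close>

lemma iso_A1:
  assumes i: "i < n" "i \<notin> Z" "insert i Z = {..<n}"
    and u: "u \<in> Vn n" "mult n (evo A) u u = u" "u i \<noteq> 0"
  shows "alg_iso n (A1 n) n (evo A)"
proof -
  define zs where "zs = sorted_list_of_set Z"
  have fin: "finite Z" by (simp add: Z_def)
  have zs: "distinct zs" "set zs = Z" using fin by (auto simp: zs_def)
  have "card (insert i Z) = n" unfolding i(3) by simp
  then have n: "n = Suc (length zs)" using distinct_card[OF zs(1)] zs(2) i(2) fin by simp
  have zZ: "zs ! j \<in> Z" "zs ! j < n" "zs ! j \<noteq> i" if "j < length zs" for j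
  proof -
    show "zs ! j \<in> Z" using that zs(2) nth_mem by blast
    then show "zs ! j < n" "zs ! j \<noteq> i" using i(2) by (auto simp: Z_def)
  qed
  define b where "b l = (if l = 0 then u else uv (zs ! (l - 1)))" for l
  have idx: "l = 0 \<or> (\<exists>j<length zs. l = Suc j)" if "l < n" for l
    using that n by (cases l) auto
  have "alg_iso n (evo (\<lambda>i k. if i = 0 \<and> k = 0 then 1 else 0)) n (evo A)"
  proof (rule alg_iso_evo_of_basis[where b = b])
    show "b l \<in> Vn n" if "l < n" for l
      using idx[OF that] u(1) zZ by (auto simp: b_def)
    have bZ: "b (Suc j) l = 0" if "j < length zs" "l \<notin> Z" for j l
      using zZ[OF that(1)] that(2) by (auto simp: b_def uv_def)
    show "mult n (evo A) (b l) (b m) = zv" if "l < n" "m < n" "l \<noteq> m" for l m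
      using idx[OF that(1)] idx[OF that(2)] that(3) bZ by (intro mult_disjoint) auto
    show "mult n (evo A) (b l) (b l) = (\<lambda>k. \<Sum>m<n. (if l = 0 \<and> m = 0 then 1 else 0) * b m k)"
      if "l < n" for l
    proof (cases "l = 0")
      case True
      then have "(\<Sum>m<n. (if l = 0 \<and> m = 0 then 1 else 0) * b m k) = u k" for k
        using n by (subst sum_single[of 0]) (auto simp: b_def)
      then show ?thesis using True u(2) by (simp add: b_def)
    next
      case False
      then have "mult n (evo A) (b l) (b l) = zv"
        using idx[OF that] bZ by (intro mult_disjoint) auto
      then show ?thesis using False by (simp add: zv_def)
    qed
    show "\<forall>l<n. a l = 0" if a: "\<And>k. k < n \<Longrightarrow> (\<Sum>l<n. a l * b l k) = 0" for a
    proof -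
      have "(\<Sum>l<n. a l * b l i) = a 0 * b 0 i"
      proof (rule sum_single)
        fix l assume l: "l < n" "l \<noteq> 0"
        then obtain j where "j < length zs" "l = Suc j" using idx[OF l(1)] by blast
        then show "a l * b l i = 0" using bZ[of j i] i(2) by simp
      qed (use n in simp)
      then have a0: "a 0 = 0" using a[OF i(1)] u(3) by (simp add: b_def)
      have "a (Suc j) = 0" if j: "j < length zs" for j
      proof -
        have "(\<Sum>l<n. a l * b l (zs ! j)) = a (Suc j) * b (Suc j) (zs ! j)"
        proof (rule sum_single)
          fix l assume l: "l < n" "l \<noteq> Suc j"
          show "a l * b l (zs ! j) = 0"
            using idx[OF l(1)] a0 l(2) j zs(1) by (auto simp: b_def uv_def nth_eq_iff_index_eq)
        qed (use n j in simp)
        then show ?thesis using a[OF zZ(2)[OF j]] by (simp add: b_def uv_def)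
      qed
      then show ?thesis using a0 idx by blast
    qed
  qed
  then show ?thesis using A1_eq_evo[of n] i(1) by simp
qed

text \<open>The adapted basis is the idempotent \<open>u\<close>, the square \<open>z\<close> of the
  first chain vector, the corrected chain vectors, and all but one of the unit vectors of
  \<open>Z\<close>. The nilpotent summand has dimension one more than the length of the chain
  because \<open>z\<close> belongs to it.\<close>

lemma iso_A2:
  assumes fs: "chain fs" "fs \<noteq> []"
    and i: "i < n" "i \<notin> Z \<union> set fs" "insert i (Z \<union> set fs) = {..<n}"
    and u: "u \<in> Vn n" "mult n (evo A) u u = u" "u i \<noteq> 0" "\<forall>k. k \<noteq> i \<longrightarrow> k \<notin> Z \<longrightarrow> u k = 0"
  shows "\<exists>D. Suc (length fs) < n \<and> strict_lower (Suc (length fs)) D \<and> subdiag_nonzero (Suc (length fs)) D \<and>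
    alg_iso n (A2 n (Suc (length fs)) (evo D)) n (evo A)"
proof -
  define q where "q = length fs"
  have q: "0 < q" using fs(2) by (simp add: q_def)
  have d: "distinct fs" using fs(1) by (simp add: chain_def)
  have fin: "finite Z" by (simp add: Z_def)
  have fn: "fs ! p < n" "fs ! p \<notin> Z" "fs ! p \<noteq> i" if "p < q" for p
    using chain_nth(1,2)[OF fs(1)] that i(2) nth_mem[of p fs] unfolding q_def by auto
  have finj: "fs ! p = fs ! p' \<longleftrightarrow> p = p'" if "p < q" "p' < q" for p p'
    using d that by (simp add: q_def nth_eq_iff_index_eq)
  have row: "A (fs ! p) k = 0" if p: "p < q" and k: "k < n" "k \<notin> Z" "\<And>j. j < p \<Longrightarrow> k \<noteq> fs ! j" for p k
  proof (rule ccontr)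
    assume "A (fs ! p) k \<noteq> 0"
    then have "k \<in> Z \<union> set (take p fs)" using fs(1) p k(1) unfolding chain_def q_def by blast
    then obtain j where "j < p" "k = fs ! j" using k(2) by (auto simp: in_set_conv_nth)
    then show False using k(3) by blast
  qed
  have sub: "A (fs ! Suc p) (fs ! p) \<noteq> 0" if "Suc p < q" for p
    using chain_subdiag[OF fs(1)] that by (simp add: q_def)
  \<comment> \<open>This square is nonzero and lies in the span of \<open>Z\<close>. It replaces the
    unit vector \<open>k0\<close>, at which it has a nonzero coordinate.\<close>
  define z where "z k = (if k < n then A (fs ! 0) k else 0)" for k
  have zZ: "z k = 0" if "k \<notin> Z" for k using row[OF q _ that] by (simp add: z_def)
  obtain k0 where k0: "k0 \<in> Z" "z k0 \<noteq> 0"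
  proof -
    obtain k where "k < n" "A (fs ! 0) k \<noteq> 0" using fn(1,2)[OF q] by (auto simp: Z_def)
    then have "z k \<noteq> 0" by (simp add: z_def)
    then show ?thesis using zZ that by blast
  qed
  have k0n: "k0 < n" using k0(1) by (simp add: Z_def)
  define zs where "zs = sorted_list_of_set (Z - {k0})"
  define r where "r = length zs"
  have zs: "distinct zs" "set zs = Z - {k0}" using fin by (auto simp: zs_def)
  have "card (insert i (Z \<union> set fs)) = Suc (card Z + q)"
  proof -
    have "Z \<inter> set fs = {}" using fs(1) by (auto simp: chain_def)
    then have "card (Z \<union> set fs) = card Z + q"
      using fin distinct_card[OF d] by (simp add: card_Un_disjoint q_def)
    then show ?thesis using i(2) fin by simp
  qed
  moreover have "card Z = Suc r"
    using card_Suc_Diff1[OF fin k0(1)] distinct_card[OF zs(1)] unfolding zs(2) r_def by simp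
  ultimately have n: "n = Suc (Suc (q + r))" unfolding i(3) by simp
  have zsZ: "zs ! j \<in> Z" "zs ! j \<noteq> k0" "zs ! j < n" if "j < r" for j
  proof -
    have "zs ! j \<in> Z - {k0}" using that zs(2) nth_mem unfolding r_def by blast
    then show "zs ! j \<in> Z" "zs ! j \<noteq> k0" "zs ! j < n" by (auto simp: Z_def)
  qed
  have cover: "k = i \<or> k \<in> Z \<or> (\<exists>p<q. k = fs ! p)" if "k < n" for k
  proof -
    have "k \<in> insert i (Z \<union> set fs)" unfolding i(3) using that by simp
    then show ?thesis by (auto simp: in_set_conv_nth q_def)
  qed
  \<comment> \<open>Adding annihilator elements to the chain vectors removes the annihilator part of the square of each of
    them but the first.\<close>
  have "\<exists>c. \<forall>p<q - 1. (\<Sum>j<Suc p. A (fs ! Suc p) (fs ! j) * c j) = A (fs ! Suc p) k" for k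
    using sub by (intro triangular_system_solution) auto
  then obtain c where c: "\<And>k p. Suc p < q \<Longrightarrow>
      (\<Sum>j<Suc p. A (fs ! Suc p) (fs ! j) * c k j) = A (fs ! Suc p) k"
    by (metis less_diff_conv Suc_eq_plus1)
  define g where "g p = (\<lambda>k. if k = fs ! p then 1 else if k \<in> Z then c k p else 0)" for p
  have gZ: "g p k = 0" if "k \<notin> Z" "k \<noteq> fs ! p" for p k using that by (simp add: g_def)
  have gsq: "mult n (evo A) (g p) (g p) = (\<lambda>k. if k < n then A (fs ! p) k else 0)" if "p < q" for p
    using mult_single[OF fn(1)[OF that], of "g p"] gZ[of _ p] by (auto simp: g_def)
  \<comment> \<open>On \<open>Z\<close> this is the choice of \<open>c\<close>; at a chain index
    only the matching \<open>g j\<close> contributes, and at \<open>i\<close> both sides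
    vanish.\<close>
  have gsum: "(if k < n then A (fs ! p) k else 0) = (\<Sum>j<p. A (fs ! p) (fs ! j) * g j k)"
    if p: "0 < p" "p < q" for p k
  proof (cases "k < n")
    case False
    have "g j k = 0" if "j < p" for j
      using False fn(1)[of j] that p by (intro gZ) (auto simp: Z_def)
    then show ?thesis using False by simp
  next
    case True
    then consider "k = i" | "k \<in> Z" | m where "m < q" "k = fs ! m" using cover by blast
    then show ?thesis
    proof cases
      case 1
      have "g j k = 0" if "j < p" for j using 1 i(2) fn(3)[of j] that p by (intro gZ) auto
      moreover have "k \<noteq> fs ! j" if "j < p" for j using 1 fn(3)[of j] p that by auto
      then have "A (fs ! p) k = 0" using row[OF p(2) True] 1 i(2) by blast
      ultimately show ?thesis by simp
    next
      case 2
      obtain p' where p': "p = Suc p'" using p(1) by (cases p) auto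
      have "(\<Sum>j<p. A (fs ! p) (fs ! j) * g j k) = (\<Sum>j<Suc p'. A (fs ! Suc p') (fs ! j) * c k j)"
        using 2 fn(2) p by (intro sum.cong) (auto simp: g_def p')
      then show ?thesis using c[of p' k] p p' True by simp
    next
      case 3
      have gk: "g j k = (if j = m then 1 else 0)" if "j < p" for j
        using 3 finj[of m j] that p fn(2)[of m] by (auto simp: g_def)
      show ?thesis
      proof (cases "m < p")
        case True
        then have "(\<Sum>j<p. A (fs ! p) (fs ! j) * g j k) = A (fs ! p) (fs ! m) * g m k"
          using gk by (intro sum_single) auto
        then show ?thesis using gk[OF True] 3 fn(1) by simp
      next
        case False
        then have "(\<Sum>j<p. A (fs ! p) (fs ! j) * g j k) = 0" using gk by (intro sum.neutral) auto
        moreover have "k \<noteq> fs ! j" if "j < p" for j using 3 finj[of m j] False p that by auto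
        then have "A (fs ! p) k = 0" using row[OF p(2) \<open>k < n\<close>] 3 fn(2) by blast
        ultimately show ?thesis by simp
      qed
    qed
  qed
  \<comment> \<open>Index 0 stands for \<open>z\<close> and index \<open>p + 1\<close> for the chain
    vector \<open>p\<close>; row 1 records that the first chain vector squares to
    \<open>z\<close>.\<close>
  define D where "D i k = (if i = 0 then 0 else if i = 1 then (if k = 0 then 1 else 0)
    else if 0 < k \<and> k < i then A (fs ! (i - 1)) (fs ! (k - 1)) else 0)" for i k :: nat
  have D: "strict_lower (Suc q) D" "subdiag_nonzero (Suc q) D"
  proof -
    show "strict_lower (Suc q) D" by (auto simp: strict_lower_def D_def split: if_splits)
    show "subdiag_nonzero (Suc q) D"
      unfolding subdiag_nonzero_def
    proof (intro allI impI)
      fix p assume "Suc p < Suc q"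
      then show "D (Suc p) p \<noteq> 0" using sub[of "p - 1"] by (cases p) (auto simp: D_def)
    qed
  qed
  define D' where "D' i k = (if i = 0 then (if k = 0 then 1 else 0)
     else if 0 < k \<and> i \<le> Suc q \<and> k \<le> Suc q then D (i - 1) (k - 1) else 0)" for i k :: nat
  define b where "b l = (if l = 0 then u else if l = 1 then z
    else if l < Suc (Suc q) then g (l - 2) else uv (zs ! (l - Suc (Suc q))))" for l
  have b: "b 0 = u" "b 1 = z" "\<And>p. p < q \<Longrightarrow> b (Suc (Suc p)) = g p" "\<And>j. b (Suc (Suc (q + j))) = uv (zs ! j)"
    by (auto simp: b_def)
  have idx: "l = 0 \<or> l = 1 \<or> (\<exists>p<q. l = Suc (Suc p)) \<or> (\<exists>j<r. l = Suc (Suc (q + j)))" if "l < n" for l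
  proof -
    consider "l = 0" | "l = 1" | "2 \<le> l" "l < Suc (Suc q)" | "Suc (Suc q) \<le> l" by linarith
    then show ?thesis
    proof cases
      case 3
      then have "l - 2 < q" "l = Suc (Suc (l - 2))" by auto
      then show ?thesis by blast
    next
      case 4
      then have "l - Suc (Suc q) < r" "l = Suc (Suc (q + (l - Suc (Suc q))))" using that n by auto
      then show ?thesis by blast
    qed auto
  qed
  \<comment> \<open>The one index outside \<open>Z\<close> at which \<open>b l\<close> does not
    vanish, for the idempotent and the chain vectors; the other basis vectors are supported on
    \<open>Z\<close>. Distinct cores give zero products and independence.\<close>
  define core where "core l = (if l = 0 then i else fs ! (l - 2))" for l
  have bcore: "b l k = 0" if l: "l < n" and k: "k \<notin> Z" "\<not> (k = core l \<and> (l = 0 \<or> 2 \<le> l \<and> l < Suc (Suc q)))" for l k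
    using idx[OF l]
  proof (elim disjE exE conjE)
    assume "l = 0"
    then show ?thesis using u(4) k by (simp add: b(1) core_def)
  next
    assume "l = 1"
    then show ?thesis using zZ[OF k(1)] b(2) by simp
  next
    fix p assume p: "p < q" "l = Suc (Suc p)"
    then show ?thesis using gZ[OF k(1), of p] k(2) by (simp add: b(3) core_def)
  next
    fix j assume j: "j < r" "l = Suc (Suc (q + j))"
    then show ?thesis using zsZ(1)[OF j(1)] k(1) unfolding j(2) b(4) by (auto simp: uv_def)
  qed
  have core_idx: "l = 0 \<or> (\<exists>p<q. l = Suc (Suc p))" if "l = 0 \<or> 2 \<le> l \<and> l < Suc (Suc q)" for l
    using that by (cases l; cases "l - 1") auto
  have coreinj: "core l \<noteq> core m" if "l \<noteq> m" "l = 0 \<or> 2 \<le> l \<and> l < Suc (Suc q)" "m = 0 \<or> 2 \<le> m \<and> m < Suc (Suc q)" for l m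
    using core_idx[OF that(2)] core_idx[OF that(3)] that(1)
    by (elim disjE exE conjE) (simp_all add: core_def fn(3) fn(3)[THEN not_sym] finj)
  have "alg_iso n (evo D') n (evo A)"
  proof (rule alg_iso_evo_of_basis[where b = b])
    fix l assume l: "l < n"
    show "b l \<in> Vn n"
      using idx[OF l]
    proof (elim disjE exE conjE)
      fix p assume p: "p < q" "l = Suc (Suc p)"
      have "g p k = 0" if "n \<le> k" for k
        using fn(1)[OF p(1)] that by (intro gZ) (auto simp: Z_def)
      then show ?thesis using p by (simp add: b(3) Vn_def)
    next
      fix j assume "j < r" "l = Suc (Suc (q + j))"
      then show ?thesis using zsZ(3) b(4) by simp
    qed (use u(1) b in \<open>auto simp: z_def Vn_def\<close>)
    show "mult n (evo A) (b l) (b m) = zv" if "m < n" "l \<noteq> m" for m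
      using bcore[OF l] bcore[OF that(1)] coreinj[OF that(2)] by (intro mult_disjoint) metis
    show "mult n (evo A) (b l) (b l) = (\<lambda>k. \<Sum>m<n. D' l m * b m k)"
      using idx[OF l]
    proof (elim disjE exE conjE)
      assume l0: "l = 0"
      have "(\<Sum>m<n. D' l m * b m k) = D' l 0 * b 0 k" for k
        using n by (intro sum_single) (auto simp: D'_def l0)
      then show ?thesis using u(2) by (simp add: l0 b(1) D'_def)
    next
      assume l1: "l = 1"
      have "mult n (evo A) z z = zv" using zZ by (intro mult_disjoint) auto
      moreover have "D' 1 m = 0" for m by (simp add: D'_def D_def)
      ultimately show ?thesis unfolding l1 b(2) by (simp add: zv_def)
    next
      fix p assume p: "p < q" "l = Suc (Suc p)"
      have "(if k < n then A (fs ! p) k else 0) = (\<Sum>m<n. D' l m * b m k)" for k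
      proof (cases "p = 0")
        case True
        have "(\<Sum>m<n. D' l m * b m k) = D' l 1 * b 1 k"
          using n by (intro sum_single) (auto simp: D'_def D_def p(2) True)
        then show ?thesis using p True b(2) by (simp add: D'_def D_def z_def)
      next
        case False
        have "(\<Sum>m<n. D' l m * b m k) = (\<Sum>m\<in>(\<lambda>j. Suc (Suc j)) ` {..<p}. D' l m * b m k)"
        proof (rule sum.mono_neutral_right)
          show "(\<lambda>j. Suc (Suc j)) ` {..<p} \<subseteq> {..<n}" using p n by auto
          show "\<forall>m\<in>{..<n} - (\<lambda>j. Suc (Suc j)) ` {..<p}. D' l m * b m k = 0"
          proof
            fix m assume m: "m \<in> {..<n} - (\<lambda>j. Suc (Suc j)) ` {..<p}"
            have "\<not> (2 \<le> m \<and> m < Suc (Suc p))"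
            proof
              assume "2 \<le> m \<and> m < Suc (Suc p)"
              then have "m = Suc (Suc (m - 2))" "m - 2 < p" by auto
              then show False using m by blast
            qed
            then show "D' l m * b m k = 0" using p False by (auto simp: D'_def D_def)
          qed
        qed simp
        also have "\<dots> = (\<Sum>j<p. D' l (Suc (Suc j)) * b (Suc (Suc j)) k)"
          by (subst sum.reindex) (auto simp: inj_on_def)
        also have "\<dots> = (\<Sum>j<p. A (fs ! p) (fs ! j) * g j k)"
        proof (intro sum.cong refl)
          fix j assume j: "j \<in> {..<p}"
          have "D' l (Suc (Suc j)) = A (fs ! p) (fs ! j)" using p j False by (auto simp: D'_def D_def)
          then show "D' l (Suc (Suc j)) * b (Suc (Suc j)) k = A (fs ! p) (fs ! j) * g j k"
            using b(3)[of j] p j by simp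
        qed
        finally show ?thesis using gsum[of p k] False p by simp
      qed
      then show ?thesis using gsq[OF p(1)] b(3)[OF p(1)] p(2) by simp
    next
      fix j assume j: "j < r" "l = Suc (Suc (q + j))"
      have "mult n (evo A) (b l) (b l) = zv" using bcore[OF l] j by (intro mult_disjoint) auto
      moreover have "D' l m = 0" for m using j by (simp add: D'_def)
      ultimately show ?thesis by (simp add: zv_def)
    qed
  next
    fix a assume a: "\<And>k. k < n \<Longrightarrow> (\<Sum>l<n. a l * b l k) = 0"
    \<comment> \<open>The coefficients of the idempotent and of the chain vectors are read off at
      their cores, then that of \<open>z\<close> at \<open>k0\<close>, and finally those of the
      remaining unit vectors of \<open>Z\<close>.\<close>
    have core: "a m = 0" if m: "m < n" "m = 0 \<or> 2 \<le> m \<and> m < Suc (Suc q)" for m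
    proof -
      have cZ: "core m \<notin> Z" "core m < n" 
        using core_idx[OF m(2)] i(1,2) fn(1,2) by (auto simp: core_def)
      have "(\<Sum>l<n. a l * b l (core m)) = a m * b m (core m)"
      proof (rule sum_single[OF m(1)])
        fix l assume l: "l < n" "l \<noteq> m"
        then have "b l (core m) = 0" using bcore[OF l(1) cZ(1)] coreinj[of l m] m(2) by metis
        then show "a l * b l (core m) = 0" by simp
      qed
      moreover have "b m (core m) \<noteq> 0"
        using core_idx[OF m(2)] u(3) b(3) by (auto simp: core_def b(1) g_def)
      ultimately show ?thesis using a[OF cZ(2)] by simp
    qed
    have rest: "l = 1 \<or> (\<exists>j<r. l = Suc (Suc (q + j))) \<or> a l = 0" if "l < n" for l
      using idx[OF that] core[OF that] by auto
    have "(\<Sum>l<n. a l * b l k0) = a 1 * b 1 k0"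
    proof (rule sum_single)
      fix l assume l: "l < n" "l \<noteq> 1"
      show "a l * b l k0 = 0"
        using rest[OF l(1)] l(2) zsZ(2)[THEN not_sym] b(4) by (auto simp: uv_def)
    qed (use n in simp)
    then have a1: "a 1 = 0" using a[OF k0n] k0(2) b(2) by simp
    have "a (Suc (Suc (q + j))) = 0" if j: "j < r" for j
    proof -
      have "(\<Sum>l<n. a l * b l (zs ! j)) = a (Suc (Suc (q + j))) * b (Suc (Suc (q + j))) (zs ! j)"
      proof (rule sum_single)
        fix l assume l: "l < n" "l \<noteq> Suc (Suc (q + j))"
        have "b l (zs ! j) = 0" if "j' < r" "l = Suc (Suc (q + j'))" for j'
          using that l(2) j zs(1) unfolding that(2) b(4) r_def by (auto simp: uv_def nth_eq_iff_index_eq)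
        then show "a l * b l (zs ! j) = 0" using rest[OF l(1)] a1 by auto
      qed (use n j in simp)
      then show ?thesis using a[OF zsZ(3)[OF j]] unfolding b(4) by (simp add: uv_def)
    qed
    then show "\<forall>l<n. a l = 0" using rest a1 by blast
  qed
  moreover have "evo D' = A2 n (Suc q) (evo D)" unfolding A2_evo D'_def ..
  ultimately show ?thesis using D n by (auto simp: q_def[symmetric])
qed

end

theorem theorem3p3:
  fixes n :: nat and c :: sconst
  assumes "is_evolution n c" and "complete_evo n c" and "\<not> nilpotent n c"
  shows "(alg_iso n c n (A1 n) \<or>
          (\<exists>s d. 2 \<le> s \<and> s \<le> n - 1 \<and> max_nil_index s d \<and> alg_iso n c n (A2 n s d)))
       \<and> (\<forall>s d. 2 \<le> s \<and> s \<le> n - 1 \<and> max_nil_index s d \<longrightarrow> \<not> alg_iso n (A1 n) n (A2 n s d))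
       \<and> (\<forall>s d s' d'. 2 \<le> s \<and> s \<le> n - 1 \<and> max_nil_index s d \<and>
                       2 \<le> s' \<and> s' \<le> n - 1 \<and> max_nil_index s' d' \<and>
                       alg_iso n (A2 n s d) n (A2 n s' d') \<longrightarrow> s = s' \<and> alg_iso s d s' d')"
proof (intro conjI)
  obtain A where A: "alg_iso n c n (evo A)" using evolution_iso_evo[OF assms(1)] by blast
  interpret split_evo n A
    using ann_complemented_iso[OF alg_iso_sym[OF A] complete_evo_ann_complemented[OF assms(2)]]
    by unfold_locales
  have "\<not> nilpotent n (evo A)" using alg_iso_nilpotent[OF A] assms(3) by simp
  then obtain fs i where fs: "chain fs"
    and i: "i < n" "i \<notin> Z \<union> set fs" "insert i (Z \<union> set fs) = {..<n}" "A i i \<noteq> 0"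
    using chain_and_loop by blast
  obtain u where u: "u \<in> Vn n" "mult n (evo A) u u = u" "u i \<noteq> 0"
      "\<forall>k. k \<noteq> i \<longrightarrow> k \<notin> Z \<longrightarrow> u k = 0"
    using idempotent_exists[OF fs i] by blast
  show "alg_iso n c n (A1 n) \<or>
      (\<exists>s d. 2 \<le> s \<and> s \<le> n - 1 \<and> max_nil_index s d \<and> alg_iso n c n (A2 n s d))"
  proof (cases "fs = []")
    case True
    then have "alg_iso n (A1 n) n (evo A)" using i u by (intro iso_A1[of i u]) auto
    then show ?thesis using alg_iso_trans[OF A alg_iso_sym] by blast
  next
    case False
    \<comment> \<open>The extra dimension is the square of the first chain vector; a nonempty chain
      thus gives \<open>?s\<close> at least 2.\<close>
    let ?s = "Suc (length fs)"
    obtain D where D: "?s < n" "strict_lower ?s D" "subdiag_nonzero ?s D"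
        "alg_iso n (A2 n ?s (evo D)) n (evo A)"
      using iso_A2[OF fs False i(1-3) u] by blast
    have "max_nil_index ?s (evo D)" using max_nil_index_evo[OF D(2,3)] by simp
    moreover have "alg_iso n c n (A2 n ?s (evo D))" using alg_iso_trans[OF A alg_iso_sym[OF D(4)]] .
    moreover have "2 \<le> ?s" "?s \<le> n - 1" using False D(1) by (auto simp: Suc_le_eq)
    ultimately show ?thesis by blast
  qed
next
  show "\<forall>s d. 2 \<le> s \<and> s \<le> n - 1 \<and> max_nil_index s d \<longrightarrow> \<not> alg_iso n (A1 n) n (A2 n s d)"
    using A1_not_iso_A2 by auto
next
  show "\<forall>s d s' d'. 2 \<le> s \<and> s \<le> n - 1 \<and> max_nil_index s d \<and>
      2 \<le> s' \<and> s' \<le> n - 1 \<and> max_nil_index s' d' \<and>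
      alg_iso n (A2 n s d) n (A2 n s' d') \<longrightarrow> s = s' \<and> alg_iso s d s' d'"
  proof (intro allI impI)
    fix s d s' d'
    assume h: "2 \<le> s \<and> s \<le> n - 1 \<and> max_nil_index s d \<and> 2 \<le> s' \<and> s' \<le> n - 1 \<and>
      max_nil_index s' d' \<and> alg_iso n (A2 n s d) n (A2 n s' d')"
    then have "s < n" "s' < n" by auto
    then show "s = s' \<and> alg_iso s d s' d'" using h A2_iso_imp_nil_iso by blast
  qed
qed

end
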